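(* Let $q$ be an odd prime power, fixed. Fix an integer $m\ge0$ and $c_0,\dots,c_m\in\mathbb F_q$ with $c_m\neq0$. For each $n$ let $\ell_n$ be an arbitrary $\mathbb F_q$-linear form in the coefficients $f_0,\dots,f_n$, and for $f=t^n+f_{n-1}t^{n-1}+\cdots+f_0$ (with $f_n=1$) put \[ Q_A(f)=\sum_{j=0}^m c_j\sum_{i=j}^n f_if_{i-j}+\ell_n(f). \] Then for every $\gamma\in\mathbb F_q$, \[ \#\{f\in\mathcal P(n):Q_A(f)=\gamma\}=\frac{\#\mathcal P(n)}{q}+O_A\bigl(q^{19n/20+o(n)}\bigr) \] as $n\to\infty$ with $q$ and $c_0,\dots,c_m$ fixed, uniformly in the choice of the linear forms $\ell_n$.
   Context: $\mathbb F_q$ is the finite field with $q$ elements, $\mathcal P(n)$ denotes the set of monic irreducible polynomials of degree $n$ in $\mathbb F_q[t]$. The implied constant in $O_A$ depends only on $q$ and $c_0,\dots,c_m$; $q^{o(n)}$ denotes a factor $q^{\varepsilon(n)n}$ with $\varepsilon(n)\to0$ as $n\to\infty$. *)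

theory Defs
  imports "HOL-Computational_Algebra.Computational_Algebra"
begin

definition monic_irred :: "nat \<Rightarrow> ('a::{finite,field}) poly set" where
  "monic_irred n = {f. lead_coeff f = 1 \<and> irreducible f \<and> degree f = n}"

definition QA :: "nat \<Rightarrow> (nat \<Rightarrow> 'a::field) \<Rightarrow> nat \<Rightarrow> (nat \<Rightarrow> 'a) \<Rightarrow> 'a poly \<Rightarrow> 'a" where
  "QA m c n a f =
     (\<Sum>j=0..m. c j * (\<Sum>i=j..n. coeff f i * coeff f (i - j)))
     + (\<Sum>i=0..n. a i * coeff f i)"

end

theory Submission
  imports Defs "HOL-Analysis.Convex"
begin

text \<open>
  By orthogonality of additive characters it suffices to bound the sum of \<open>\<psi> (Q f)\<close> over irreducible
  \<open>f\<close> for a nontrivial character \<open>\<psi>\<close>. Vaughan's identity with both cut-offs at \<open>n div 5\<close> splits it into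
  sums over factorisations \<open>f = g * h\<close>. For fixed \<open>g\<close>, the polar form of \<open>h \<mapsto> Q (g * h)\<close> is an even
  Toeplitz form whose symbol is the correlation of \<open>g\<close> with itself, smoothed by the symbol of \<open>Q\<close>; the
  exponential sum over \<open>h\<close> is controlled by the size of the kernel of this form.

  Type I: the symbol is nonzero of band width at most \<open>m + deg g\<close>, hence the kernel has at most
  \<open>q ^ (m + deg g)\<close> elements.

  Type II: after Cauchy--Schwarz one needs the average size of the kernel for the difference of the symbols
  of \<open>g\<close> and \<open>g'\<close>, where \<open>deg g = deg g' = k \<le> N = deg h\<close>. The symbol of \<open>g\<close> determines \<open>g * g\<^sup>*\<close>,
  where \<open>g\<^sup>*\<close> is the reversal of \<open>g\<close>, so by the divisor bound a given difference arises from at most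
  \<open>q ^ (k + o(n))\<close> pairs. Summing
  over all even symbols, duality turns the kernel count into the number of pairs \<open>(v, w)\<close> with
  \<open>v * w\<^sup>*\<close> antisymmetric, which the divisor bound estimates by \<open>q ^ (N + o(n))\<close>. This saves a factor
  \<open>q ^ (k / 4)\<close>, and \<open>k > n / 5\<close> gives the exponent \<open>19 n / 20\<close>.
\<close>

subsection \<open>Monic polynomials and the divisor bound\<close>

text \<open>No bound for a single pair \<open>(g, g')\<close> is possible: if \<open>g\<close> and
  \<open>g'\<close> have the same product with their reversals, the difference symbol is zero and
  the kernel is the whole space. Only averages help. Averaged over all even symbols a kernel has
  \<open>q ^ o(n)\<close> elements; the differences lie in a space of \<open>q ^ (N + m + 1)\<close>
  symbols, each reached from at most \<open>q ^ (k + o(n))\<close> of the \<open>q ^ (2 * k)\<close>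
  pairs. Hence the average kernel over pairs is at most about \<open>q ^ (N - k)\<close>, the sums
  over \<open>h\<close> have mean size \<open>q ^ (N - k / 2)\<close>, and the Cauchy--Schwarz step
  that created the pairs halves this saving: this is where \<open>k / 4\<close> comes from. A Type I
  sum over \<open>h\<close> is \<open>O(q ^ (n / 2))\<close> however \<open>n\<close> is split; its
  outer variable has degree at most \<open>2 * n / 5\<close>, giving \<open>9 * n / 10\<close>, so
  Type II decides the exponent. The linear forms are additive, so differencing moves them into
  factors of modulus one; this gives the uniformity. The divisor bound is carried as a free
  parameter \<open>D\<close>, valid up to degree \<open>2 * n\<close> and fixed only at the end,
  once for each \<delta> > 0; only then is the limit \<delta> to 0 taken.\<close>

definition poly_below :: "nat \<Rightarrow> 'a::zero poly set" where
  "poly_below N = {f. \<forall>i\<ge>N. coeff f i = 0}"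

definition monics :: "nat \<Rightarrow> 'a::field poly set" where
  "monics n = {f. lead_coeff f = 1 \<and> degree f = n}"

text \<open>Monic divisors represent the divisors up to units, so \<open>card (mdivs f)\<close> is
  the usual divisor function, also for \<open>f\<close> that is not monic.\<close>

definition mdivs :: "'a::field poly \<Rightarrow> 'a poly set" where
  "mdivs f = {d. lead_coeff d = 1 \<and> d dvd f}"

lemma poly_below_Suc:
  "poly_below (Suc N) = (\<lambda>(a, p). pCons a p) ` (UNIV \<times> poly_below N)"
proof (intro equalityI subsetI)
  fix f :: "'a poly" assume f: "f \<in> poly_below (Suc N)"
  obtain a p where ap: "f = pCons a p" by (cases f)
  have "coeff p i = 0" if "i \<ge> N" for i
  proof -
    have "coeff f (Suc i) = 0" using f that by (auto simp: poly_below_def)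
    thus ?thesis by (simp add: ap)
  qed
  thus "f \<in> (\<lambda>(a, p). pCons a p) ` (UNIV \<times> poly_below N)"
    by (auto simp: ap poly_below_def)
qed (auto simp: poly_below_def coeff_pCons split: nat.splits)

lemma finite_card_poly_below:
  "finite (poly_below N :: 'a::{finite,zero} poly set)
   \<and> card (poly_below N :: 'a poly set) = card (UNIV :: 'a set) ^ N"
proof (induction N)
  case 0
  have "poly_below 0 = {0 :: 'a poly}" by (auto simp: poly_below_def poly_eq_iff)
  thus ?case by simp
next
  case (Suc N)
  have "inj_on (\<lambda>(a, p). pCons a p) (UNIV \<times> (poly_below N :: 'a poly set))"
    by (auto simp: inj_on_def)
  with Suc show ?case
    unfolding poly_below_Suc by (simp add: card_image card_cartesian_product)
qed

lemma finite_poly_below [simp, intro]: "finite (poly_below N :: 'a::{finite,zero} poly set)"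
  and card_poly_below: "card (poly_below N :: 'a poly set) = card (UNIV :: 'a set) ^ N"
  using finite_card_poly_below by blast+

lemma monics_eq_image: "monics n = (\<lambda>v. monom 1 n + v) ` poly_below n"
proof (intro equalityI subsetI)
  fix f :: "'a poly" assume "f \<in> monics n"
  hence f: "lead_coeff f = 1" "degree f = n" by (auto simp: monics_def)
  have "f - monom 1 n \<in> poly_below n"
    using f by (auto simp: poly_below_def coeff_eq_0 le_less)
  thus "f \<in> (\<lambda>v. monom 1 n + v) ` poly_below n"
    by (intro image_eqI[of _ _ "f - monom 1 n"]) auto
next
  fix f :: "'a poly" assume "f \<in> (\<lambda>v. monom 1 n + v) ` poly_below n"
  then obtain v where v: "f = monom 1 n + v" "\<forall>i\<ge>n. coeff v i = 0"
    by (auto simp: poly_below_def)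
  have c: "coeff f n = 1" using v by simp
  have "degree f \<le> n" by (rule degree_le) (use v in auto)
  moreover have "n \<le> degree f" by (rule le_degree) (simp add: c)
  ultimately show "f \<in> monics n" using c by (simp add: monics_def)
qed

lemma finite_monics [simp, intro]: "finite (monics n :: 'a::{finite,field} poly set)"
  by (simp add: monics_eq_image)

lemma card_monics: "card (monics n :: 'a::{finite,field} poly set) = card (UNIV :: 'a set) ^ n"
  by (simp add: monics_eq_image card_image inj_on_def card_poly_below)

lemma monics_0: "monics 0 = {1}"
proof -
  have "f = 1" if "lead_coeff f = 1" "degree f = 0" for f :: "'a poly"
    using that by (auto elim!: degree_eq_zeroE simp: one_pCons)
  thus ?thesis by (auto simp: monics_def)
qed

lemma monics_nonzero: "f \<in> monics n \<Longrightarrow> f \<noteq> 0"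
  by (auto simp: monics_def)

lemma monics_mult: "f \<in> monics i \<Longrightarrow> g \<in> monics j \<Longrightarrow> f * g \<in> monics (i + j)"
  using degree_mult_eq[of f g] lead_coeff_mult[of f g]
  by (cases "f = 0"; cases "g = 0") (auto simp: monics_def)

lemma monic_cofactor:
  fixes d :: "'a::field poly"
  assumes "lead_coeff (d * e) = 1" "lead_coeff d = 1"
  shows "lead_coeff e = 1"
  using assms by (simp add: lead_coeff_mult)

lemma mdivs_cofactor:
  fixes f :: "'a::field poly"
  assumes "f \<in> monics n" "d \<in> mdivs f"
  shows "d * (f div d) = f" "d \<in> monics (degree d)" "degree d \<le> n" "f div d \<in> monics (n - degree d)"
proof -
  show *: "d * (f div d) = f" using assms by (auto simp: mdivs_def)
  show d: "d \<in> monics (degree d)" using assms by (auto simp: mdivs_def monics_def)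
  have "d \<noteq> 0" "f \<noteq> 0" using assms by (auto simp: mdivs_def monics_def)
  have nz: "f div d \<noteq> 0" using * \<open>f \<noteq> 0\<close> by auto
  have "degree (d * (f div d)) = degree d + degree (f div d)"
    using \<open>d \<noteq> 0\<close> nz by (rule degree_mult_eq)
  hence deg: "n = degree d + degree (f div d)" using assms * by (simp add: monics_def)
  thus "degree d \<le> n" by simp
  have "lead_coeff (f div d) = 1"
    by (rule monic_cofactor[of d]) (use assms * in \<open>auto simp: monics_def mdivs_def\<close>)
  thus "f div d \<in> monics (n - degree d)" using deg by (simp add: monics_def)
qed

lemma finite_mdivs [simp, intro]:
  fixes f :: "'a::{finite,field} poly"
  assumes "f \<noteq> 0"
  shows "finite (mdivs f)"
proof (rule finite_subset)
  show "mdivs f \<subseteq> (\<Union>i\<le>degree f. monics i)"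
    using dvd_imp_degree_le[OF _ assms] by (auto simp: mdivs_def monics_def)
qed auto

text \<open>Reindexing by \<open>(f, d)\<close> to \<open>(degree d, d, f div d)\<close>. It carries
  Dirichlet convolutions over to double sums with separated degrees.\<close>

lemma sum_monics_mdivs:
  fixes G :: "'a::{finite,field} poly \<Rightarrow> 'a poly \<Rightarrow> 'b::comm_monoid_add"
  shows "(\<Sum>f\<in>monics n. \<Sum>d\<in>mdivs f. G d (f div d))
       = (\<Sum>i\<le>n. \<Sum>d\<in>monics i. \<Sum>h\<in>monics (n - i). G d h)"
proof -
  have fin: "finite (mdivs f)" if "f \<in> monics n" for f :: "'a poly"
    using that by (simp add: monics_nonzero)
  have "(\<Sum>f\<in>monics n. \<Sum>d\<in>mdivs f. G d (f div d))
      = (\<Sum>(f, d)\<in>Sigma (monics n) mdivs. G d (f div d))"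
    using fin by (subst sum.Sigma) auto
  also have "\<dots> = (\<Sum>(i, d, h)\<in>Sigma {..n} (\<lambda>i. monics i \<times> monics (n - i)). G d h)"
  proof (rule sum.reindex_bij_witness[of _ "\<lambda>(i, d, h). (d * h, d)" "\<lambda>(f, d). (degree d, d, f div d)"])
    fix a :: "'a poly \<times> 'a poly" assume "a \<in> Sigma (monics n) mdivs"
    then obtain f d where a: "a = (f, d)" "f \<in> monics n" "d \<in> mdivs f" by auto
    note c = mdivs_cofactor[OF a(2,3)]
    show "(case case a of (f, d) \<Rightarrow> (degree d, d, f div d) of (i :: nat, d, h) \<Rightarrow> (d * h, d)) = a"
      using c by (simp add: a)
    show "(case a of (f, d) \<Rightarrow> (degree d, d, f div d)) \<in> Sigma {..n} (\<lambda>i. monics i \<times> monics (n - i))"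
      using c by (simp add: a)
    show "(case case a of (f, d) \<Rightarrow> (degree d, d, f div d) of (i, d, h) \<Rightarrow> G d h) = (case a of (f, d) \<Rightarrow> G d (f div d))"
      by (simp add: a)
  next
    fix b :: "nat \<times> 'a poly \<times> 'a poly" assume "b \<in> Sigma {..n} (\<lambda>i. monics i \<times> monics (n - i))"
    then obtain i d h where b: "b = (i, d, h)" "i \<le> n" "d \<in> monics i" "h \<in> monics (n - i)" by auto
    have "d \<noteq> 0" using b by (simp add: monics_nonzero)
    thus "(case case b of (i, d, h) \<Rightarrow> (d * h, d) of (f, d) \<Rightarrow> (degree d, d, f div d)) = b"
      using b by (simp add: monics_def)
    have "d * h \<in> monics n" using monics_mult[OF b(3,4)] b(2) by simp
    thus "(case b of (i, d, h) \<Rightarrow> (d * h, d)) \<in> Sigma (monics n) mdivs"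
      using b by (auto simp: mdivs_def monics_def)
  qed
  also have "\<dots> = (\<Sum>i\<le>n. \<Sum>d\<in>monics i. \<Sum>h\<in>monics (n - i). G d h)"
    by (subst sum.Sigma[symmetric]) (auto simp: sum.Sigma intro!: sum.cong)
  finally show ?thesis .
qed

section \<open>Factorisation into monic irreducible polynomials\<close>

abbreviation monic_prime :: "'a::field poly \<Rightarrow> bool" where
  "monic_prime p \<equiv> lead_coeff p = 1 \<and> irreducible p"

lemma monic_prime_degree_pos:
  fixes p :: "'a::field poly"
  assumes "monic_prime p"
  shows "degree p > 0"
proof (rule ccontr)
  assume "\<not> degree p > 0"
  hence "p \<in> monics 0" using assms by (simp add: monics_def)
  hence "p = 1" by (simp add: monics_0)
  thus False using assms by (auto simp: irreducible_def)
qed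

lemma dvd_monic_eq:
  fixes p r :: "'a::field poly"
  assumes "monic_prime p" "monic_prime r" "p dvd r"
  shows "p = r"
proof -
  obtain e where e: "r = p * e" using assms(3) by blast
  have "\<not> p dvd 1" using assms(1) by (auto simp: irreducible_def)
  with e assms(2) have "e dvd 1" by (auto simp: irreducible_def)
  moreover have "e \<noteq> 0" using e assms(2) by auto
  ultimately have "degree e = 0" by (simp add: is_unit_iff_degree)
  moreover have "lead_coeff e = 1" using assms e monic_cofactor by blast
  ultimately have "e \<in> monics 0" by (simp add: monics_def)
  hence "e = 1" by (simp add: monics_0)
  thus ?thesis using e by simp
qed

lemma exists_monic_prime_dvd:
  fixes f :: "'a::field poly"
  assumes "degree f > 0"
  shows "\<exists>p. monic_prime p \<and> p dvd f"
  using assms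
proof (induction "degree f" arbitrary: f rule: less_induct)
  case less
  have nz: "f \<noteq> 0" using less.prems by auto
  have nu: "\<not> f dvd 1" using less.prems nz by (simp add: is_unit_iff_degree)
  show ?case
  proof (cases "irreducible f")
    case True
    define c where "c = inverse (lead_coeff f)"
    have c: "c \<noteq> 0" using nz by (simp add: c_def)
    have dv: "smult c f dvd f" "f dvd smult c f" using c by (simp_all add: smult_dvd_iff dvd_smult)
    have "irreducible (smult c f)"
    proof (rule irreducibleI)
      show "smult c f \<noteq> 0" using c nz by simp
      show "\<not> smult c f dvd 1" using nu dv dvd_trans by blast
      fix a b assume ab: "smult c f = a * b"
      hence "f = smult (inverse c) a * b" using c
        by (metis mult_smult_left smult_smult left_inverse smult_1_left)
      hence "smult (inverse c) a dvd 1 \<or> b dvd 1" using True by (rule irreducibleD[rotated])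
      thus "a dvd 1 \<or> b dvd 1" using c by (simp add: smult_dvd_iff)
    qed
    moreover have "lead_coeff (smult c f) = 1" using nz by (simp add: c_def)
    ultimately show ?thesis using dv by blast
  next
    case False
    then obtain a b where ab: "f = a * b" "\<not> a dvd 1" "\<not> b dvd 1"
      using nz nu by (auto simp: irreducible_def)
    have "a \<noteq> 0" "b \<noteq> 0" using nz ab by auto
    hence "degree a > 0" "degree b > 0" "degree f = degree a + degree b"
      using ab by (auto simp: is_unit_iff_degree degree_mult_eq)
    with less.hyps[of a] obtain p where "monic_prime p" "p dvd a" by auto
    thus ?thesis using ab by auto
  qed
qed

lemma monic_prime_dvd_mult_iff:
  fixes p :: "'a::field poly"
  assumes "monic_prime p"
  shows "p dvd a * b \<longleftrightarrow> p dvd a \<or> p dvd b"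
  using assms field_poly_irreducible_imp_prime prime_elem_dvd_mult_iff by blast

lemma monic_prime_dvd_power:
  fixes p :: "'a::field poly"
  assumes "monic_prime p" "p dvd a ^ n"
  shows "p dvd a"
  using assms field_poly_irreducible_imp_prime prime_elem_dvd_power by blast

lemma dvd_prime_power_mult:
  fixes p :: "'a::field poly"
  assumes "monic_prime p" "\<not> p dvd h" "h dvd p ^ e * g"
  shows "h dvd g"
  using assms(3)
proof (induction e)
  case (Suc e)
  then obtain k where k: "p * (p ^ e * g) = h * k" by (auto simp: dvd_def mult.assoc)
  hence "p dvd h * k" by (metis dvd_triv_left)
  hence "p dvd k" using assms monic_prime_dvd_mult_iff by blast
  then obtain k' where "k = p * k'" by blast
  with k have "p * (p ^ e * g) = p * (h * k')" by (simp add: ac_simps)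
  moreover have "p \<noteq> 0" using assms(1) by auto
  ultimately have "p ^ e * g = h * k'" by simp
  thus ?case using Suc.IH by simp
qed simp

lemma prime_power_split:
  fixes f :: "'a::field poly"
  assumes "monic_prime p" "f \<noteq> 0"
  shows "\<exists>e g. f = p ^ e * g \<and> \<not> p dvd g"
  using assms(2)
proof (induction "degree f" arbitrary: f rule: less_induct)
  case less
  show ?case
  proof (cases "p dvd f")
    case False
    thus ?thesis by (intro exI[of _ 0] exI[of _ f]) simp
  next
    case True
    then obtain h where h: "f = p * h" by blast
    hence "h \<noteq> 0" "p \<noteq> 0" using less.prems by auto
    hence "degree h < degree f"
      using monic_prime_degree_pos[OF assms(1)] by (simp add: h degree_mult_eq)
    from less.hyps[OF this \<open>h \<noteq> 0\<close>] obtain e g where "h = p ^ e * g" "\<not> p dvd g" by blast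
    thus ?thesis using h by (intro exI[of _ "Suc e"] exI[of _ g]) (simp add: mult.assoc)
  qed
qed

text \<open>The induction for multiplicative arguments: a full prime power is split off at a time,
  so that the remaining factor is coprime to \<open>p\<close>.\<close>

lemma monic_prime_power_induct [consumes 1, case_names one prime_power]:
  fixes f :: "'a::field poly"
  assumes "lead_coeff f = 1"
    and "P 1"
    and step: "\<And>p e g. monic_prime p \<Longrightarrow> e \<ge> 1 \<Longrightarrow> lead_coeff g = 1 \<Longrightarrow> \<not> p dvd g \<Longrightarrow> P g \<Longrightarrow> P (p ^ e * g)"
  shows "P f"
  using assms(1)
proof (induction "degree f" arbitrary: f rule: less_induct)
  case less
  show ?case
  proof (cases "degree f = 0")
    case True
    hence "f \<in> monics 0" using less.prems by (simp add: monics_def)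
    thus ?thesis using assms(2) by (simp add: monics_0)
  next
    case False
    then obtain p where p: "monic_prime p" "p dvd f" using exists_monic_prime_dvd[of f] by auto
    have "f \<noteq> 0" using False by auto
    obtain e g where eg: "f = p ^ e * g" "\<not> p dvd g"
      using prime_power_split[OF p(1) \<open>f \<noteq> 0\<close>] by metis
    have e: "e \<ge> 1" using eg p by (cases e) auto
    have g: "lead_coeff g = 1"
      using less.prems p(1) by (simp add: eg lead_coeff_mult lead_coeff_power)
    have nz: "g \<noteq> 0" "p \<noteq> 0" using g p by auto
    have "degree f = e * degree p + degree g"
      using nz by (simp add: eg degree_mult_eq degree_power_eq)
    moreover have "e * degree p > 0" using e monic_prime_degree_pos[OF p(1)] by simp
    ultimately have "degree g < degree f" by linarith
    from less.hyps[OF this g] show ?thesis using step[OF p(1) e g eg(2)] eg(1) by simp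
  qed
qed

lemma mdivs_1: "mdivs 1 = {1 :: 'a::field poly}"
proof -
  have "d = 1" if "lead_coeff d = 1" "d dvd 1" for d :: "'a poly"
  proof -
    have "d \<noteq> 0" using that by auto
    hence "d \<in> monics 0" using that by (simp add: monics_def is_unit_iff_degree)
    thus ?thesis by (simp add: monics_0)
  qed
  thus ?thesis by (auto simp: mdivs_def)
qed

lemma mdivs_prime_power_mult:
  fixes p g :: "'a::field poly"
  assumes "monic_prime p" "\<not> p dvd g"
  shows "mdivs (p ^ e * g) \<subseteq> (\<lambda>(i, d). p ^ i * d) ` ({..e} \<times> mdivs g)"
proof
  fix h assume h: "h \<in> mdivs (p ^ e * g)"
  hence h': "lead_coeff h = 1" "h dvd p ^ e * g" by (auto simp: mdivs_def)
  hence "h \<noteq> 0" by auto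
  then obtain i d where id: "h = p ^ i * d" "\<not> p dvd d"
    using prime_power_split[OF assms(1)] by metis
  have d: "lead_coeff d = 1" using h'(1) assms(1) by (simp add: id lead_coeff_mult lead_coeff_power)
  have "d dvd p ^ e * g" using h' id by (meson dvd_mult_right)
  hence "d dvd g" using dvd_prime_power_mult[OF assms(1) id(2)] by blast
  moreover have "i \<le> e"
  proof (rule ccontr)
    assume "\<not> i \<le> e"
    hence "p ^ Suc e dvd p ^ i" by (intro le_imp_power_dvd) simp
    hence "p ^ e * p dvd p ^ e * g" using h' id
      by (metis dvd_mult_left dvd_trans power_Suc2)
    moreover have "p ^ e \<noteq> 0" using assms(1) by auto
    ultimately show False using assms(2) by simp
  qed
  ultimately show "h \<in> (\<lambda>(i, d). p ^ i * d) ` ({..e} \<times> mdivs g)"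
    using d id by (auto simp: mdivs_def)
qed

text \<open>One step of the multiplicativity of the divisor function; the factor
  \<open>e + 1\<close> counts the possible exponents of \<open>p\<close>.\<close>

lemma card_mdivs_prime_power_mult:
  fixes p g :: "'a::{finite,field} poly"
  assumes "monic_prime p" "\<not> p dvd g" "g \<noteq> 0"
  shows "card (mdivs (p ^ e * g)) \<le> (e + 1) * card (mdivs g)"
proof -
  have "card (mdivs (p ^ e * g)) \<le> card ((\<lambda>(i, d). p ^ i * d) ` ({..e} \<times> mdivs g))"
    using mdivs_prime_power_mult[OF assms(1,2)] assms(3) by (intro card_mono) auto
  also have "\<dots> \<le> card ({..e} \<times> mdivs g)" using assms(3) by (intro card_image_le) auto
  finally show ?thesis by (simp add: card_cartesian_product)
qed

lemma monic_prime_dvd_prime_power_mult_iff: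
  fixes p g :: "'a::field poly"
  assumes "monic_prime p" "monic_prime r" "e \<ge> 1"
  shows "r dvd p ^ e * g \<longleftrightarrow> r = p \<or> r dvd g"
proof
  assume "r dvd p ^ e * g"
  hence "r dvd p ^ e \<or> r dvd g" using monic_prime_dvd_mult_iff[OF assms(2)] by blast
  thus "r = p \<or> r dvd g"
    using monic_prime_dvd_power[OF assms(2)] dvd_monic_eq[OF assms(2,1)] by blast
next
  assume "r = p \<or> r dvd g"
  thus "r dvd p ^ e * g" using assms(3) by (auto intro: dvd_mult2 dvd_power)
qed

lemma linear_le_powr:
  fixes Q \<delta> :: real
  assumes "Q > 1" "\<delta> > 0"
  shows "\<exists>B\<ge>1. \<forall>n::nat. real n + 1 \<le> B * Q powr (\<delta> * real n)"
proof -
  define r where "r = Q powr \<delta>"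
  have r: "r > 1" using assms by (simp add: r_def)
  have Qr: "Q powr (\<delta> * real n) = r ^ n" for n
    unfolding r_def powr_powr[symmetric] using assms by (intro powr_realpow) auto
  \<comment> \<open>With this constant, \<open>B * (1 + n * (r - 1))\<close> is \<open>n + 1\<close>
    plus two nonnegative terms, and Bernoulli's inequality compares \<open>1 + n * (r - 1)\<close>
    with \<open>r ^ n\<close>.\<close>
  define B where "B = 1 + 1 / (r - 1)"
  have B: "B \<ge> 1" using r by (simp add: B_def)
  have "real n + 1 \<le> B * r ^ n" for n
  proof -
    have "B * (1 + real n * (r - 1)) = 1 + real n + real n * (r - 1) + 1 / (r - 1)"
      using r by (simp add: B_def distrib_left distrib_right)
    moreover have "0 \<le> real n * (r - 1)" "0 \<le> 1 / (r - 1)" using r by simp_all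
    ultimately have "real n + 1 \<le> B * (1 + real n * (r - 1))" by linarith
    also have "\<dots> \<le> B * (1 + (r - 1)) ^ n"
      using Bernoulli_inequality[of "r - 1" n] r B by (intro mult_left_mono) auto
    finally show ?thesis by simp
  qed
  thus ?thesis using B Qr by auto
qed

text \<open>The classical argument. A prime of degree at least \<open>K\<close>, where
  \<open>r ^ K > 2\<close>, contributes \<open>e + 1 \<le> 2 ^ e \<le> r ^ (e * degree p)\<close>
  and costs nothing; each of the finitely many smaller primes costs one constant factor
  \<open>B\<close>.\<close>

lemma card_mdivs_bound_monic:
  fixes Q \<delta> :: real
  assumes "Q > 1" "\<delta> > 0"
  shows "\<exists>C\<ge>1. \<forall>f::'a::{finite,field} poly. lead_coeff f = 1 \<longrightarrow>
           real (card (mdivs f)) \<le> C * Q powr (\<delta> * real (degree f))"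
proof -
  define r where "r = Q powr \<delta>"
  have r: "r > 1" using assms by (simp add: r_def)
  have Qr: "Q powr (\<delta> * real k) = r ^ k" for k
    unfolding r_def powr_powr[symmetric] using assms by (intro powr_realpow) auto
  obtain K where K: "2 < r ^ K" using real_arch_pow[OF r, of 2] by blast
  obtain B where B: "B \<ge> 1" and Be: "\<And>e::nat. real e + 1 \<le> B * r ^ e"
    using linear_le_powr[OF assms] by (auto simp: Qr)
  have two: "real e + 1 \<le> 2 ^ e" for e
    by (induction e) auto
  define Sm where "Sm = {p::'a poly. monic_prime p \<and> degree p < K}"
  have finSm: "finite Sm"
  proof (rule finite_subset)
    show "Sm \<subseteq> (\<Union>i<K. monics i)" by (auto simp: Sm_def monics_def)
  qed auto
  \<comment> \<open>Counting the small primes that actually divide \<open>f\<close> lets the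
    induction spend one \<open>B\<close> per small prime; only at the end is \<open>s f\<close>
    replaced by \<open>card Sm\<close>.\<close>
  define s where "s f = card {p\<in>Sm. p dvd f}" for f
  have main: "real (card (mdivs f)) \<le> B ^ s f * r ^ degree f" if "lead_coeff f = 1" for f
    using that
  proof (induction rule: monic_prime_power_induct)
    case one
    show ?case using B by (simp add: mdivs_1)
  next
    case (prime_power p e g)
    have nz: "g \<noteq> 0" "p \<noteq> 0" using prime_power by auto
    have deg: "degree (p ^ e * g) = e * degree p + degree g"
      using nz by (simp add: degree_mult_eq degree_power_eq)
    have dp: "degree p \<ge> 1" using monic_prime_degree_pos[OF prime_power(1)] by simp
    have key: "real (e + 1) * B ^ s g \<le> B ^ s (p ^ e * g) * r ^ (e * degree p)"
    proof (cases "p \<in> Sm")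
      case True
      have "{p'\<in>Sm. p' dvd p ^ e * g} = insert p {p'\<in>Sm. p' dvd g}"
        using monic_prime_dvd_prime_power_mult_iff[OF prime_power(1) _ prime_power(2)] True
        by (auto simp: Sm_def)
      hence "s (p ^ e * g) = Suc (s g)" using finSm prime_power(4) by (simp add: s_def)
      moreover have "real (e + 1) \<le> B * r ^ (e * degree p)"
      proof -
        have "real (e + 1) \<le> B * r ^ e" using Be[of e] by simp
        also have "\<dots> \<le> B * r ^ (e * degree p)"
          using r B dp by (intro mult_left_mono power_increasing) auto
        finally show ?thesis .
      qed
      ultimately show ?thesis
        using B mult_right_mono[of "real (e + 1)" "B * r ^ (e * degree p)" "B ^ s g"] by (simp add: ac_simps)
    next
      case False
      hence pK: "degree p \<ge> K" using prime_power(1) by (auto simp: Sm_def)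
      have "{p'\<in>Sm. p' dvd p ^ e * g} = {p'\<in>Sm. p' dvd g}"
        using monic_prime_dvd_prime_power_mult_iff[OF prime_power(1) _ prime_power(2)] False
        by (auto simp: Sm_def)
      hence "s (p ^ e * g) = s g" by (simp add: s_def)
      moreover have "real (e + 1) \<le> r ^ (e * degree p)"
      proof -
        have "real (e + 1) \<le> 2 ^ e" using two[of e] by simp
        also have "\<dots> \<le> (r ^ K) ^ e" using K by (intro power_mono) auto
        also have "\<dots> = r ^ (e * K)" by (simp add: power_mult mult.commute flip: power_mult)
        also have "\<dots> \<le> r ^ (e * degree p)" using r pK by (intro power_increasing) auto
        finally show ?thesis .
      qed
      ultimately show ?thesis
        using B mult_right_mono[of "real (e + 1)" "r ^ (e * degree p)" "B ^ s g"] by (simp add: ac_simps)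
    qed
    have "real (card (mdivs (p ^ e * g))) \<le> real (e + 1) * real (card (mdivs g))"
      using card_mdivs_prime_power_mult[OF prime_power(1,4) nz(1), of e] by (metis of_nat_le_iff of_nat_mult)
    also have "\<dots> \<le> real (e + 1) * (B ^ s g * r ^ degree g)"
      using prime_power by (intro mult_left_mono) auto
    also have "\<dots> = (real (e + 1) * B ^ s g) * r ^ degree g" by simp
    also have "\<dots> \<le> (B ^ s (p ^ e * g) * r ^ (e * degree p)) * r ^ degree g"
      using key r by (intro mult_right_mono) auto
    also have "\<dots> = B ^ s (p ^ e * g) * r ^ degree (p ^ e * g)" by (simp add: deg power_add)
    finally show ?case .
  qed
  show ?thesis
  proof (intro exI[of _ "B ^ card Sm"] conjI allI impI)
    show "1 \<le> B ^ card Sm" using B by simp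
    fix f :: "'a poly" assume f: "lead_coeff f = 1"
    have "s f \<le> card Sm" unfolding s_def using finSm by (intro card_mono) auto
    hence "B ^ s f \<le> B ^ card Sm" using B by (intro power_increasing) auto
    hence "B ^ s f * r ^ degree f \<le> B ^ card Sm * r ^ degree f" using r by (intro mult_right_mono) auto
    with main[OF f] show "real (card (mdivs f)) \<le> B ^ card Sm * Q powr (\<delta> * real (degree f))"
      by (simp add: Qr)
  qed
qed

lemma card_mdivs_bound:
  fixes Q \<delta> :: real
  assumes "Q > 1" "\<delta> > 0"
  obtains C where "C \<ge> 1" and
    "\<And>f::'a::{finite,field} poly. f \<noteq> 0 \<Longrightarrow> real (card (mdivs f)) \<le> C * Q powr (\<delta> * real (degree f))"
proof -
  obtain C where C: "C \<ge> 1" "\<And>f::'a poly. lead_coeff f = 1 \<Longrightarrow>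
      real (card (mdivs f)) \<le> C * Q powr (\<delta> * real (degree f))"
    using card_mdivs_bound_monic[OF assms] by blast
  have "real (card (mdivs f)) \<le> C * Q powr (\<delta> * real (degree f))" if "f \<noteq> 0" for f :: "'a poly"
  proof -
    define c where "c = inverse (lead_coeff f)"
    have c: "c \<noteq> 0" using that by (simp add: c_def)
    have "mdivs (smult c f) = mdivs f" using c by (auto simp: mdivs_def dvd_smult_iff)
    moreover have "lead_coeff (smult c f) = 1" using that by (simp add: c_def)
    ultimately show ?thesis using C(2)[of "smult c f"] c by simp
  qed
  thus ?thesis using that C(1) by blast
qed

subsection \<open>Vaughan's identity for monic polynomials\<close>

text \<open>Summing over all representations as a prime power makes the divisor sum immediate, without
  appealing to uniqueness of the prime.\<close>

definition mangoldt :: "'a::field poly \<Rightarrow> real" where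
  "mangoldt f = (\<Sum>(p, j)\<in>{(p, j). monic_prime p \<and> j \<ge> 1 \<and> p ^ j = f}. real (degree p))"

definition prime_power_divs :: "'a::field poly \<Rightarrow> ('a poly \<times> nat) set" where
  "prime_power_divs f = {(p, j). monic_prime p \<and> j \<ge> 1 \<and> p ^ j dvd f}"

lemma finite_prime_power_divs:
  fixes f :: "'a::{finite,field} poly"
  assumes "f \<noteq> 0"
  shows "finite (prime_power_divs f)"
proof (rule finite_subset)
  show "prime_power_divs f \<subseteq> mdivs f \<times> {..degree f}"
  proof safe
    fix p j assume *: "(p, j) \<in> prime_power_divs f"
    hence p: "monic_prime p" "j \<ge> 1" "p ^ j dvd f" by (auto simp: prime_power_divs_def)
    have "p dvd p ^ j" using p by (intro dvd_power) auto
    with p show "p \<in> mdivs f" by (auto simp: mdivs_def intro: dvd_trans)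
    have "degree (p ^ j) \<le> degree f" using p assms by (intro dvd_imp_degree_le)
    moreover have "degree (p ^ j) = j * degree p" using p by (intro degree_power_eq) auto
    moreover have "degree p > 0" using p monic_prime_degree_pos by blast
    ultimately show "j \<le> degree f"
      by (metis le_trans mult_le_mono2 mult.right_neutral Suc_leI One_nat_def)
  qed
qed (use assms in auto)

text \<open>A prime with exact exponent \<open>e\<close> in \<open>f\<close> contributes the pairs
  \<open>(p, 1)\<close>, ..., \<open>(p, e)\<close>, hence \<open>e * degree p\<close>. The degree
  plays the part of the logarithm.\<close>

lemma sum_prime_power_divs:
  fixes f :: "'a::{finite,field} poly"
  assumes "lead_coeff f = 1"
  shows "(\<Sum>(p, j)\<in>prime_power_divs f. real (degree p)) = real (degree f)"
  using assms
proof (induction rule: monic_prime_power_induct)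
  case one
  have "\<not> p ^ j dvd 1" if "monic_prime p" "j \<ge> 1" for p :: "'a poly" and j
    using that is_unit_power_iff[of p j] by (auto simp: irreducible_def)
  hence "prime_power_divs (1 :: 'a poly) = {}" by (auto simp: prime_power_divs_def)
  thus ?case by simp
next
  case (prime_power p e g)
  have nz: "g \<noteq> 0" "p \<noteq> 0" using prime_power by auto
  have deg: "degree (p ^ e * g) = e * degree p + degree g"
    using nz by (simp add: degree_mult_eq degree_power_eq)
  have eq: "prime_power_divs (p ^ e * g) = {p} \<times> {1..e} \<union> prime_power_divs g"
  proof (intro equalityI subrelI)
    fix r j assume "(r, j) \<in> prime_power_divs (p ^ e * g)"
    hence r: "monic_prime r" "j \<ge> 1" "r ^ j dvd p ^ e * g" by (auto simp: prime_power_divs_def)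
    show "(r, j) \<in> {p} \<times> {1..e} \<union> prime_power_divs g"
    proof (cases "r = p")
      case True
      have "j \<le> e"
      proof (rule ccontr)
        assume "\<not> j \<le> e"
        hence "p ^ Suc e dvd p ^ j" by (intro le_imp_power_dvd) simp
        hence "p ^ e * p dvd p ^ e * g" using r True by (metis dvd_trans power_Suc2)
        moreover have "p ^ e \<noteq> 0" using nz by simp
        ultimately show False using prime_power(4) by simp
      qed
      thus ?thesis using r True by simp
    next
      case False
      hence "\<not> p dvd r" using dvd_monic_eq[OF prime_power(1) r(1)] by blast
      hence "\<not> p dvd r ^ j" using monic_prime_dvd_power[OF prime_power(1)] by blast
      hence "r ^ j dvd g" using dvd_prime_power_mult[OF prime_power(1) _ r(3)] by blast
      thus ?thesis using r by (simp add: prime_power_divs_def)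
    qed
  next
    fix r j assume "(r, j) \<in> {p} \<times> {1..e} \<union> prime_power_divs g"
    thus "(r, j) \<in> prime_power_divs (p ^ e * g)"
      using prime_power(1) by (auto simp: prime_power_divs_def le_imp_power_dvd intro: dvd_mult dvd_mult2)
  qed
  have "p \<noteq> r \<or> \<not> r ^ j dvd g" if "j \<ge> 1" for r j
    using prime_power(4) that by (metis dvd_power dvd_trans less_le_trans zero_less_one)
  hence disj: "({p} \<times> {1..e}) \<inter> prime_power_divs g = {}"
    by (auto simp: prime_power_divs_def)
  have "(\<Sum>(p, j)\<in>prime_power_divs (p ^ e * g). real (degree p))
      = (\<Sum>(p, j)\<in>{p} \<times> {1..e}. real (degree p)) + (\<Sum>(p, j)\<in>prime_power_divs g. real (degree p))"
    unfolding eq using finite_prime_power_divs[OF nz(1)] disj by (intro sum.union_disjoint) auto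
  also have "(\<Sum>(p, j)\<in>{p} \<times> {1..e}. real (degree p)) = real e * real (degree p)"
    by (simp add: sum.cartesian_product[symmetric])
  finally show ?case using prime_power by (simp add: deg)
qed

text \<open>The convolution identity "von Mangoldt with 1 gives log", obtained by grouping the pairs
  \<open>(p, j)\<close> according to the value \<open>p ^ j\<close>.\<close>

lemma sum_mangoldt_mdivs:
  fixes f :: "'a::{finite,field} poly"
  assumes "lead_coeff f = 1"
  shows "(\<Sum>d\<in>mdivs f. mangoldt d) = real (degree f)"
proof -
  have nz: "f \<noteq> 0" using assms by auto
  have "(\<Sum>(p, j)\<in>prime_power_divs f. real (degree p))
      = (\<Sum>d\<in>mdivs f. \<Sum>(p, j)\<in>{x\<in>prime_power_divs f. fst x ^ snd x = d}. real (degree p))"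
  proof (rule sum.group[symmetric])
    show "(\<lambda>x. fst x ^ snd x) ` prime_power_divs f \<subseteq> mdivs f"
      by (auto simp: prime_power_divs_def mdivs_def lead_coeff_power)
  qed (use nz finite_prime_power_divs in auto)
  also have "\<dots> = (\<Sum>d\<in>mdivs f. mangoldt d)"
    unfolding mangoldt_def
    by (intro sum.cong refl) (auto simp: prime_power_divs_def mdivs_def)
  finally show ?thesis using sum_prime_power_divs[OF assms] by simp
qed

lemma mangoldt_nonneg: "mangoldt f \<ge> 0"
  unfolding mangoldt_def by (intro sum_nonneg) auto

lemma mangoldt_le_degree:
  fixes f :: "'a::{finite,field} poly"
  assumes "lead_coeff f = 1"
  shows "mangoldt f \<le> real (degree f)"
proof -
  have "f \<noteq> 0" using assms by auto
  have "mangoldt f \<le> (\<Sum>d\<in>mdivs f. mangoldt d)"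
    using assms \<open>f \<noteq> 0\<close> by (intro member_le_sum finite_mdivs) (auto simp: mdivs_def mangoldt_nonneg)
  thus ?thesis using sum_mangoldt_mdivs[OF assms] by simp
qed

text \<open>The pair \<open>(f, 1)\<close> gives the lower bound; the upper bound comes from the
  divisor sum, all of whose terms are nonnegative.\<close>

lemma mangoldt_prime:
  fixes f :: "'a::{finite,field} poly"
  assumes "monic_prime f"
  shows "mangoldt f = real (degree f)"
proof -
  have nz: "f \<noteq> 0" using assms by auto
  have fin: "finite {(p, j). monic_prime p \<and> j \<ge> 1 \<and> p ^ j = f}"
    by (rule finite_subset[OF _ finite_prime_power_divs[OF nz]]) (auto simp: prime_power_divs_def)
  have "(\<Sum>(p, j)\<in>{(f, 1::nat)}. real (degree p)) \<le> mangoldt f"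
    unfolding mangoldt_def using assms by (intro sum_mono2 fin) auto
  thus ?thesis using mangoldt_le_degree[of f] assms by simp
qed

lemma mangoldt_nonzero_imp:
  fixes f :: "'a::field poly"
  assumes "mangoldt f \<noteq> 0"
  obtains p j where "monic_prime p" "j \<ge> 1" "f = p ^ j"
proof -
  have "{(p, j). monic_prime p \<and> j \<ge> 1 \<and> p ^ j = f} \<noteq> {}"
    using assms unfolding mangoldt_def by (metis sum.empty)
  thus ?thesis using that by blast
qed

section \<open>The Moebius function and its truncated divisor sums\<close>

definition poly_moebius :: "'a::field poly \<Rightarrow> real" where
  "poly_moebius f = (if squarefree f then (-1) ^ card {p. monic_prime p \<and> p dvd f} else 0)"

lemma abs_poly_moebius_le: "\<bar>poly_moebius f\<bar> \<le> 1"
  by (simp add: poly_moebius_def power_abs)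

lemma squarefree_prime_mult_iff:
  fixes p d :: "'a::field poly"
  assumes "monic_prime p" "\<not> p dvd d"
  shows "squarefree (p * d) \<longleftrightarrow> squarefree d"
proof
  assume "squarefree (p * d)"
  thus "squarefree d" by (auto simp: squarefree_def intro: dvd_mult)
next
  assume d: "squarefree d"
  show "squarefree (p * d)"
    unfolding squarefree_def
  proof (intro allI impI)
    fix x assume x: "x\<^sup>2 dvd p * d"
    have "\<not> p dvd x"
    proof
      assume "p dvd x"
      hence "p * p dvd x\<^sup>2" by (simp add: power2_eq_square mult_dvd_mono)
      hence "p * p dvd p * d" using x dvd_trans by blast
      thus False using assms by auto
    qed
    hence "\<not> p dvd x\<^sup>2" using monic_prime_dvd_power[OF assms(1)] by blast
    hence "x\<^sup>2 dvd d" using dvd_prime_power_mult[OF assms(1), of "x\<^sup>2" 1 d] x by simp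
    thus "x dvd 1" using d by (auto simp: squarefree_def)
  qed
qed

lemma poly_moebius_prime_mult:
  fixes p d :: "'a::{finite,field} poly"
  assumes "monic_prime p" "\<not> p dvd d"
  shows "poly_moebius (p * d) = - poly_moebius d"
proof (cases "squarefree d")
  case True
  have "d \<noteq> 0" using assms(2) by auto
  have fin: "finite {r. monic_prime r \<and> r dvd d}"
    by (rule finite_subset[OF _ finite_mdivs[OF \<open>d \<noteq> 0\<close>]]) (auto simp: mdivs_def)
  have "{r. monic_prime r \<and> r dvd p * d} = insert p {r. monic_prime r \<and> r dvd d}"
    using monic_prime_dvd_prime_power_mult_iff[OF assms(1), of _ 1 d] assms(1) by auto
  hence "card {r. monic_prime r \<and> r dvd p * d} = Suc (card {r. monic_prime r \<and> r dvd d})"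
    using fin assms(2) by simp
  thus ?thesis using True squarefree_prime_mult_iff[OF assms] by (simp add: poly_moebius_def)
qed (use squarefree_prime_mult_iff[OF assms] in \<open>simp add: poly_moebius_def\<close>)

lemma poly_moebius_1: "poly_moebius (1 :: 'a::field poly) = 1"
proof -
  have *: "{p :: 'a poly. monic_prime p \<and> p dvd 1} = {}" by (auto simp: irreducible_def)
  show ?thesis unfolding poly_moebius_def * by simp
qed

text \<open>Fix a prime \<open>p\<close> dividing \<open>f\<close>. Divisors \<open>d\<close> prime
  to \<open>p\<close> cancel against \<open>p * d\<close>, and the remaining divisors are divisible
  by the square of \<open>p\<close>.\<close>

lemma sum_poly_moebius_mdivs:
  fixes f :: "'a::{finite,field} poly"
  assumes "lead_coeff f = 1" "degree f > 0"
  shows "(\<Sum>d\<in>mdivs f. poly_moebius d) = 0"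
proof -
  have nz: "f \<noteq> 0" using assms by auto
  obtain p where p: "monic_prime p" "p dvd f" using exists_monic_prime_dvd[OF assms(2)] by blast
  define A where "A = {d \<in> mdivs f. \<not> p dvd d}"
  have Af: "finite A" using nz by (simp add: A_def)
  have pnz: "p \<noteq> 0" using p by auto
  have sub: "A \<union> (\<lambda>d. p * d) ` A \<subseteq> mdivs f"
  proof -
    have "p * d dvd f" if "d \<in> A" for d
    proof -
      have "d dvd f" using that by (simp add: A_def mdivs_def)
      then obtain k where k: "f = d * k" by blast
      hence "p dvd k" using p that monic_prime_dvd_mult_iff[OF p(1)] by (auto simp: A_def)
      thus ?thesis using k by (auto simp: mult.commute intro: mult_dvd_mono)
    qed
    thus ?thesis using p(1) by (auto simp: A_def mdivs_def lead_coeff_mult)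
  qed
  have "poly_moebius d = 0" if d: "d \<in> mdivs f - (A \<union> (\<lambda>d. p * d) ` A)" for d
  proof -
    have "p dvd d" using d by (auto simp: A_def)
    then obtain d' where d': "d = p * d'" by blast
    have "lead_coeff d' = 1" using d d' p(1) by (auto simp: mdivs_def lead_coeff_mult)
    hence "p dvd d'" using d d' by (auto simp: A_def mdivs_def dest: dvd_mult_right)
    hence "p\<^sup>2 dvd d" using d' by (simp add: power2_eq_square)
    moreover have "\<not> p dvd 1" using p(1) by (auto simp: irreducible_def)
    ultimately have "\<not> squarefree d" by (auto simp: squarefree_def)
    thus ?thesis by (simp add: poly_moebius_def)
  qed
  hence "(\<Sum>d\<in>mdivs f. poly_moebius d) = (\<Sum>d\<in>A \<union> (\<lambda>d. p * d) ` A. poly_moebius d)"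
    using sub nz by (intro sum.mono_neutral_right) auto
  also have "\<dots> = (\<Sum>d\<in>A. poly_moebius d) + (\<Sum>d\<in>(\<lambda>d. p * d) ` A. poly_moebius d)"
    using Af by (intro sum.union_disjoint) (auto simp: A_def)
  also have "(\<Sum>d\<in>(\<lambda>d. p * d) ` A. poly_moebius d) = (\<Sum>d\<in>A. poly_moebius (p * d))"
    using pnz by (subst sum.reindex) (auto simp: inj_on_def)
  also have "\<dots> = (\<Sum>d\<in>A. - poly_moebius d)"
    by (intro sum.cong refl poly_moebius_prime_mult[OF p(1)]) (auto simp: A_def)
  finally show ?thesis by (simp add: sum_negf)
qed

text \<open>The Type II coefficient of Vaughan's identity. It is 1 at \<open>f = 1\<close> and
  vanishes for monic \<open>f\<close> with \<open>0 < degree f \<le> u\<close>, which leaves a gap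
  next to the top degree.\<close>

definition trunc_moebius_sum :: "nat \<Rightarrow> 'a::field poly \<Rightarrow> real" where
  "trunc_moebius_sum u f = (\<Sum>d\<in>mdivs f. if degree d \<le> u then poly_moebius d else 0)"

lemma trunc_moebius_sum_1: "trunc_moebius_sum u 1 = 1"
  by (simp add: trunc_moebius_sum_def mdivs_1 poly_moebius_1)

lemma trunc_moebius_sum_eq_0:
  fixes f :: "'a::{finite,field} poly"
  assumes "f \<in> monics n" "0 < n" "n \<le> u"
  shows "trunc_moebius_sum u f = 0"
proof -
  have "degree d \<le> u" if "d \<in> mdivs f" for d
    using mdivs_cofactor(3)[OF assms(1) that] assms by simp
  hence "trunc_moebius_sum u f = (\<Sum>d\<in>mdivs f. poly_moebius d)"
    unfolding trunc_moebius_sum_def by (intro sum.cong) auto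
  thus ?thesis using sum_poly_moebius_mdivs[of f] assms by (auto simp: monics_def)
qed

lemma abs_trunc_moebius_sum_le: "\<bar>trunc_moebius_sum u f\<bar> \<le> real (card (mdivs f))"
proof -
  have "\<bar>trunc_moebius_sum u f\<bar> \<le> (\<Sum>d\<in>mdivs f. \<bar>if degree d \<le> u then poly_moebius d else 0\<bar>)"
    unfolding trunc_moebius_sum_def by (rule sum_abs)
  also have "\<dots> \<le> (\<Sum>d\<in>mdivs f. 1)"
    by (intro sum_mono) (simp add: abs_poly_moebius_le)
  finally show ?thesis by simp
qed

lemma sum_atMost_triangle_swap:
  fixes g :: "nat \<Rightarrow> nat \<Rightarrow> 'b::comm_monoid_add"
  shows "(\<Sum>i\<le>n. \<Sum>j\<le>n - i. g i j) = (\<Sum>j\<le>n. \<Sum>i\<le>n - j. g i j)"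
proof -
  have "(\<Sum>i\<le>n. \<Sum>j\<le>n - i. g i j) = (\<Sum>i\<le>n. \<Sum>j\<le>n. if i + j \<le> n then g i j else 0)"
    by (intro sum.cong refl sum.mono_neutral_cong_left) auto
  also have "\<dots> = (\<Sum>j\<le>n. \<Sum>i\<le>n. if i + j \<le> n then g i j else 0)" by (rule sum.swap)
  also have "\<dots> = (\<Sum>j\<le>n. \<Sum>i\<le>n - j. g i j)"
    by (intro sum.cong refl sum.mono_neutral_cong_right) auto
  finally show ?thesis .
qed

lemma sum_trunc_moebius_sum:
  fixes F :: "'a::{finite,field} poly \<Rightarrow> complex"
  shows "(\<Sum>e\<in>monics n. of_real (trunc_moebius_sum u e) * F e)
       = (\<Sum>i\<le>n. \<Sum>d\<in>monics i. \<Sum>h\<in>monics (n - i). of_real (if i \<le> u then poly_moebius d else 0) * F (d * h))"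
proof -
  have "(\<Sum>e\<in>monics n. of_real (trunc_moebius_sum u e) * F e)
      = (\<Sum>e\<in>monics n. \<Sum>d\<in>mdivs e. of_real (if degree d \<le> u then poly_moebius d else 0) * F (d * (e div d)))"
    unfolding trunc_moebius_sum_def of_real_sum sum_distrib_right
    by (intro sum.cong refl) (simp add: mdivs_cofactor)
  also have "\<dots> = (\<Sum>i\<le>n. \<Sum>d\<in>monics i. \<Sum>h\<in>monics (n - i). of_real (if degree d \<le> u then poly_moebius d else 0) * F (d * h))"
    by (rule sum_monics_mdivs)
  also have "\<dots> = (\<Sum>i\<le>n. \<Sum>d\<in>monics i. \<Sum>h\<in>monics (n - i). of_real (if i \<le> u then poly_moebius d else 0) * F (d * h))"
    by (intro sum.cong refl) (auto simp: monics_def)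
  finally show ?thesis .
qed

lemma sum_mangoldt_conv:
  fixes F :: "'a::{finite,field} poly \<Rightarrow> complex"
  shows "(\<Sum>j\<le>n. \<Sum>b\<in>monics j. \<Sum>h\<in>monics (n - j). of_real (mangoldt b) * F (b * h))
       = of_nat n * (\<Sum>e\<in>monics n. F e)"
proof -
  have "(\<Sum>j\<le>n. \<Sum>b\<in>monics j. \<Sum>h\<in>monics (n - j). of_real (mangoldt b) * F (b * h))
      = (\<Sum>e\<in>monics n. \<Sum>b\<in>mdivs e. of_real (mangoldt b) * F (b * (e div b)))"
    by (rule sum_monics_mdivs[symmetric])
  also have "\<dots> = (\<Sum>e\<in>monics n. of_nat n * F e)"
  proof (intro sum.cong refl)
    fix e :: "'a poly" assume e: "e \<in> monics n"
    have "(\<Sum>b\<in>mdivs e. of_real (mangoldt b) * F (b * (e div b))) = (\<Sum>b\<in>mdivs e. of_real (mangoldt b) * F e)"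
      by (intro sum.cong refl) (simp add: mdivs_cofactor[OF e])
    also have "\<dots> = of_real (\<Sum>b\<in>mdivs e. mangoldt b) * F e" by (simp add: sum_distrib_right)
    also have "(\<Sum>b\<in>mdivs e. mangoldt b) = real n"
      using e sum_mangoldt_mdivs[of e] by (auto simp: monics_def)
    also have "complex_of_real (real n) * F e = of_nat n * F e" by simp
    finally show "(\<Sum>b\<in>mdivs e. of_real (mangoldt b) * F (b * (e div b))) = of_nat n * F e" .
  qed
  finally show ?thesis by (simp add: sum_distrib_left)
qed

text \<open>The triple sum \<open>T\<close>, with weight \<open>poly_moebius d * mangoldt b\<close>
  restricted to \<open>degree d \<le> u\<close>, is evaluated twice. Summing over
  \<open>b * h\<close> first collapses the von Mangoldt function to a degree and leaves the first
  term. Ordering by the degree \<open>j\<close> of \<open>b\<close> instead produces the blocks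
  \<open>G j\<close>, one of which is the sum sought.\<close>

lemma vaughan_identity:
  fixes F :: "'a::{finite,field} poly \<Rightarrow> complex"
  assumes "u + v \<le> n" "v < n"
  shows "(\<Sum>f\<in>monics n. of_real (mangoldt f) * F f)
    = (\<Sum>i\<le>u. of_nat (n - i) * (\<Sum>d\<in>monics i. of_real (poly_moebius d) * (\<Sum>h\<in>monics (n - i). F (d * h))))
    - (\<Sum>j\<le>v. \<Sum>i\<le>u. \<Sum>b\<in>monics j. \<Sum>d\<in>monics i. of_real (mangoldt b * poly_moebius d) * (\<Sum>h\<in>monics (n - (j + i)). F (b * d * h)))
    - (\<Sum>j\<in>{v<..<n - u}. \<Sum>b\<in>monics j. \<Sum>h\<in>monics (n - j). of_real (mangoldt b) * of_real (trunc_moebius_sum u h) * F (b * h))"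
proof -
  define G where "G j = (\<Sum>b\<in>monics j. \<Sum>h\<in>monics (n - j). of_real (mangoldt b) * of_real (trunc_moebius_sum u h) * F (b * h))" for j
  define T where "T = (\<Sum>i\<le>n. \<Sum>j\<le>n - i. \<Sum>d\<in>monics i. \<Sum>b\<in>monics j. \<Sum>h\<in>monics (n - i - j).
      of_real (if i \<le> u then poly_moebius d else 0) * (of_real (mangoldt b) * F (d * (b * h))))"
  have "T = (\<Sum>i\<le>n. \<Sum>d\<in>monics i. of_real (if i \<le> u then poly_moebius d else 0) *
      (\<Sum>j\<le>n - i. \<Sum>b\<in>monics j. \<Sum>h\<in>monics (n - i - j). of_real (mangoldt b) * F (d * (b * h))))"
    unfolding T_def sum_distrib_left by (intro sum.cong refl, subst sum.swap) simp
  also have "\<dots> = (\<Sum>i\<le>n. \<Sum>d\<in>monics i. of_real (if i \<le> u then poly_moebius d else 0) *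
      (of_nat (n - i) * (\<Sum>h\<in>monics (n - i). F (d * h))))"
    by (intro sum.cong refl arg_cong2[where f = "(*)"] sum_mangoldt_conv)
  also have "\<dots> = (\<Sum>i\<le>u. \<Sum>d\<in>monics i. of_real (if i \<le> u then poly_moebius d else 0) *
      (of_nat (n - i) * (\<Sum>h\<in>monics (n - i). F (d * h))))"
    using assms by (intro sum.mono_neutral_right) auto
  also have "\<dots> = (\<Sum>i\<le>u. of_nat (n - i) * (\<Sum>d\<in>monics i. of_real (poly_moebius d) * (\<Sum>h\<in>monics (n - i). F (d * h))))"
    by (intro sum.cong refl) (simp add: sum_distrib_left ac_simps)
  finally have T1: "T = \<dots>" .
  have G_expand: "G j = (\<Sum>i\<le>n - j. \<Sum>b\<in>monics j. \<Sum>d\<in>monics i. \<Sum>h\<in>monics (n - (j + i)).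
      of_real (mangoldt b) * (of_real (if i \<le> u then poly_moebius d else 0) * F (b * d * h)))" for j
  proof -
    have "G j = (\<Sum>b\<in>monics j. of_real (mangoldt b) * (\<Sum>e\<in>monics (n - j). of_real (trunc_moebius_sum u e) * F (b * e)))"
      by (simp add: G_def sum_distrib_left ac_simps)
    also have "\<dots> = (\<Sum>b\<in>monics j. of_real (mangoldt b) * (\<Sum>i\<le>n - j. \<Sum>d\<in>monics i. \<Sum>h\<in>monics (n - j - i).
        of_real (if i \<le> u then poly_moebius d else 0) * F (b * (d * h))))"
      by (subst sum_trunc_moebius_sum[where F = "\<lambda>e. F (_ * e)"]) (rule refl)
    also have "\<dots> = (\<Sum>i\<le>n - j. \<Sum>b\<in>monics j. \<Sum>d\<in>monics i. \<Sum>h\<in>monics (n - (j + i)).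
        of_real (mangoldt b) * (of_real (if i \<le> u then poly_moebius d else 0) * F (b * d * h)))"
      by (simp only: sum_distrib_left mult.assoc diff_diff_left) (rule sum.swap)
    finally show ?thesis .
  qed
  have "T = (\<Sum>j\<le>n. \<Sum>i\<le>n - j. \<Sum>d\<in>monics i. \<Sum>b\<in>monics j. \<Sum>h\<in>monics (n - i - j).
      of_real (if i \<le> u then poly_moebius d else 0) * (of_real (mangoldt b) * F (d * (b * h))))"
    unfolding T_def by (rule sum_atMost_triangle_swap)
  also have "\<dots> = (\<Sum>j\<le>n. G j)"
    unfolding G_expand
    by (rule sum.cong[OF refl], rule sum.cong[OF refl], subst sum.swap) (simp add: ac_simps)
  \<comment> \<open>The block \<open>j = n\<close> has cofactor 1 and is the wanted sum; for
    \<open>n - u \<le> j < n\<close> the cofactor has degree between 1 and \<open>u\<close>, where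
    the truncated Moebius sum vanishes.\<close>
  also have "\<dots> = (\<Sum>j\<in>{..v} \<union> ({v<..<n - u} \<union> {n}). G j)"
  proof (rule sum.mono_neutral_right)
    show "\<forall>j\<in>{..n} - ({..v} \<union> ({v<..<n - u} \<union> {n})). G j = 0"
    proof
      fix j assume j: "j \<in> {..n} - ({..v} \<union> ({v<..<n - u} \<union> {n}))"
      have "trunc_moebius_sum u h = 0" if "h \<in> monics (n - j)" for h :: "'a poly"
        using j by (intro trunc_moebius_sum_eq_0[OF that]) auto
      thus "G j = 0" by (simp add: G_def)
    qed
  qed (use assms in auto)
  also have "\<dots> = (\<Sum>j\<le>v. G j) + ((\<Sum>j\<in>{v<..<n - u}. G j) + G n)"
    using assms by (subst sum.union_disjoint; (subst sum.union_disjoint)?) auto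
  also have "G n = (\<Sum>f\<in>monics n. of_real (mangoldt f) * F f)"
    by (simp add: G_def monics_0 trunc_moebius_sum_1)
  also have "(\<Sum>j\<le>v. G j) = (\<Sum>j\<le>v. \<Sum>i\<le>u. \<Sum>b\<in>monics j. \<Sum>d\<in>monics i. of_real (mangoldt b * poly_moebius d) * (\<Sum>h\<in>monics (n - (j + i)). F (b * d * h)))"
  proof (intro sum.cong refl)
    fix j assume j: "j \<in> {..v}"
    \<comment> \<open>For \<open>j \<le> v\<close> the range \<open>i \<le> n - j\<close> contains
      \<open>i \<le> u\<close>, since \<open>u + v \<le> n\<close>; beyond \<open>u\<close> the
      truncation makes the terms zero.\<close>
    have "G j = (\<Sum>i\<le>u. \<Sum>b\<in>monics j. \<Sum>d\<in>monics i. \<Sum>h\<in>monics (n - (j + i)).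
      of_real (mangoldt b) * (of_real (if i \<le> u then poly_moebius d else 0) * F (b * d * h)))"
      unfolding G_expand using j assms by (intro sum.mono_neutral_right) auto
    thus "G j = (\<Sum>i\<le>u. \<Sum>b\<in>monics j. \<Sum>d\<in>monics i. of_real (mangoldt b * poly_moebius d) * (\<Sum>h\<in>monics (n - (j + i)). F (b * d * h)))"
      by (simp add: sum_distrib_left mult.assoc)
  qed
  finally have T2: "T = (\<Sum>j\<le>v. \<Sum>i\<le>u. \<Sum>b\<in>monics j. \<Sum>d\<in>monics i. of_real (mangoldt b * poly_moebius d) * (\<Sum>h\<in>monics (n - (j + i)). F (b * d * h)))
    + ((\<Sum>j\<in>{v<..<n - u}. G j) + (\<Sum>f\<in>monics n. of_real (mangoldt f) * F f))" .
  have "x = a - b - c" if "T = a" "T = b + (c + x)" for x a b c :: complex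
    using that by (auto simp: algebra_simps)
  from this[OF T1 T2] show ?thesis unfolding G_def .
qed

subsection \<open>Additive characters and Gauss sums of Toeplitz forms\<close>

definition nontrivial_add_char :: "('a::ab_group_add \<Rightarrow> complex) \<Rightarrow> bool" where
  "nontrivial_add_char \<psi> \<longleftrightarrow> (\<forall>x y. \<psi> (x + y) = \<psi> x * \<psi> y) \<and> (\<forall>x. norm (\<psi> x) = 1) \<and> (\<exists>x. \<psi> x \<noteq> 1)"

text \<open>Choose an additive subgroup \<open>H\<close> maximal among those avoiding 1. Then 1
  generates the quotient, which is cyclic of order \<open>p\<close>, the characteristic; sending the
  class of 1 to a nontrivial \<open>p\<close>-th root of unity defines the character.\<close>

lemma exists_nontrivial_add_char:
  "\<exists>\<psi> :: 'a::{finite,field} \<Rightarrow> complex. nontrivial_add_char \<psi>"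
proof -
  define p where "p = CHAR('a)"
  have p0: "p > 0" unfolding p_def by (rule finite_imp_CHAR_pos) simp
  have pp: "prime p" unfolding p_def using p0 by (intro prime_CHAR_semidom) (simp add: p_def)
  have ofp: "of_nat p = (0 :: 'a)" by (simp add: p_def)
  \<comment> \<open>Closure under negation need not be demanded: in characteristic \<open>p\<close>,
    \<open>- x\<close> is \<open>p - 1\<close> copies of \<open>x\<close>.\<close>
  define sub where "sub H \<longleftrightarrow> (0::'a) \<in> H \<and> (\<forall>x\<in>H. \<forall>y\<in>H. x + y \<in> H)" for H
  have mulH: "of_nat k * x \<in> H" if "sub H" "x \<in> H" for H k and x :: 'a
    using that by (induction k) (auto simp: sub_def algebra_simps)
  have negH: "- x \<in> H" if "sub H" "x \<in> H" for H and x :: 'a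
  proof -
    have "of_nat (p - 1) = (-1 :: 'a)" using p0 ofp by (simp add: of_nat_diff)
    thus ?thesis using mulH[OF that, of "p - 1"] by simp
  qed
  have inv: "\<exists>k'. of_nat k' * of_nat k = (1 :: 'a)" if "\<not> p dvd k" for k
  proof -
    have "gcd k p = 1" using pp that by (metis prime_imp_coprime coprime_commute coprime_iff_gcd_eq_1)
    moreover have "k \<noteq> 0" using that by (rule contrapos_nn) simp
    ultimately obtain x y where "k * x = p * y + 1" using bezout_nat[of k p] by auto
    hence "(of_nat (k * x) :: 'a) = of_nat (p * y + 1)" by simp
    hence "of_nat x * of_nat k = (1 :: 'a)" by (simp add: ofp mult.commute)
    thus ?thesis by blast
  qed
  have "{H. sub H \<and> 1 \<notin> H} \<noteq> {}" by (auto simp: sub_def intro!: exI[of _ "{0}"])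
  then obtain H where H: "sub H" "1 \<notin> H" and max: "\<And>H'. sub H' \<Longrightarrow> 1 \<notin> H' \<Longrightarrow> H \<subseteq> H' \<Longrightarrow> H = H'"
    using finite_has_maximal[of "{H. sub H \<and> 1 \<notin> H}"] by auto
  \<comment> \<open>Otherwise the group generated by \<open>H\<close> and \<open>x\<close> is
    strictly larger, so it contains 1, say \<open>1 = h + k * x\<close>. Here \<open>p\<close> does
    not divide \<open>k\<close>, and inverting \<open>k\<close> modulo \<open>p\<close> shows that
    \<open>x\<close> is congruent to an integer modulo \<open>H\<close> after all.\<close>
  have span: "\<exists>k. x - of_nat k \<in> H" for x
  proof (rule ccontr)
    assume no: "\<nexists>k. x - of_nat k \<in> H"
    define H' where "H' = {h + of_nat k * x | h k. h \<in> H}"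
    have "h + of_nat k * x + (h' + of_nat k' * x) \<in> H'" if "h \<in> H" "h' \<in> H" for h h' k k'
    proof -
      have "h + of_nat k * x + (h' + of_nat k' * x) = (h + h') + of_nat (k + k') * x"
        by (simp add: algebra_simps)
      moreover have "h + h' \<in> H" using H that by (auto simp: sub_def)
      ultimately show ?thesis unfolding H'_def by blast
    qed
    moreover have HH': "H \<subseteq> H'" 
    proof
      fix h assume "h \<in> H"
      moreover have "h = h + of_nat 0 * x" by simp
      ultimately show "h \<in> H'" unfolding H'_def by blast
    qed
    ultimately have sub': "sub H'" using H by (fastforce simp: sub_def H'_def)
    have "x = 0 + of_nat 1 * x" by simp
    hence "x \<in> H'" using H unfolding H'_def sub_def by blast
    moreover have "x \<notin> H" using no by (metis of_nat_0 diff_zero)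
    ultimately have "1 \<in> H'" using max[OF sub'] HH' by blast
    then obtain h k where hk: "h \<in> H" "1 = h + of_nat k * x" by (auto simp: H'_def)
    have "\<not> p dvd k"
    proof
      assume "p dvd k"
      hence "of_nat k = (0 :: 'a)" using ofp by auto
      thus False using hk H by simp
    qed
    then obtain k' where k': "of_nat k' * of_nat k = (1 :: 'a)" using inv by blast
    have "of_nat k' * 1 = of_nat k' * h + (of_nat k' * of_nat k) * x"
      by (subst hk(2)) (simp add: algebra_simps)
    hence "x - of_nat k' = - (of_nat k' * h)" by (simp add: k' algebra_simps)
    also have "\<dots> \<in> H" using negH mulH H hk by blast
    finally show False using no by blast
  qed
  define \<kappa> where "\<kappa> x = (SOME k. x - of_nat k \<in> H)" for x
  have \<kappa>: "x - of_nat (\<kappa> x) \<in> H" for x using span[of x] unfolding \<kappa>_def by (rule someI_ex)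
  have uniq: "p dvd k - l" if "l \<le> k" "x - of_nat k \<in> H" "x - of_nat l \<in> H" for x k l
  proof (rule ccontr)
    assume "\<not> p dvd k - l"
    then obtain k' where k': "of_nat k' * of_nat (k - l) = (1 :: 'a)" using inv by blast
    have "(x - of_nat l) + - (x - of_nat k) \<in> H" 
      using H(1) that(3) negH[OF H(1) that(2)] unfolding sub_def by blast
    hence "of_nat (k - l) \<in> H" using that by (simp add: of_nat_diff)
    hence "1 \<in> H" using mulH[OF H(1), of _ k'] k' by metis
    thus False using H by simp
  qed
  have "\<exists>\<omega>::complex. \<omega> ^ p = 1 \<and> \<omega> \<noteq> 1 \<and> norm \<omega> = 1"
  \<comment> \<open>For \<open>p = 2\<close> the sine of \<open>2 * pi / p\<close> vanishes, so the
    test by the imaginary part fails and -1 is given directly.\<close>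
  proof (cases "p = 2")
    case True
    thus ?thesis by (intro exI[of _ "-1"]) auto
  next
    case False
    hence p3: "real p > 2" using prime_ge_2_nat[OF pp] by simp
    hence "sin (2 * pi / real p) > 0" by (intro sin_gt_zero) (auto simp: field_simps)
    hence "cis (2 * pi / real p) \<noteq> 1" by (auto simp: complex_eq_iff)
    moreover have "cis (2 * pi / real p) ^ p = 1" using p0 by (simp add: DeMoivre)
    ultimately show ?thesis by (intro exI[of _ "cis (2 * pi / real p)"]) auto
  qed
  then obtain \<omega> :: complex where \<omega>: "\<omega> ^ p = 1" "\<omega> \<noteq> 1" "norm \<omega> = 1" by blast
  have pow: "\<omega> ^ k = \<omega> ^ l" if "x - of_nat k \<in> H" "x - of_nat l \<in> H" for x k l
  proof -
    have le: "\<omega> ^ k = \<omega> ^ l" if kl: "l \<le> k" "x - of_nat k \<in> H" "x - of_nat l \<in> H" for k l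
    proof -
      obtain t where "k - l = p * t" using uniq[OF kl] by blast
      hence "k = l + p * t" using kl by simp
      thus ?thesis by (simp add: power_add power_mult \<omega>)
    qed
    show ?thesis using le[of k l] le[of l k] that by (cases "k \<le> l") auto
  qed
  define \<psi> where "\<psi> x = \<omega> ^ \<kappa> x" for x
  have "\<psi> (x + y) = \<psi> x * \<psi> y" for x y
  proof -
    have "(x - of_nat (\<kappa> x)) + (y - of_nat (\<kappa> y)) \<in> H" using \<kappa> H by (auto simp: sub_def)
    hence "(x + y) - of_nat (\<kappa> x + \<kappa> y) \<in> H" by (simp add: algebra_simps)
    from pow[OF \<kappa> this] show ?thesis by (simp add: \<psi>_def power_add)
  qed
  moreover have "\<psi> 1 \<noteq> 1"
  proof -
    have "1 - of_nat 1 \<in> H" using H by (simp add: sub_def)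
    hence "\<psi> 1 = \<omega> ^ 1" unfolding \<psi>_def using pow \<kappa> by blast
    thus ?thesis using \<omega> by simp
  qed
  moreover have "norm (\<psi> x) = 1" for x by (simp add: \<psi>_def norm_power \<omega>)
  ultimately show ?thesis unfolding nontrivial_add_char_def by blast
qed

lemma add_char_simps:
  assumes "nontrivial_add_char \<psi>"
  shows "\<psi> (x + y) = \<psi> x * \<psi> y" "norm (\<psi> x) = 1" "\<psi> 0 = 1" "\<psi> (- x) = cnj (\<psi> x)"
    "\<psi> (x - y) = \<psi> x * cnj (\<psi> y)"
proof -
  show add: "\<psi> (x + y) = \<psi> x * \<psi> y" for x y using assms by (simp add: nontrivial_add_char_def)
  show nrm: "norm (\<psi> x) = 1" for x using assms by (simp add: nontrivial_add_char_def)
  have nz: "\<psi> x \<noteq> 0" for x using nrm[of x] by auto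
  show z: "\<psi> 0 = 1" using add[of 0 0] nz[of 0] by simp
  show neg: "\<psi> (- x) = cnj (\<psi> x)" for x
  proof -
    have "\<psi> x * \<psi> (- x) = 1" using add[of x "- x"] z by simp
    moreover have "\<psi> x * cnj (\<psi> x) = 1" using nrm[of x] by (simp flip: complex_norm_square)
    ultimately show ?thesis using nz[of x] by (metis mult_left_cancel)
  qed
  show "\<psi> (x - y) = \<psi> x * cnj (\<psi> y)" using add[of x "- y"] neg by simp
qed

lemma nontrivial_add_char_scale:
  fixes \<psi> :: "'a::field \<Rightarrow> complex"
  assumes "nontrivial_add_char \<psi>" "\<alpha> \<noteq> 0"
  shows "nontrivial_add_char (\<lambda>x. \<psi> (\<alpha> * x))"
proof -
  obtain x where x: "\<psi> x \<noteq> 1" using assms by (auto simp: nontrivial_add_char_def)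
  have "\<alpha> * (x / \<alpha>) = x" using assms(2) by simp
  hence "\<exists>y. \<psi> (\<alpha> * y) \<noteq> 1" using x by metis
  thus ?thesis using assms(1) unfolding nontrivial_add_char_def by (simp add: distrib_left)
qed

text \<open>Translation by \<open>v0\<close> permutes \<open>V\<close> and multiplies the sum by
  \<open>\<psi> x \<noteq> 1\<close>. Used below with \<open>V\<close> the field, a space of vectors
  and a space of symbols.\<close>

lemma sum_add_char_eq_0:
  fixes \<psi> :: "'a::ab_group_add \<Rightarrow> complex" and V :: "'b::ab_group_add set"
  assumes "nontrivial_add_char \<psi>" "\<psi> x \<noteq> 1"
    and "\<And>v. v \<in> V \<Longrightarrow> v + v0 \<in> V" "\<And>v. v \<in> V \<Longrightarrow> v - v0 \<in> V"
    and "\<And>v. v \<in> V \<Longrightarrow> \<phi> (v + v0) = \<phi> v + x"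
  shows "(\<Sum>v\<in>V. \<psi> (\<phi> v)) = 0"
proof -
  have "(\<Sum>v\<in>V. \<psi> (\<phi> v)) = (\<Sum>v\<in>V. \<psi> (\<phi> (v + v0)))"
    using assms(3,4) by (intro sum.reindex_bij_witness[of _ "\<lambda>v. v + v0" "\<lambda>v. v - v0"]) auto
  also have "\<dots> = (\<Sum>v\<in>V. \<psi> (\<phi> v)) * \<psi> x"
    by (simp add: assms(5) add_char_simps[OF assms(1)] sum_distrib_right)
  finally show ?thesis using assms(2) by (simp add: mult_cancel_left1)
qed

lemma sum_UNIV_add_char:
  fixes \<psi> :: "'a::{finite,field} \<Rightarrow> complex"
  assumes "nontrivial_add_char \<psi>"
  shows "(\<Sum>\<alpha>\<in>UNIV. \<psi> (\<alpha> * y)) = (if y = 0 then of_nat (card (UNIV :: 'a set)) else 0)"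
proof (cases "y = 0")
  case False
  obtain x where x: "\<psi> x \<noteq> 1" using assms by (auto simp: nontrivial_add_char_def)
  have "(\<Sum>\<alpha>\<in>UNIV. \<psi> (\<alpha> * y)) = 0"
    by (rule sum_add_char_eq_0[OF assms x, of _ "x / y"]) (use False in \<open>auto simp: distrib_right\<close>)
  thus ?thesis using False by simp
qed (simp add: add_char_simps[OF assms])

section \<open>Polynomials of bounded degree and Toeplitz forms on them\<close>

lemma poly_below_add: "v \<in> poly_below N \<Longrightarrow> w \<in> poly_below N \<Longrightarrow> v + w \<in> poly_below N"
  and poly_below_diff: "v' \<in> poly_below N \<Longrightarrow> w' \<in> poly_below N \<Longrightarrow> v' - w' \<in> poly_below N"
  and poly_below_monom: "i < N \<Longrightarrow> monom x i \<in> poly_below N"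
  by (auto simp: poly_below_def)

lemma poly_below_mult:
  fixes v w :: "'a::comm_semiring_0 poly"
  assumes "v \<in> poly_below A" "w \<in> poly_below B"
  shows "v * w \<in> poly_below (A + B - 1)"
proof -
  have "coeff v i * coeff w (r - i) = 0" if "r \<ge> A + B - 1" "i \<le> r" for r i
    using assms that by (cases "i \<ge> A") (auto simp: poly_below_def)
  thus ?thesis by (auto simp: poly_below_def coeff_mult)
qed

lemma poly_eq_sum_below:
  assumes "v \<in> poly_below A"
  shows "v = (\<Sum>i<A. monom (coeff v i) i)"
  using assms by (intro poly_eqI) (auto simp: coeff_sum poly_below_def)

text \<open>Applies the linear functional with values \<phi> on monomials to a product; the
  condition on \<open>L\<close> ensures that no coefficient of the product is cut off.\<close>

lemma sum_coeff_mult_box: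
  fixes v w :: "'a::comm_semiring_1 poly"
  assumes "v \<in> poly_below A" "w \<in> poly_below B" "A + B - 1 \<le> L"
  shows "(\<Sum>r<L. coeff (v * w) r * \<phi> r) = (\<Sum>i<A. \<Sum>l<B. coeff v i * coeff w l * \<phi> (i + l))"
proof -
  have "v * w = (\<Sum>i<A. monom (coeff v i) i) * (\<Sum>l<B. monom (coeff w l) l)"
    using poly_eq_sum_below[OF assms(1)] poly_eq_sum_below[OF assms(2)] by simp
  also have "\<dots> = (\<Sum>i<A. \<Sum>l<B. monom (coeff v i * coeff w l) (i + l))"
    by (simp add: sum_product mult_monom)
  finally have "coeff (v * w) r = (\<Sum>i<A. \<Sum>l<B. if i + l = r then coeff v i * coeff w l else 0)" for r
    by (simp add: coeff_sum)
  hence "(\<Sum>r<L. coeff (v * w) r * \<phi> r)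
      = (\<Sum>r<L. \<Sum>i<A. \<Sum>l<B. (if i + l = r then coeff v i * coeff w l else 0) * \<phi> r)"
    by (simp add: sum_distrib_right)
  also have "\<dots> = (\<Sum>i<A. \<Sum>l<B. \<Sum>r<L. (if i + l = r then coeff v i * coeff w l else 0) * \<phi> r)"
    by (subst sum.swap, rule sum.cong[OF refl], rule sum.swap)
  also have "\<dots> = (\<Sum>i<A. \<Sum>l<B. coeff v i * coeff w l * \<phi> (i + l))"
  proof (intro sum.cong refl)
    fix i l assume "i \<in> {..<A}" "l \<in> {..<B}"
    hence "i + l < L" using assms(3) by auto
    have "(\<Sum>r<L. (if i + l = r then coeff v i * coeff w l else 0) * \<phi> r)
        = (\<Sum>r<L. if i + l = r then coeff v i * coeff w l * \<phi> r else 0)"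
      by (intro sum.cong) auto
    thus "(\<Sum>r<L. (if i + l = r then coeff v i * coeff w l else 0) * \<phi> r) = coeff v i * coeff w l * \<phi> (i + l)"
      using \<open>i + l < L\<close> by simp
  qed
  finally show ?thesis .
qed

definition toep :: "(int \<Rightarrow> 'a::comm_ring_1) \<Rightarrow> nat \<Rightarrow> 'a poly \<Rightarrow> 'a poly \<Rightarrow> 'a" where
  "toep \<beta> N v w = (\<Sum>i<N. \<Sum>l<N. coeff v i * coeff w l * \<beta> (int i - int l))"

text \<open>The right radical of the form: the row equations are the conditions
  \<open>toep \<beta> N v w = 0\<close> for monomials \<open>v\<close>.\<close>

definition toep_ker :: "(int \<Rightarrow> 'a::comm_ring_1) \<Rightarrow> nat \<Rightarrow> 'a poly set" where
  "toep_ker \<beta> N = {w \<in> poly_below N. \<forall>i<N. (\<Sum>l<N. coeff w l * \<beta> (int i - int l)) = 0}"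

lemma toep_add_left: "toep \<beta> N (v + v') w = toep \<beta> N v w + toep \<beta> N v' w"
  by (simp add: toep_def algebra_simps sum.distrib)

lemma toep_diff_symbol: "toep (\<lambda>z. \<beta> z - \<beta>' z) N v w = toep \<beta> N v w - toep \<beta>' N v w"
  by (simp add: toep_def algebra_simps sum_subtractf)

lemma toep_alt: "toep \<beta> N v w = (\<Sum>i<N. coeff v i * (\<Sum>l<N. coeff w l * \<beta> (int i - int l)))"
  by (simp add: toep_def sum_distrib_left mult.assoc)

lemma toep_monom_left:
  assumes "i < N"
  shows "toep \<beta> N (monom x i) w = x * (\<Sum>l<N. coeff w l * \<beta> (int i - int l))"
proof -
  have "toep \<beta> N (monom x i) w = (\<Sum>j<N. if i = j then x * (\<Sum>l<N. coeff w l * \<beta> (int j - int l)) else 0)"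
    unfolding toep_alt by (intro sum.cong) auto
  thus ?thesis using assms by simp
qed

lemma sum_add_char_toep:
  fixes \<psi> :: "'a::{finite,field} \<Rightarrow> complex"
  assumes \<psi>: "nontrivial_add_char \<psi>" and w: "w \<in> poly_below N"
  shows "(\<Sum>v\<in>poly_below N. \<psi> (toep \<beta> N v w))
       = (if w \<in> toep_ker \<beta> N then of_nat (card (UNIV :: 'a set) ^ N) else 0)"
proof (cases "w \<in> toep_ker \<beta> N")
  case True
  hence "toep \<beta> N v w = 0" for v unfolding toep_alt toep_ker_def by simp
  thus ?thesis using True by (simp add: add_char_simps[OF \<psi>] card_poly_below)
next
  case False
  then obtain i where i: "i < N" "(\<Sum>l<N. coeff w l * \<beta> (int i - int l)) \<noteq> 0" (is "?t \<noteq> 0")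
    using w by (auto simp: toep_ker_def)
  obtain x where x: "\<psi> x \<noteq> 1" using \<psi> by (auto simp: nontrivial_add_char_def)
  have "(\<Sum>v\<in>poly_below N. \<psi> (toep \<beta> N v w)) = 0"
  proof (rule sum_add_char_eq_0[OF \<psi> x, of _ "monom (x / ?t) i"])
    fix v :: "'a poly"
    show "toep \<beta> N (v + monom (x / ?t) i) w = toep \<beta> N v w + x"
      using i by (simp add: toep_add_left toep_monom_left)
  qed (use i in \<open>auto intro!: poly_below_add poly_below_diff poly_below_monom\<close>)
  thus ?thesis using False by simp
qed

text \<open>Weyl differencing: in the square of the modulus put \<open>u = v + w\<close>. For fixed
  \<open>w\<close> the phase difference is a constant \<open>\<rho> w\<close> plus a linear form in
  \<open>v\<close>, so only \<open>w\<close> in the kernel survive. As \<rho> is arbitrary, all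
  linear parts of the phase are absorbed in it.\<close>

lemma norm_gauss_sum_le:
  fixes \<psi> :: "'a::{finite,field} \<Rightarrow> complex"
  assumes \<psi>: "nontrivial_add_char \<psi>"
    and \<Phi>: "\<And>v w. v \<in> poly_below N \<Longrightarrow> w \<in> poly_below N \<Longrightarrow> \<Phi> (v + w) = \<Phi> v + \<rho> w + toep \<beta> N v w"
  shows "(norm (\<Sum>v\<in>poly_below N. \<psi> (\<Phi> v)))\<^sup>2
       \<le> real (card (UNIV :: 'a set) ^ N) * real (card (toep_ker \<beta> N))"
proof -
  let ?V = "poly_below N :: 'a poly set"
  define S where "S = (\<Sum>v\<in>?V. \<psi> (\<Phi> v))"
  note [simp] = add_char_simps[OF \<psi>]
  have "of_real ((norm S)\<^sup>2) = (\<Sum>v\<in>?V. \<Sum>u\<in>?V. \<psi> (\<Phi> u) * cnj (\<psi> (\<Phi> v)))"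
    unfolding complex_norm_square S_def cnj_sum by (subst sum.swap) (simp add: sum_product)
  also have "\<dots> = (\<Sum>v\<in>?V. \<Sum>w\<in>?V. \<psi> (\<Phi> (v + w)) * cnj (\<psi> (\<Phi> v)))"
  proof (rule sum.cong[OF refl])
    fix v assume "v \<in> ?V"
    thus "(\<Sum>u\<in>?V. \<psi> (\<Phi> u) * cnj (\<psi> (\<Phi> v))) = (\<Sum>w\<in>?V. \<psi> (\<Phi> (v + w)) * cnj (\<psi> (\<Phi> v)))"
      by (intro sum.reindex_bij_witness[of _ "\<lambda>w. v + w" "\<lambda>u. u - v"])
        (auto intro: poly_below_add poly_below_diff)
  qed
  also have "\<dots> = (\<Sum>v\<in>?V. \<Sum>w\<in>?V. \<psi> (\<rho> w) * \<psi> (toep \<beta> N v w))"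
  proof (intro sum.cong refl)
    fix v w assume vw: "v \<in> ?V" "w \<in> ?V"
    have "\<psi> (\<Phi> (v + w)) * cnj (\<psi> (\<Phi> v)) = \<psi> (\<Phi> (v + w) - \<Phi> v)" by simp
    also have "\<Phi> (v + w) - \<Phi> v = \<rho> w + toep \<beta> N v w" using \<Phi>[OF vw] by simp
    finally show "\<psi> (\<Phi> (v + w)) * cnj (\<psi> (\<Phi> v)) = \<psi> (\<rho> w) * \<psi> (toep \<beta> N v w)" by simp
  qed
  also have "\<dots> = (\<Sum>w\<in>?V. \<psi> (\<rho> w) * (\<Sum>v\<in>?V. \<psi> (toep \<beta> N v w)))"
    by (subst sum.swap) (simp add: sum_distrib_left)
  finally have "(norm S)\<^sup>2 = norm (\<Sum>w\<in>?V. \<psi> (\<rho> w) * (\<Sum>v\<in>?V. \<psi> (toep \<beta> N v w)))"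
    by (metis norm_of_real abs_power2 power2_abs abs_norm_cancel)
  also have "\<dots> \<le> (\<Sum>w\<in>?V. norm (\<psi> (\<rho> w) * (\<Sum>v\<in>?V. \<psi> (toep \<beta> N v w))))"
    by (rule norm_sum)
  also have "\<dots> = (\<Sum>w\<in>?V. if w \<in> toep_ker \<beta> N then real (card (UNIV :: 'a set) ^ N) else 0)"
    by (intro sum.cong refl) (auto simp: norm_mult sum_add_char_toep[OF \<psi>] norm_power)
  also have "\<dots> = real (card (UNIV :: 'a set) ^ N) * real (card (toep_ker \<beta> N))"
  proof -
    have "?V \<inter> toep_ker \<beta> N = toep_ker \<beta> N" by (auto simp: toep_ker_def)
    thus ?thesis by (simp add: sum.inter_restrict[symmetric] Int_commute)
  qed
  finally show ?thesis unfolding S_def .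
qed

subsection \<open>Counting kernels of even Toeplitz forms\<close>

text \<open>Reversal with respect to the formal degree \<open>N - 1\<close>.\<close>

definition rev_poly :: "nat \<Rightarrow> 'a::comm_ring_1 poly \<Rightarrow> 'a poly" where
  "rev_poly N w = (\<Sum>l<N. monom (coeff w (N - 1 - l)) l)"

lemma coeff_rev_poly: "coeff (rev_poly N w) i = (if i < N then coeff w (N - 1 - i) else 0)"
  by (simp add: rev_poly_def coeff_sum)

lemma rev_poly_below: "rev_poly N w \<in> poly_below N"
  by (simp add: poly_below_def coeff_rev_poly)

lemma inj_on_rev_poly: "inj_on (rev_poly N) (poly_below N)"
proof (rule inj_onI, rule poly_eqI)
  fix v w :: "'a poly" and i
  assume vw: "v \<in> poly_below N" "w \<in> poly_below N" "rev_poly N v = rev_poly N w"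
  show "coeff v i = coeff w i"
  proof (cases "i < N")
    case True
    hence "coeff (rev_poly N v) (N - 1 - i) = coeff (rev_poly N w) (N - 1 - i)" using vw by simp
    thus ?thesis using True by (simp add: coeff_rev_poly)
  qed (use vw in \<open>auto simp: poly_below_def\<close>)
qed

text \<open>Reversing \<open>w\<close> turns the difference \<open>i - l\<close> into the sum
  \<open>r = i + (N - 1 - l)\<close>, so the bilinear form becomes a linear functional of one
  polynomial product.\<close>

lemma toep_eq_rev_poly:
  assumes "v \<in> poly_below N"
  shows "toep \<beta> N v w = (\<Sum>r<2 * N - 1. coeff (v * rev_poly N w) r * \<beta> (int r - int (N - 1)))"
proof -
  have "(\<Sum>r<2 * N - 1. coeff (v * rev_poly N w) r * \<beta> (int r - int (N - 1)))
      = (\<Sum>i<N. \<Sum>l<N. coeff v i * coeff (rev_poly N w) l * \<beta> (int (i + l) - int (N - 1)))"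
    by (rule sum_coeff_mult_box[OF assms rev_poly_below]) simp
  also have "\<dots> = (\<Sum>i<N. \<Sum>l<N. coeff v i * coeff w l * \<beta> (int i - int l))"
  proof (rule sum.cong[OF refl])
    fix i
    show "(\<Sum>l<N. coeff v i * coeff (rev_poly N w) l * \<beta> (int (i + l) - int (N - 1)))
        = (\<Sum>l<N. coeff v i * coeff w l * \<beta> (int i - int l))"
      by (rule sum.reindex_bij_witness[of _ "\<lambda>l. N - 1 - l" "\<lambda>l. N - 1 - l"])
        (auto simp: coeff_rev_poly of_nat_diff algebra_simps)
  qed
  finally show ?thesis by (simp add: toep_def)
qed

text \<open>Coding even symbols by polynomials makes them a finite vector space over which one can
  sum characters.\<close>

definition even_symbol :: "'a::zero poly \<Rightarrow> int \<Rightarrow> 'a" where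
  "even_symbol b z = coeff b (nat \<bar>z\<bar>)"

text \<open>Antisymmetry is expressed by vanishing sums over \<open>\<bar>r - (N - 1)\<bar> = j\<close>, the coefficient of \<open>b\<^sub>j\<close> in
  a Toeplitz form with even symbol \<open>b\<close>; this set is a singleton for \<open>j = 0\<close>.\<close>

definition antisym_poly :: "nat \<Rightarrow> 'a::comm_ring_1 poly \<Rightarrow> bool" where
  "antisym_poly N x \<longleftrightarrow> x \<in> poly_below (2 * N - 1) \<and>
     (\<forall>j<N. (\<Sum>r\<in>{r. r < 2 * N - 1 \<and> \<bar>int r - int (N - 1)\<bar> = int j}. coeff x r) = 0)"

text \<open>The coefficients below \<open>N\<close> determine the rest, since the one at
  \<open>N - 1 + j\<close> is minus the one at \<open>N - 1 - j\<close>.\<close>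

lemma card_antisym_poly_le:
  "card {x :: 'a::{finite,field} poly. antisym_poly N x} \<le> card (UNIV :: 'a set) ^ N"
proof -
  have "inj_on (poly_cutoff N) {x :: 'a poly. antisym_poly N x}"
  proof (rule inj_onI, rule poly_eqI)
    fix x y :: "'a poly" and r
    assume xy: "x \<in> {x. antisym_poly N x}" "y \<in> {x. antisym_poly N x}" "poly_cutoff N x = poly_cutoff N y"
    have low: "coeff x i = coeff y i" if "i < N" for i
    proof -
      have "coeff (poly_cutoff N x) i = coeff (poly_cutoff N y) i" using xy by simp
      thus ?thesis using that by (simp add: coeff_poly_cutoff)
    qed
    consider "r < N" | "N \<le> r" "r < 2 * N - 1" | "r \<ge> 2 * N - 1" by linarith
    thus "coeff x r = coeff y r"
    proof cases
      case 2
      define j where "j = r - (N - 1)"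
      define s where "s = N - 1 - j"
      have j: "j < N" "j \<ge> 1" "r = N - 1 + j" using 2 by (auto simp: j_def)
      have "{r. r < 2 * N - 1 \<and> \<bar>int r - int (N - 1)\<bar> = int j} = {s, r}" "s \<noteq> r"
        using j 2 by (auto simp: s_def of_nat_diff)
      hence "(\<Sum>r\<in>{r. r < 2 * N - 1 \<and> \<bar>int r - int (N - 1)\<bar> = int j}. coeff z r) = coeff z s + coeff z r"
        for z :: "'a poly" by simp
      hence "coeff x s + coeff x r = 0" "coeff y s + coeff y r = 0"
        using xy(1,2) j(1) by (auto simp: antisym_poly_def)
      moreover have "coeff x s = coeff y s" using 2 by (intro low) (auto simp: s_def)
      ultimately show ?thesis by (metis add_left_cancel)
    qed (use xy low in \<open>auto simp: antisym_poly_def poly_below_def\<close>)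
  qed
  moreover have "poly_cutoff N ` {x :: 'a poly. antisym_poly N x} \<subseteq> poly_below N"
    by (auto simp: poly_below_def coeff_poly_cutoff)
  ultimately have "card {x :: 'a poly. antisym_poly N x} \<le> card (poly_below N :: 'a poly set)"
    by (intro card_inj_on_le) auto
  thus ?thesis by (simp add: card_poly_below)
qed

lemma card_poly_dvd_le:
  fixes x :: "'a::{finite,field} poly"
  assumes "x \<noteq> 0"
  shows "finite {v. v dvd x}" "card {v. v dvd x} \<le> card (UNIV :: 'a set) * card (mdivs x)"
proof -
  have sub: "{v. v dvd x} \<subseteq> (\<lambda>(c, d). smult c d) ` (UNIV \<times> mdivs x)"
  proof
    fix v assume "v \<in> {v. v dvd x}"
    hence v: "v dvd x" "v \<noteq> 0" using assms by auto
    hence "smult (inverse (lead_coeff v)) v \<in> mdivs x"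
      by (auto simp: mdivs_def smult_dvd_iff)
    moreover have "v = smult (lead_coeff v) (smult (inverse (lead_coeff v)) v)" using v by simp
    ultimately show "v \<in> (\<lambda>(c, d). smult c d) ` (UNIV \<times> mdivs x)"
      by (intro image_eqI[of _ _ "(lead_coeff v, smult (inverse (lead_coeff v)) v)"]) auto
  qed
  have fin: "finite ((UNIV :: 'a set) \<times> mdivs x)" using assms by simp
  show "finite {v. v dvd x}" using finite_subset[OF sub] fin by blast
  have "card {v. v dvd x} \<le> card ((\<lambda>(c, d). smult c d) ` (UNIV \<times> mdivs x))"
    using fin by (intro card_mono sub) auto
  also have "\<dots> \<le> card ((UNIV :: 'a set) \<times> mdivs x)" by (rule card_image_le[OF fin])
  finally show "card {v. v dvd x} \<le> card (UNIV :: 'a set) * card (mdivs x)"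
    by (simp add: card_cartesian_product)
qed

text \<open>The product vanishes only if \<open>v = 0\<close> or \<open>w = 0\<close>, which gives
  the 2. Each nonzero antisymmetric value \<open>x\<close> has at most \<open>q * D\<close>
  factorisations: \<open>v\<close> is a divisor of \<open>x\<close> and determines
  \<open>w\<close>.\<close>

lemma card_antisym_pairs_le:
  fixes D :: real
  assumes D: "\<And>x :: 'a::{finite,field} poly. x \<noteq> 0 \<Longrightarrow> degree x \<le> 2 * N \<Longrightarrow> real (card (mdivs x)) \<le> D"
  shows "real (card {(v, w). v \<in> poly_below N \<and> w \<in> poly_below N \<and> antisym_poly N (v * rev_poly N w :: 'a poly)})
       \<le> real (card (UNIV :: 'a set)) ^ N * (2 + real (card (UNIV :: 'a set)) * D)"
proof -
  let ?q = "real (card (UNIV :: 'a set))"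
  let ?V = "poly_below N :: 'a poly set"
  define A where "A = {x :: 'a poly. antisym_poly N x} - {0}"
  have finA': "finite {x :: 'a poly. antisym_poly N x}"
    by (rule finite_subset[of _ "poly_below (2 * N - 1)"]) (auto simp: antisym_poly_def)
  hence finA: "finite A" by (simp add: A_def)
  define P where "P = {(v, w). v \<in> ?V \<and> w \<in> ?V \<and> antisym_poly N (v * rev_poly N w)}"
  define E where "E x = {(v, w). v \<in> ?V \<and> w \<in> ?V \<and> v * rev_poly N w = x}" for x
  have finE: "finite (E x)" for x
    by (rule finite_subset[of _ "?V \<times> ?V"]) (auto simp: E_def)
  have sub: "P \<subseteq> {0} \<times> ?V \<union> ?V \<times> {0} \<union> (\<Union>x\<in>A. E x)"
  proof (rule subrelI)
    fix v w assume vw: "(v, w) \<in> P"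
    show "(v, w) \<in> {0} \<times> ?V \<union> ?V \<times> {0} \<union> (\<Union>x\<in>A. E x)"
    proof (cases "v * rev_poly N w = 0")
      case True
      have "rev_poly N (0 :: 'a poly) = 0" by (simp add: rev_poly_def)
      moreover have "0 \<in> ?V" by (simp add: poly_below_def)
      ultimately have "w = 0" if "rev_poly N w = 0" using that inj_onD[OF inj_on_rev_poly, of N w 0] vw
        by (simp add: P_def)
      thus ?thesis using True vw by (auto simp: P_def)
    next
      case False
      thus ?thesis using vw by (auto simp: P_def E_def A_def)
    qed
  qed
  have Ecard: "real (card (E x)) \<le> ?q * D" if "x \<in> A" for x
  proof -
    have x: "x \<noteq> 0" "x \<in> poly_below (2 * N - 1)" using that by (auto simp: A_def antisym_poly_def)
    have deg: "degree x \<le> 2 * N"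
      using x(2) by (intro degree_le) (auto simp: poly_below_def)
    have "inj_on fst (E x)"
    proof (rule inj_onI)
      fix s t assume st: "s \<in> E x" "t \<in> E x" "fst s = fst t"
      then obtain v w w' where *: "s = (v, w)" "t = (v, w')" "w \<in> ?V" "w' \<in> ?V"
        "v * rev_poly N w = x" "v * rev_poly N w' = x" by (auto simp: E_def)
      hence "v \<noteq> 0" using x by auto
      hence "rev_poly N w = rev_poly N w'" using * by (metis mult_left_cancel)
      thus "s = t" using * inj_onD[OF inj_on_rev_poly, of N w w'] by simp
    qed
    moreover have "fst ` E x \<subseteq> {v. v dvd x}" by (auto simp: E_def)
    ultimately have "card (E x) \<le> card {v. v dvd x}"
      using card_poly_dvd_le(1)[OF x(1)] by (intro card_inj_on_le)
    also have "\<dots> \<le> card (UNIV :: 'a set) * card (mdivs x)" by (rule card_poly_dvd_le(2)[OF x(1)])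
    finally have "real (card (E x)) \<le> real (card (UNIV :: 'a set) * card (mdivs x))"
      by (rule of_nat_mono)
    also have "\<dots> = ?q * real (card (mdivs x))" by simp
    also have "\<dots> \<le> ?q * D" using D[OF x(1) deg] by (intro mult_left_mono) auto
    finally show ?thesis .
  qed
  have "real (card (mdivs (1 :: 'a poly))) \<le> D" by (rule D) auto
  hence D0: "D \<ge> 0" using order_trans[OF of_nat_0_le_iff] by blast
  have "card P \<le> card ({0} \<times> ?V \<union> ?V \<times> {0} \<union> (\<Union>x\<in>A. E x))"
    using finA finE by (intro card_mono sub) auto
  also have "\<dots> \<le> card ({0 :: 'a poly} \<times> ?V) + card (?V \<times> {0 :: 'a poly}) + card (\<Union>x\<in>A. E x)"
    using card_Un_le[of "{0} \<times> ?V \<union> ?V \<times> {0}" "\<Union>x\<in>A. E x"] card_Un_le[of "{0} \<times> ?V" "?V \<times> {0}"]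
    by linarith
  also have "\<dots> \<le> 2 * card ?V + (\<Sum>x\<in>A. card (E x))"
    using card_UN_le[OF finA, of E] by (simp add: card_cartesian_product)
  finally have "real (card P) \<le> real (2 * card ?V + (\<Sum>x\<in>A. card (E x)))"
    by (rule of_nat_mono)
  also have "\<dots> = 2 * real (card ?V) + (\<Sum>x\<in>A. real (card (E x)))" by simp
  also have "(\<Sum>x\<in>A. real (card (E x))) \<le> (\<Sum>x\<in>A. ?q * D)" by (intro sum_mono Ecard)
  also have "(\<Sum>x\<in>A. ?q * D) = real (card A) * (?q * D)" by simp
  also have "\<dots> \<le> ?q ^ N * (?q * D)"
  proof (rule mult_right_mono)
    have "card A \<le> card {x :: 'a poly. antisym_poly N x}"
      unfolding A_def by (intro card_mono finA') auto
    also have "\<dots> \<le> card (UNIV :: 'a set) ^ N" by (rule card_antisym_poly_le)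
    finally have "real (card A) \<le> real (card (UNIV :: 'a set) ^ N)" by (rule of_nat_mono)
    thus "real (card A) \<le> ?q ^ N" by simp
  qed (use D0 in auto)
  finally show ?thesis unfolding P_def by (simp add: card_poly_below algebra_simps)
qed

text \<open>If the sum of the coefficients over some class \<bar>r - (N - 1)\<bar> = j is nonzero,
  changing the single coefficient of \<open>b\<close> at \<open>j\<close> shifts the form by any
  prescribed amount; \<open>N \<le> L\<close> makes that coefficient available.\<close>

lemma sum_add_char_even_symbol:
  fixes \<psi> :: "'a::{finite,field} \<Rightarrow> complex"
  assumes \<psi>: "nontrivial_add_char \<psi>" and vw: "v \<in> poly_below N" "w \<in> poly_below N" and "N \<le> L"
    and nz: "\<not> antisym_poly N (v * rev_poly N w)"
  shows "(\<Sum>b\<in>poly_below L. \<psi> (toep (even_symbol b) N v w)) = 0"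
proof -
  let ?x = "v * rev_poly N w"
  let ?R = "\<lambda>j. {r. r < 2 * N - 1 \<and> \<bar>int r - int (N - 1)\<bar> = int j}"
  have "?x \<in> poly_below (2 * N - 1)"
    using poly_below_mult[OF vw(1) rev_poly_below] by (simp add: mult_2)
  then obtain j where j: "j < N" "(\<Sum>r\<in>?R j. coeff ?x r) \<noteq> 0" (is "?s \<noteq> 0")
    using nz by (auto simp: antisym_poly_def)
  obtain y where y: "\<psi> y \<noteq> 1" using \<psi> by (auto simp: nontrivial_add_char_def)
  show ?thesis
  proof (rule sum_add_char_eq_0[OF \<psi> y, of _ "monom (y / ?s) j"])
    fix b :: "'a poly"
    have "(\<Sum>r<2 * N - 1. coeff ?x r * even_symbol (monom (y / ?s) j) (int r - int (N - 1)))
        = (\<Sum>r\<in>?R j. coeff ?x r * (y / ?s))"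
      by (rule sum.mono_neutral_cong_right) (auto simp: even_symbol_def)
    also have "\<dots> = ?s * (y / ?s)" by (rule sum_distrib_right[symmetric])
    also have "\<dots> = y" using j(2) by (rule nonzero_mult_div_cancel_left[of _ y, unfolded times_divide_eq_right[symmetric]])
    finally have "toep (even_symbol (monom (y / ?s) j)) N v w = y"
      unfolding toep_eq_rev_poly[OF vw(1)] .
    moreover have "toep (even_symbol (b + monom (y / ?s) j)) N v w
        = toep (even_symbol b) N v w + toep (even_symbol (monom (y / ?s) j)) N v w"
      by (simp only: toep_def even_symbol_def coeff_add distrib_left sum.distrib)
    ultimately show "toep (even_symbol (b + monom (y / ?s) j)) N v w = toep (even_symbol b) N v w + y"
      by simp
  qed (use j \<open>N \<le> L\<close> in \<open>auto intro!: poly_below_add poly_below_diff poly_below_monom\<close>)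
qed

text \<open>The kernel sizes are expanded in characters and the sum over the symbols is carried out first.\<close>

lemma sum_card_toep_ker_le:
  fixes D :: real
  assumes "N \<le> L"
    and D: "\<And>x :: 'a::{finite,field} poly. x \<noteq> 0 \<Longrightarrow> degree x \<le> 2 * N \<Longrightarrow> real (card (mdivs x)) \<le> D"
  shows "(\<Sum>b\<in>(poly_below L :: 'a poly set). real (card (toep_ker (even_symbol b) N)))
       \<le> real (card (UNIV :: 'a set)) ^ L * (2 + real (card (UNIV :: 'a set)) * D)"
proof -
  let ?q = "real (card (UNIV :: 'a set))"
  let ?V = "poly_below N :: 'a poly set" and ?B = "poly_below L :: 'a poly set"
  obtain \<psi> :: "'a \<Rightarrow> complex" where \<psi>: "nontrivial_add_char \<psi>" using exists_nontrivial_add_char by blast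
  define P where "P = {(v, w). v \<in> ?V \<and> w \<in> ?V \<and> antisym_poly N (v * rev_poly N w)}"
  have PV: "P \<subseteq> ?V \<times> ?V" by (auto simp: P_def)
  have ker: "of_real (?q ^ N * real (card (toep_ker (even_symbol b) N)))
      = (\<Sum>w\<in>?V. \<Sum>v\<in>?V. \<psi> (toep (even_symbol b) N v w))" for b
  proof -
    have "?V \<inter> toep_ker (even_symbol b) N = toep_ker (even_symbol b) N" by (auto simp: toep_ker_def)
    hence "(\<Sum>w\<in>?V. if w \<in> toep_ker (even_symbol b) N then complex_of_nat (card (UNIV :: 'a set) ^ N) else 0)
        = of_real (?q ^ N * real (card (toep_ker (even_symbol b) N)))"
      by (simp add: sum.inter_restrict[symmetric] mult.commute)
    thus ?thesis using sum_add_char_toep[OF \<psi>] by simp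
  qed
  have "complex_of_real (?q ^ N * (\<Sum>b\<in>?B. real (card (toep_ker (even_symbol b) N))))
      = (\<Sum>b\<in>?B. of_real (?q ^ N * real (card (toep_ker (even_symbol b) N))))"
    by (simp add: sum_distrib_left)
  also have "\<dots> = (\<Sum>b\<in>?B. \<Sum>(w, v)\<in>?V \<times> ?V. \<psi> (toep (even_symbol b) N v w))"
    unfolding ker by (simp add: sum.cartesian_product)
  also have "\<dots> = (\<Sum>(w, v)\<in>?V \<times> ?V. \<Sum>b\<in>?B. \<psi> (toep (even_symbol b) N v w))"
    by (subst sum.swap) (simp add: case_prod_beta)
  also have "\<dots> = (\<Sum>(v, w)\<in>?V \<times> ?V. \<Sum>b\<in>?B. \<psi> (toep (even_symbol b) N v w))"
    by (rule sum.reindex_bij_witness[of _ prod.swap prod.swap]) auto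
  \<comment> \<open>Only pairs with antisymmetric product survive; on them each character value is
    estimated trivially by 1.\<close>
  also have "\<dots> = (\<Sum>(v, w)\<in>P. \<Sum>b\<in>?B. \<psi> (toep (even_symbol b) N v w))"
    using sum_add_char_even_symbol[OF \<psi> _ _ assms(1)] PV
    by (intro sum.mono_neutral_right) (auto simp: P_def)
  finally have "norm (complex_of_real (?q ^ N * (\<Sum>b\<in>?B. real (card (toep_ker (even_symbol b) N)))))
      = norm (\<Sum>(v, w)\<in>P. \<Sum>b\<in>?B. \<psi> (toep (even_symbol b) N v w))" by simp
  also have "\<dots> \<le> (\<Sum>x\<in>P. \<Sum>b\<in>?B. 1)"
    using add_char_simps(2)[OF \<psi>]
    by (intro sum_norm_le) (auto simp: case_prod_beta intro!: order_trans[OF norm_sum])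
  also have "\<dots> = real (card P) * ?q ^ L" by (simp add: card_poly_below)
  also have "\<dots> \<le> ?q ^ N * (2 + ?q * D) * ?q ^ L"
    using card_antisym_pairs_le[OF D] unfolding P_def by (intro mult_right_mono) auto
  finally have "\<bar>?q ^ N * (\<Sum>b\<in>?B. real (card (toep_ker (even_symbol b) N)))\<bar> \<le> ?q ^ N * (2 + ?q * D) * ?q ^ L"
    unfolding norm_of_real .
  hence "?q ^ N * (\<Sum>b\<in>?B. real (card (toep_ker (even_symbol b) N))) \<le> ?q ^ N * (?q ^ L * (2 + ?q * D))"
    using abs_ge_self order_trans by (fastforce simp: ac_simps)
  moreover have "?q ^ N > 0" by (simp add: card_gt_0_iff)
  ultimately show ?thesis by (metis mult_le_cancel_left_pos)
qed

text \<open>The equations form a linear recurrence with leading coefficient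
  \<open>\<beta> (- int d)\<close>: row \<open>l - d\<close> expresses the coefficient at
  \<open>l\<close> through the earlier ones, so the first \<open>d\<close> coefficients determine a
  kernel element.\<close>

lemma card_toep_ker_banded_le:
  fixes \<beta> :: "int \<Rightarrow> 'a::{finite,field}"
  assumes "\<And>z. \<bar>z\<bar> > int d \<Longrightarrow> \<beta> z = 0" "\<beta> (- int d) \<noteq> 0"
  shows "card (toep_ker \<beta> N) \<le> card (UNIV :: 'a set) ^ d"
proof -
  have "inj_on (poly_cutoff d) (toep_ker \<beta> N)"
  proof (rule inj_onI)
    fix x y assume xy: "x \<in> toep_ker \<beta> N" "y \<in> toep_ker \<beta> N" "poly_cutoff d x = poly_cutoff d y"
    define w where "w = x - y"
    have low: "coeff w i = 0" if "i < d" for i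
    proof -
      have "coeff (poly_cutoff d x) i = coeff (poly_cutoff d y) i" using xy by simp
      thus ?thesis using that by (simp add: coeff_poly_cutoff w_def)
    qed
    have w: "w \<in> poly_below N" using xy by (auto simp: w_def toep_ker_def intro: poly_below_diff)
    have eq: "(\<Sum>l<N. coeff w l * \<beta> (int i - int l)) = 0" if "i < N" for i
      using xy that by (simp add: w_def toep_ker_def left_diff_distrib sum_subtractf)
    have "coeff w l = 0" for l
    proof (induction l rule: less_induct)
      case (less l)
      show ?case
      proof (cases "d \<le> l \<and> l < N")
        case True
        have "(\<Sum>l'<N. coeff w l' * \<beta> (int (l - d) - int l')) = (\<Sum>l'\<in>{l}. coeff w l' * \<beta> (int (l - d) - int l'))"
        proof (rule sum.mono_neutral_right)
          show "\<forall>i\<in>{..<N} - {l}. coeff w i * \<beta> (int (l - d) - int i) = 0"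
          proof
            fix i assume "i \<in> {..<N} - {l}"
            then consider "i < l" | "i > l" by force
            thus "coeff w i * \<beta> (int (l - d) - int i) = 0"
            proof cases
              case 2
              hence "\<bar>int (l - d) - int i\<bar> > int d" using True by (simp add: of_nat_diff)
              thus ?thesis using assms(1) by simp
            qed (use less in simp)
          qed
        qed (use True in auto)
        also have "\<dots> = coeff w l * \<beta> (- int d)" using True by (simp add: of_nat_diff)
        finally have "coeff w l * \<beta> (- int d) = 0" using eq[of "l - d"] True by force
        thus ?thesis using assms(2) by simp
      qed (use low w in \<open>auto simp: poly_below_def not_le not_less\<close>)
    qed
    hence "w = 0" by (simp add: poly_eq_iff)
    thus "x = y" by (simp add: w_def)
  qed
  moreover have "poly_cutoff d ` toep_ker \<beta> N \<subseteq> poly_below d"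
    by (auto simp: poly_below_def coeff_poly_cutoff)
  ultimately have "card (toep_ker \<beta> N) \<le> card (poly_below d :: 'a poly set)"
    by (intro card_inj_on_le) auto
  thus ?thesis by (simp add: card_poly_below)
qed

subsection \<open>The quadratic form and its correlation symbols\<close>

text \<open>The doubled coefficient at \<open>0\<close> comes from polarisation; it is nonzero for \<open>m = 0\<close> only because \<open>q\<close> is odd.\<close>

definition form_symbol :: "nat \<Rightarrow> (nat \<Rightarrow> 'a::comm_ring_1) \<Rightarrow> int \<Rightarrow> 'a" where
  "form_symbol m c z = (if nat \<bar>z\<bar> \<le> m then c (nat \<bar>z\<bar>) else 0) + (if z = 0 then c 0 else 0)"

lemma form_symbol_minus: "form_symbol m c (- z) = form_symbol m c z"
  by (simp add: form_symbol_def)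

lemma form_symbol_eq_0: "\<bar>z\<bar> > int m \<Longrightarrow> form_symbol m c z = 0"
  by (auto simp: form_symbol_def)

lemma form_symbol_nonzero:
  fixes c :: "nat \<Rightarrow> 'a::{finite,field}"
  assumes "odd (card (UNIV :: 'a set))" "c m \<noteq> 0"
  shows "form_symbol m c (int m) \<noteq> 0"
proof (cases "m = 0")
  case True
  \<comment> \<open>If 2 were 0, then \<open>x\<close> to \<open>x + 1\<close> would be an
    involution without fixed points; its orbits would split the field into pairs and make its
    cardinality even.\<close>
  have "(2 :: 'a) \<noteq> 0"
  proof
    assume "(2 :: 'a) = 0"
    hence two: "x + x = 0" for x :: 'a by (metis mult_2 mult_zero_left)
    have "\<Union> ((\<lambda>x::'a. {x, x + 1}) ` UNIV) = UNIV" by auto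
    moreover have "even (card (\<Union> ((\<lambda>x::'a. {x, x + 1}) ` UNIV)))"
    proof -
      have "2 dvd card (\<Union> ((\<lambda>x::'a. {x, x + 1}) ` UNIV))"
      proof (rule dvd_partition)
        show "\<forall>c\<in>(\<lambda>x::'a. {x, x + 1}) ` UNIV. 2 dvd card c" by auto
        have eq: "{x, x + 1} = {y, y + 1}" if "z \<in> {x, x + 1}" "z \<in> {y, y + 1}" for x y z :: 'a
          using that two[of 1] by (auto simp: add.assoc)
        show "\<forall>c1\<in>(\<lambda>x::'a. {x, x + 1}) ` UNIV. \<forall>c2\<in>(\<lambda>x::'a. {x, x + 1}) ` UNIV. c1 \<noteq> c2 \<longrightarrow> c1 \<inter> c2 = {}"
          using eq by blast
      qed auto
      thus ?thesis .
    qed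
    ultimately show False using assms(1) by simp
  qed
  thus ?thesis using assms True by (simp add: form_symbol_def mult_2[symmetric])
qed (use assms in \<open>simp add: form_symbol_def\<close>)

text \<open>For \<open>i = l\<close> both indicators hold at \<open>j = 0\<close>, which accounts
  for the doubled central coefficient.\<close>

lemma form_symbol_eq_sum:
  "form_symbol m c (int i - int l)
     = (\<Sum>j=0..m. c j * ((if i = l + j then 1 else 0) + (if l = i + j then 1 else 0)))"
proof -
  have "(\<Sum>j=0..m. c j * ((if i = l + j then 1 else 0) + (if l = i + j then 1 else 0)))
      = (\<Sum>j=0..m. if j = nat \<bar>int i - int l\<bar> then c j * (1 + (if i = l then 1 else 0)) else 0)"
    by (intro sum.cong refl) auto
  also have "\<dots> = (if nat \<bar>int i - int l\<bar> \<le> m then c (nat \<bar>int i - int l\<bar>) * (1 + (if i = l then 1 else 0)) else 0)"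
    by (simp add: sum.delta)
  finally show ?thesis by (auto simp: form_symbol_def algebra_simps)
qed

lemma sum_box_diagonal:
  fixes X :: "nat \<Rightarrow> nat \<Rightarrow> 'a::comm_monoid_add"
  shows "(\<Sum>i<Suc n. \<Sum>l<Suc n. if i = l + j then X i l else 0) = (\<Sum>i=j..n. X i (i - j))"
proof -
  have "(\<Sum>l<Suc n. if i = l + j then X i l else 0) = (if j \<le> i then X i (i - j) else 0)" if "i < Suc n" for i
  proof (cases "j \<le> i")
    case True
    have "(\<Sum>l<Suc n. if i = l + j then X i l else 0) = (\<Sum>l<Suc n. if l = i - j then X i l else 0)"
      using True by (intro sum.cong) auto
    moreover have "i - j < Suc n" using that by simp
    ultimately show ?thesis using True by (simp del: sum.lessThan_Suc)
  qed (auto intro!: sum.neutral)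
  hence "(\<Sum>i<Suc n. \<Sum>l<Suc n. if i = l + j then X i l else 0) = (\<Sum>i<Suc n. if j \<le> i then X i (i - j) else 0)"
    by (intro sum.cong) auto
  also have "\<dots> = (\<Sum>i=j..n. X i (i - j))"
    by (rule sum.mono_neutral_cong_right) auto
  finally show ?thesis .
qed

lemma toep_form_symbol:
  "toep (form_symbol m c) (Suc n) f w
     = (\<Sum>j=0..m. c j * (\<Sum>i=j..n. coeff f i * coeff w (i - j) + coeff w i * coeff f (i - j)))"
proof -
  let ?X = "\<lambda>i l. coeff f i * coeff w l"
  have "toep (form_symbol m c) (Suc n) f w
      = (\<Sum>i<Suc n. \<Sum>l<Suc n. \<Sum>j=0..m. c j * ((if i = l + j then ?X i l else 0) + (if l = i + j then ?X i l else 0)))"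
    unfolding toep_def form_symbol_eq_sum sum_distrib_left
    by (intro sum.cong refl) (auto simp: algebra_simps)
  also have "\<dots> = (\<Sum>i<Suc n. \<Sum>j=0..m. \<Sum>l<Suc n. c j * ((if i = l + j then ?X i l else 0) + (if l = i + j then ?X i l else 0)))"
    by (rule sum.cong[OF refl], rule sum.swap)
  also have "\<dots> = (\<Sum>j=0..m. \<Sum>i<Suc n. \<Sum>l<Suc n. c j * ((if i = l + j then ?X i l else 0) + (if l = i + j then ?X i l else 0)))"
    by (rule sum.swap)
  also have "\<dots> = (\<Sum>j=0..m. c j * ((\<Sum>i<Suc n. \<Sum>l<Suc n. if i = l + j then ?X i l else 0)
      + (\<Sum>i<Suc n. \<Sum>l<Suc n. if l = i + j then ?X i l else 0)))"
    by (simp only: sum_distrib_left[symmetric] sum.distrib)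
  also have "\<dots> = (\<Sum>j=0..m. c j * (\<Sum>i=j..n. coeff f i * coeff w (i - j) + coeff w i * coeff f (i - j)))"
  proof (rule sum.cong[OF refl])
    fix j
    have *: "(\<Sum>i<Suc n. \<Sum>l<Suc n. if l = i + j then ?X i l else 0) = (\<Sum>l=j..n. ?X (l - j) l)"
      by (subst sum.swap) (rule sum_box_diagonal)
    show "c j * ((\<Sum>i<Suc n. \<Sum>l<Suc n. if i = l + j then ?X i l else 0)
        + (\<Sum>i<Suc n. \<Sum>l<Suc n. if l = i + j then ?X i l else 0))
      = c j * (\<Sum>i=j..n. coeff f i * coeff w (i - j) + coeff w i * coeff f (i - j))"
      unfolding * sum_box_diagonal sum.distrib by (simp add: mult.commute)
  qed
  finally show ?thesis .
qed

text \<open>Polarisation. The linear part \<open>a\<close> is additive and leaves no trace in the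
  bilinear term, so all later kernels depend on \<open>c\<close> only.\<close>

lemma QA_add: "QA m c n a (f + w) = QA m c n a f + QA m c n a w + toep (form_symbol m c) (Suc n) f w"
  unfolding QA_def toep_form_symbol
  by (simp add: algebra_simps sum.distrib)

text \<open>The autocorrelation of \<open>g\<close> convolved with \<alpha>. Writing it as a
  Toeplitz form at \<open>(g, g)\<close> with shifted symbol makes \<open>toep_eq_rev_poly\<close>
  applicable to it.\<close>

definition corr_symbol :: "(int \<Rightarrow> 'a::comm_ring_1) \<Rightarrow> nat \<Rightarrow> 'a poly \<Rightarrow> int \<Rightarrow> 'a" where
  "corr_symbol \<alpha> K g z = toep (\<lambda>u. \<alpha> (z + u)) K g g"

text \<open>The indices of the products differ by
  \<open>(x + i) - (y + l) = (i - l) + (x - y)\<close>, so pulling a Toeplitz form back along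
  multiplication by \<open>g\<close> gives a Toeplitz form again.\<close>

lemma toep_mult:
  assumes g: "g \<in> poly_below K" and v: "v \<in> poly_below N" and w: "w \<in> poly_below N" and L: "K + N - 1 \<le> L"
  shows "toep \<alpha> L (g * v) (g * w) = toep (corr_symbol \<alpha> K g) N v w"
proof -
  let ?G = "\<lambda>x i y l. coeff g x * coeff v i * (coeff g y * coeff w l * \<alpha> (int (x + i) - int (y + l)))"
  have inner: "(\<Sum>J<L. coeff (g * w) J * \<alpha> (int I - int J)) = (\<Sum>y<K. \<Sum>l<N. coeff g y * coeff w l * \<alpha> (int I - int (y + l)))" for I
    by (rule sum_coeff_mult_box[OF g w L])
  have "toep \<alpha> L (g * v) (g * w) = (\<Sum>x<K. \<Sum>i<N. \<Sum>y<K. \<Sum>l<N. ?G x i y l)"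
    unfolding toep_alt inner by (subst sum_coeff_mult_box[OF g v L]) (simp only: sum_distrib_left)
  also have "\<dots> = (\<Sum>i<N. \<Sum>x<K. \<Sum>y<K. \<Sum>l<N. ?G x i y l)"
    by (rule sum.swap)
  also have "\<dots> = (\<Sum>i<N. \<Sum>x<K. \<Sum>l<N. \<Sum>y<K. ?G x i y l)"
    by (rule sum.cong[OF refl], rule sum.cong[OF refl], rule sum.swap)
  also have "\<dots> = (\<Sum>i<N. \<Sum>l<N. \<Sum>x<K. \<Sum>y<K. ?G x i y l)"
    by (rule sum.cong[OF refl], rule sum.swap)
  also have "\<dots> = toep (corr_symbol \<alpha> K g) N v w"
    unfolding toep_def corr_symbol_def sum_distrib_left
    by (intro sum.cong refl) (simp add: algebra_simps)
  finally show ?thesis .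
qed

lemma corr_symbol_minus:
  assumes "\<And>z. \<alpha> (- z) = \<alpha> z"
  shows "corr_symbol \<alpha> K g (- z) = corr_symbol \<alpha> K g z"
proof -
  have "corr_symbol \<alpha> K g (- z) = (\<Sum>i<K. \<Sum>l<K. coeff g l * coeff g i * \<alpha> (z + (int l - int i)))"
    unfolding corr_symbol_def toep_def
  proof (intro sum.cong refl)
    fix i l
    show "coeff g i * coeff g l * \<alpha> (- z + (int i - int l)) = coeff g l * coeff g i * \<alpha> (z + (int l - int i))"
      using assms[of "z + (int l - int i)"] by (simp add: algebra_simps)
  qed
  also have "\<dots> = corr_symbol \<alpha> K g z"
    unfolding corr_symbol_def toep_def by (rule sum.swap)
  finally show ?thesis .
qed

lemma corr_symbol_eq_0:
  assumes "\<And>z. \<bar>z\<bar> > int m \<Longrightarrow> \<alpha> z = 0" "\<bar>z\<bar> > int (m + k)"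
  shows "corr_symbol \<alpha> (Suc k) g z = 0"
  unfolding corr_symbol_def toep_def
proof (intro sum.neutral ballI)
  fix i l assume "i \<in> {..<Suc k}" "l \<in> {..<Suc k}"
  hence "\<bar>z + (int i - int l)\<bar> > int m" using assms(2) by (simp; linarith)
  thus "coeff g i * coeff g l * \<alpha> (z + (int i - int l)) = 0" using assms(1) by simp
qed

text \<open>The Laurent generating series of \<alpha>, multiplied by the \<open>m\<close>-th power
  of the variable to clear negative exponents.\<close>

definition symbol_poly :: "nat \<Rightarrow> (int \<Rightarrow> 'a::comm_ring_1) \<Rightarrow> 'a poly" where
  "symbol_poly m \<alpha> = (\<Sum>s<2 * m + 1. monom (\<alpha> (int s - int m)) s)"

text \<open>On generating series convolution is multiplication: up to a shift by
  \<open>m + k\<close>, the correlation symbol is the product of \<open>g\<close>, its reversal and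
  the series of \<alpha>.\<close>

lemma coeff_mult_symbol_poly:
  assumes \<alpha>: "\<And>z. \<alpha> (- z) = \<alpha> z" "\<And>z. \<bar>z\<bar> > int m \<Longrightarrow> \<alpha> z = 0" and g: "g \<in> poly_below (Suc k)"
  shows "coeff (g * rev_poly (Suc k) g * symbol_poly m \<alpha>) t = corr_symbol \<alpha> (Suc k) g (int m + int k - int t)"
proof -
  let ?H = "g * rev_poly (Suc k) g"
  have P: "coeff (symbol_poly m \<alpha>) s = \<alpha> (int s - int m)" for s
    using \<alpha>(2)[of "int s - int m"] by (auto simp: symbol_poly_def coeff_sum)
  have H: "coeff ?H r = 0" if "r \<ge> 2 * k + 1" for r
    using poly_below_mult[OF g rev_poly_below[of "Suc k" g]] that by (auto simp: poly_below_def)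
  have "corr_symbol \<alpha> (Suc k) g (int m + int k - int t)
      = (\<Sum>r<2 * Suc k - 1. coeff ?H r * \<alpha> ((int m + int k - int t) + (int r - int (Suc k - 1))))"
    unfolding corr_symbol_def by (rule toep_eq_rev_poly[OF g])
  also have "\<dots> = (\<Sum>r<2 * k + 1. coeff ?H r * \<alpha> (int t - int r - int m))"
  proof (rule sum.cong)
    fix r
    show "coeff ?H r * \<alpha> ((int m + int k - int t) + (int r - int (Suc k - 1))) = coeff ?H r * \<alpha> (int t - int r - int m)"
      using \<alpha>(1)[of "int t - int r - int m"] by (simp add: algebra_simps)
  qed auto
  also have "\<dots> = (\<Sum>r\<le>t. coeff ?H r * \<alpha> (int (t - r) - int m))"
    by (rule sum.mono_neutral_cong) (auto simp: \<alpha>(2) H of_nat_diff)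
  also have "\<dots> = coeff (?H * symbol_poly m \<alpha>) t" by (simp add: coeff_mult P)
  finally show ?thesis by simp
qed

lemma monics_subset_poly_below: "g \<in> monics k \<Longrightarrow> g \<in> poly_below (Suc k)"
  by (auto simp: monics_def poly_below_def coeff_eq_0)

lemma monics_mult_rev_nonzero:
  assumes "g \<in> monics k"
  shows "g * rev_poly (Suc k) g \<noteq> 0"
proof -
  have "coeff (rev_poly (Suc k) g) 0 = 1" using assms by (auto simp: coeff_rev_poly monics_def)
  hence "rev_poly (Suc k) g \<noteq> 0" by auto
  thus ?thesis using monics_nonzero[OF assms] by simp
qed

locale quadratic_form =
  fixes m :: nat and c :: "nat \<Rightarrow> 'a::{finite,field}" and q :: real
  defines q_def: "q \<equiv> real (card (UNIV :: 'a set))"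
  assumes odd_card: "odd (card (UNIV :: 'a set))" and cm: "c m \<noteq> 0"
begin

abbreviation "\<alpha> \<equiv> form_symbol m c"

lemma q_pos: "q > 0"
  by (simp add: q_def card_gt_0_iff)

lemma symbol_poly_nonzero: "symbol_poly m \<alpha> \<noteq> 0"
proof -
  have "coeff (symbol_poly m \<alpha>) (2 * m) = \<alpha> (int m)" by (simp add: symbol_poly_def coeff_sum)
  thus ?thesis using form_symbol_nonzero[where c = c and m = m, OF odd_card cm] by auto
qed

text \<open>Evenness and bandedness extend the agreement from \<open>0..m + k\<close> to all
  integers; then the nonzero factor \<open>symbol_poly\<close> is cancelled in an integral
  domain.\<close>

lemma corr_eq_imp:
  assumes "g \<in> monics k" "g' \<in> monics k"
    and "\<And>j. j \<le> m + k \<Longrightarrow> corr_symbol \<alpha> (Suc k) g (int j) = corr_symbol \<alpha> (Suc k) g' (int j)"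
  shows "g * rev_poly (Suc k) g = g' * rev_poly (Suc k) g'"
proof -
  have "corr_symbol \<alpha> (Suc k) g z = corr_symbol \<alpha> (Suc k) g' z" for z
  proof (cases "\<bar>z\<bar> > int (m + k)")
    case True
    thus ?thesis by (simp add: corr_symbol_eq_0[OF form_symbol_eq_0])
  next
    case False
    have abs: "corr_symbol \<alpha> (Suc k) h z = corr_symbol \<alpha> (Suc k) h \<bar>z\<bar>" for h
      using corr_symbol_minus[of \<alpha> "Suc k" h z] by (auto simp: form_symbol_minus abs_if)
    have "corr_symbol \<alpha> (Suc k) g (int (nat \<bar>z\<bar>)) = corr_symbol \<alpha> (Suc k) g' (int (nat \<bar>z\<bar>))"
      by (rule assms(3)) (use False in linarith)
    thus ?thesis by (simp add: abs[of g] abs[of g'])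
  qed
  hence "g * rev_poly (Suc k) g * symbol_poly m \<alpha> = g' * rev_poly (Suc k) g' * symbol_poly m \<alpha>"
    by (intro poly_eqI)
      (simp add: coeff_mult_symbol_poly form_symbol_minus form_symbol_eq_0 monics_subset_poly_below[OF assms(1)]
        monics_subset_poly_below[OF assms(2)])
  thus ?thesis using symbol_poly_nonzero by simp
qed

lemma card_toep_ker_corr_le:
  assumes "g \<in> monics k"
  shows "card (toep_ker (corr_symbol \<alpha> (Suc k) g) N) \<le> card (UNIV :: 'a set) ^ (m + k)"
proof -
  let ?b = "corr_symbol \<alpha> (Suc k) g"
  have even: "?b (- z) = ?b z" for z by (simp add: corr_symbol_minus form_symbol_minus)
  have van: "?b z = 0" if "\<bar>z\<bar> > int (m + k)" for z
    using that by (simp add: corr_symbol_eq_0[OF form_symbol_eq_0])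
  have "g * rev_poly (Suc k) g * symbol_poly m \<alpha> \<noteq> 0"
    using monics_mult_rev_nonzero[OF assms] symbol_poly_nonzero by simp
  then obtain t where t: "?b (int m + int k - int t) \<noteq> 0"
    using coeff_mult_symbol_poly[where \<alpha> = \<alpha> and m = m, OF form_symbol_minus form_symbol_eq_0 monics_subset_poly_below[OF assms]]
    by (metis poly_eqI coeff_0)
  define z where "z = nat \<bar>int m + int k - int t\<bar>"
  have z: "?b (int z) \<noteq> 0" using t even[of "int m + int k - int t"] by (auto simp: z_def abs_if split: if_splits)
  have bound: "j \<le> m + k" if "?b (int j) \<noteq> 0" for j
    using that van[of "int j"] by (cases "j \<le> m + k") auto
  \<comment> \<open>The true band width, which can be smaller than \<open>m + k\<close>: if
    \<open>g\<close> is divisible by the variable, the symbol vanishes at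
    \<open>m + k\<close>.\<close>
  define d where "d = (GREATEST j. ?b (int j) \<noteq> 0)"
  have d: "?b (int d) \<noteq> 0" unfolding d_def 
    by (rule GreatestI_nat[where P = "\<lambda>j. ?b (int j) \<noteq> 0", OF z bound])
  have gt: "?b (int j) = 0" if "j > d" for j
    using that Greatest_le_nat[of "\<lambda>j. ?b (int j) \<noteq> 0" j "m + k"] bound by (auto simp: d_def)
  have "card (toep_ker ?b N) \<le> card (UNIV :: 'a set) ^ d"
  proof (rule card_toep_ker_banded_le)
    fix y :: int assume "\<bar>y\<bar> > int d"
    hence "?b (int (nat \<bar>y\<bar>)) = 0" by (intro gt) linarith
    thus "?b y = 0" using even[of y] by (auto simp: abs_if split: if_splits)
  qed (use d even in simp)
  also have "\<dots> \<le> card (UNIV :: 'a set) ^ (m + k)"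
    using bound[OF d] by (intro power_increasing) (auto simp: Suc_le_eq card_gt_0_iff)
  finally show ?thesis .
qed

text \<open>Writing a monic \<open>h\<close> as \<open>monom 1 N + v\<close> makes the domain a
  vector space; the middle bracket gathers everything depending on the increment \<open>w\<close>
  alone.\<close>

lemma QA_phase:
  assumes g: "g \<in> monics k" and "v \<in> poly_below N" "w \<in> poly_below N"
  shows "QA m c (k + N) a (g * (monom 1 N + (v + w))) = QA m c (k + N) a (g * (monom 1 N + v))
     + (QA m c (k + N) a (g * w) + toep \<alpha> (Suc (k + N)) (g * monom 1 N) (g * w))
     + toep (corr_symbol \<alpha> (Suc k) g) N v w"
proof -
  have "QA m c (k + N) a (g * (monom 1 N + (v + w)))
      = QA m c (k + N) a (g * (monom 1 N + v) + g * w)" by (simp add: algebra_simps)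
  also have "\<dots> = QA m c (k + N) a (g * (monom 1 N + v)) + QA m c (k + N) a (g * w)
      + toep \<alpha> (Suc (k + N)) (g * monom 1 N + g * v) (g * w)"
    by (subst QA_add) (simp add: distrib_left)
  also have "toep \<alpha> (Suc (k + N)) (g * monom 1 N + g * v) (g * w)
      = toep \<alpha> (Suc (k + N)) (g * monom 1 N) (g * w) + toep (corr_symbol \<alpha> (Suc k) g) N v w"
    unfolding toep_add_left by (subst toep_mult[OF monics_subset_poly_below[OF g] assms(2,3)]) auto
  finally show ?thesis by (simp add: algebra_simps)
qed

lemma sum_monics_shift: "(\<Sum>h\<in>monics N. F h) = (\<Sum>v\<in>poly_below N. F (monom 1 N + v))"
  unfolding monics_eq_image by (subst sum.reindex) (auto simp: inj_on_def)

text \<open>Square-root cancellation relative to the total degree: \<open>N + (m + k)\<close> is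
  \<open>n + m\<close>, whatever the split \<open>n = k + N\<close>.\<close>

lemma type_I_bound:
  assumes \<psi>: "nontrivial_add_char \<psi>" and g: "g \<in> monics k"
  shows "(norm (\<Sum>h\<in>monics N. \<psi> (QA m c (k + N) a (g * h))))\<^sup>2 \<le> q ^ (N + (m + k))"
proof -
  have "(norm (\<Sum>h\<in>monics N. \<psi> (QA m c (k + N) a (g * h))))\<^sup>2
     \<le> real (card (UNIV :: 'a set) ^ N) * real (card (toep_ker (corr_symbol \<alpha> (Suc k) g) N))"
    unfolding sum_monics_shift by (rule norm_gauss_sum_le[OF \<psi> QA_phase[OF g]])
  also have "\<dots> \<le> real (card (UNIV :: 'a set) ^ N) * real (card (UNIV :: 'a set) ^ (m + k))"
    using card_toep_ker_corr_le[OF g] by (intro mult_left_mono of_nat_mono) auto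
  finally show ?thesis by (simp add: q_def power_add)
qed

lemma pair_sum_bound:
  assumes \<psi>: "nontrivial_add_char \<psi>" and g: "g \<in> monics k" "g' \<in> monics k"
  shows "(norm (\<Sum>h\<in>monics N. \<psi> (QA m c (k + N) a (g * h) - QA m c (k + N) a (g' * h))))\<^sup>2
     \<le> q ^ N * real (card (toep_ker (\<lambda>z. corr_symbol \<alpha> (Suc k) g z - corr_symbol \<alpha> (Suc k) g' z) N))"
proof -
  let ?\<rho> = "\<lambda>g w. QA m c (k + N) a (g * w) + toep \<alpha> (Suc (k + N)) (g * monom 1 N) (g * w)"
  have "(norm (\<Sum>h\<in>monics N. \<psi> (QA m c (k + N) a (g * h) - QA m c (k + N) a (g' * h))))\<^sup>2
     \<le> real (card (UNIV :: 'a set) ^ N) * real (card (toep_ker (\<lambda>z. corr_symbol \<alpha> (Suc k) g z - corr_symbol \<alpha> (Suc k) g' z) N))"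
    unfolding sum_monics_shift
  proof (rule norm_gauss_sum_le[OF \<psi>, where \<rho> = "\<lambda>w. ?\<rho> g w - ?\<rho> g' w"])
    fix v w :: "'a poly" assume "v \<in> poly_below N" "w \<in> poly_below N"
    thus "QA m c (k + N) a (g * (monom 1 N + (v + w))) - QA m c (k + N) a (g' * (monom 1 N + (v + w)))
      = QA m c (k + N) a (g * (monom 1 N + v)) - QA m c (k + N) a (g' * (monom 1 N + v))
        + (?\<rho> g w - ?\<rho> g' w) + toep (\<lambda>z. corr_symbol \<alpha> (Suc k) g z - corr_symbol \<alpha> (Suc k) g' z) N v w"
      by (simp only: QA_phase[OF g(1)] QA_phase[OF g(2)] toep_diff_symbol) (simp add: algebra_simps)
  qed
  thus ?thesis by (simp add: q_def)
qed

subsection \<open>Type II sums\<close>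

text \<open>For fixed \<open>g'\<close> each difference symbol comes from at most \<open>D\<close>
  values of \<open>g\<close>, so the sum over \<open>g\<close> is at most \<open>D\<close> times the
  sum over all even symbols. Summing trivially over \<open>g'\<close> costs
  \<open>q ^ k\<close>.\<close>

lemma sum_card_toep_ker_corr_le:
  fixes D :: real
  assumes "k \<le> N"
    and D: "\<And>x :: 'a poly. x \<noteq> 0 \<Longrightarrow> degree x \<le> 2 * N \<Longrightarrow> real (card (mdivs x)) \<le> D"
  shows "(\<Sum>g'\<in>monics k. \<Sum>g\<in>monics k.
            real (card (toep_ker (\<lambda>z. corr_symbol \<alpha> (Suc k) g z - corr_symbol \<alpha> (Suc k) g' z) N)))
       \<le> q ^ k * (D * (q ^ (N + m + 1) * (2 + q * D)))"
proof -
  \<comment> \<open>The difference symbols reach index \<open>m + k\<close>, and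
    \<open>m + k < L\<close> because \<open>k \<le> N\<close>.\<close>
  define L where "L = N + m + 1"
  let ?b = "corr_symbol \<alpha> (Suc k)"
  let ?K = "\<lambda>b :: 'a poly. real (card (toep_ker (even_symbol b) N))"
  define B where "B g g' = (\<Sum>j<L. monom (?b g (int j) - ?b g' (int j)) j)" for g g'
  have coeffB: "coeff (B g g') j = ?b g (int j) - ?b g' (int j)" for g g' j
  proof (cases "j < L")
    case False
    hence "\<bar>int j\<bar> > int (m + k)" using assms(1) by (simp add: L_def)
    thus ?thesis using False by (simp add: B_def coeff_sum corr_symbol_eq_0[OF form_symbol_eq_0])
  qed (simp add: B_def coeff_sum)
  have symB: "even_symbol (B g g') = (\<lambda>z. ?b g z - ?b g' z)" for g g'
  proof
    fix z
    have "?b h \<bar>z\<bar> = ?b h z" for h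
      using corr_symbol_minus[of \<alpha> "Suc k" h z] by (auto simp: form_symbol_minus abs_if)
    thus "even_symbol (B g g') z = ?b g z - ?b g' z" by (simp add: even_symbol_def coeffB)
  qed
  have Bin: "B g g' \<in> poly_below L" for g g' by (simp add: B_def poly_below_def coeff_sum)
  \<comment> \<open>With \<open>g'\<close> fixed, \<open>b\<close> gives the symbol of
    \<open>g\<close>, hence the product \<open>?H\<close> of \<open>g\<close> with its reversal; so
    \<open>g\<close> is a monic divisor of one polynomial of degree at most
    \<open>2 * k \<le> 2 * N\<close>.\<close>
  have fibre: "real (card {g \<in> monics k. B g g' = b}) \<le> D" for g' b
  proof (cases "{g \<in> monics k. B g g' = b} = {}")
    case True
    have "real (card (mdivs (1 :: 'a poly))) \<le> D" by (rule D) auto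
    hence "0 \<le> D" using order_trans[OF of_nat_0_le_iff] by blast
    thus ?thesis unfolding True by simp
  next
    case False
    then obtain g0 where g0: "g0 \<in> monics k" "B g0 g' = b" by blast
    let ?H = "g0 * rev_poly (Suc k) g0"
    have "g \<in> mdivs ?H" if g: "g \<in> monics k" "B g g' = b" for g
    proof -
      have "?b g (int j) = ?b g0 (int j)" for j
        using coeffB[of g g' j] coeffB[of g0 g' j] g(2) g0(2) by simp
      hence "g * rev_poly (Suc k) g = ?H" using corr_eq_imp[OF g(1) g0(1)] by blast
      thus ?thesis using g(1) by (auto simp: mdivs_def monics_def intro: dvdI[of _ _ "rev_poly (Suc k) g"])
    qed
    hence sub: "{g \<in> monics k. B g g' = b} \<subseteq> mdivs ?H" by blast
    have H0: "?H \<noteq> 0" by (rule monics_mult_rev_nonzero[OF g0(1)])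
    have "?H \<in> poly_below (Suc k + Suc k - 1)"
      by (rule poly_below_mult[OF monics_subset_poly_below[OF g0(1)] rev_poly_below])
    hence "degree ?H \<le> 2 * k" by (intro degree_le) (auto simp: poly_below_def)
    hence "real (card (mdivs ?H)) \<le> D" using H0 assms(1) by (intro D) auto
    moreover have "card {g \<in> monics k. B g g' = b} \<le> card (mdivs ?H)"
      using H0 by (intro card_mono sub) auto
    ultimately show ?thesis by linarith
  qed
  have inner: "(\<Sum>g\<in>monics k. real (card (toep_ker (\<lambda>z. ?b g z - ?b g' z) N))) \<le> D * (q ^ L * (2 + q * D))" for g'
  proof -
    have "(\<Sum>g\<in>monics k. real (card (toep_ker (\<lambda>z. ?b g z - ?b g' z) N))) = (\<Sum>g\<in>monics k. ?K (B g g'))"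
      by (simp add: symB)
    also have "\<dots> = (\<Sum>b\<in>poly_below L. \<Sum>g\<in>{g \<in> monics k. B g g' = b}. ?K (B g g'))"
      using Bin by (intro sum.group[symmetric]) auto
    also have "\<dots> = (\<Sum>b\<in>poly_below L. real (card {g \<in> monics k. B g g' = b}) * ?K b)"
      by (intro sum.cong refl) simp
    also have "\<dots> \<le> (\<Sum>b\<in>poly_below L. D * ?K b)"
      by (intro sum_mono mult_right_mono fibre) auto
    also have "\<dots> = D * (\<Sum>b\<in>poly_below L. ?K b)" by (simp add: sum_distrib_left)
    also have "\<dots> \<le> D * (q ^ L * (2 + q * D))"
    proof (rule mult_left_mono)
      show "(\<Sum>b\<in>poly_below L. ?K b) \<le> q ^ L * (2 + q * D)"
        unfolding q_def by (rule sum_card_toep_ker_le[OF _ D]) (auto simp: L_def)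
      show "0 \<le> D" using fibre order_trans[OF of_nat_0_le_iff] by blast
    qed
    finally show ?thesis .
  qed
  have "(\<Sum>g'\<in>monics k. \<Sum>g\<in>monics k. real (card (toep_ker (\<lambda>z. ?b g z - ?b g' z) N)))
      \<le> (\<Sum>g'\<in>(monics k :: 'a poly set). D * (q ^ L * (2 + q * D)))" by (intro sum_mono inner)
  thus ?thesis by (simp add: card_monics q_def L_def)
qed

text \<open>Two applications of Cauchy--Schwarz lead to the fourth power: over \<open>h\<close>,
  removing \<open>y\<close>, and over the pairs \<open>(g, g')\<close>. The exponent of
  \<open>q\<close> is \<open>2 * N\<close> from the first, \<open>2 * k\<close> from the number of
  pairs, \<open>N\<close> from the Gauss sum bound, and \<open>k + N + m + 1\<close> from the kernel
  average.\<close>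

lemma type_II_bound:
  fixes D X Y :: real and x y :: "'a poly \<Rightarrow> complex"
  assumes \<psi>: "nontrivial_add_char \<psi>" and "k \<le> N"
    and D: "\<And>x :: 'a poly. x \<noteq> 0 \<Longrightarrow> degree x \<le> 2 * N \<Longrightarrow> real (card (mdivs x)) \<le> D"
    and X: "\<And>g. g \<in> monics k \<Longrightarrow> norm (x g) \<le> X"
    and Y: "\<And>h. h \<in> monics N \<Longrightarrow> norm (y h) \<le> Y"
  shows "(norm (\<Sum>g\<in>monics k. \<Sum>h\<in>monics N. x g * y h * \<psi> (QA m c (k + N) a (g * h)))) ^ 4
       \<le> (X * Y) ^ 4 * (q ^ (3 * k + 4 * N + m + 1) * (D * (2 + q * D)))"
proof -
  define F where "F g h = \<psi> (QA m c (k + N) a (g * h))" for g h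
  define S where "S = (\<Sum>g\<in>monics k. \<Sum>h\<in>monics N. x g * y h * F g h)"
  define I where "I h = (\<Sum>g\<in>monics k. x g * F g h)" for h
  define T where "T g g' = (\<Sum>h\<in>monics N. \<psi> (QA m c (k + N) a (g * h) - QA m c (k + N) a (g' * h)))" for g g'
  \<comment> \<open>Witnesses that the ranges are nonempty, which forces \<open>X\<close> and
    \<open>Y\<close> to be nonnegative.\<close>
  have "(1 :: 'a poly) * monom 1 k \<in> monics k" "(1 :: 'a poly) * monom 1 N \<in> monics N"
    by (simp_all add: monics_def degree_monom_eq)
  hence X0: "X \<ge> 0" and Y0: "Y \<ge> 0"
    using order_trans[OF norm_ge_zero X] order_trans[OF norm_ge_zero Y] by blast+
  have "S = (\<Sum>h\<in>monics N. y h * I h)"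
    unfolding S_def I_def by (subst sum.swap) (simp add: sum_distrib_left ac_simps)
  hence "norm S \<le> (\<Sum>h\<in>monics N. norm (y h * I h))" by (simp add: norm_sum)
  also have "\<dots> \<le> (\<Sum>h\<in>monics N. Y * norm (I h))"
    unfolding norm_mult by (intro sum_mono mult_right_mono Y) auto
  also have "\<dots> = Y * (\<Sum>h\<in>monics N. norm (I h))" by (simp add: sum_distrib_left)
  finally have "(norm S)\<^sup>2 \<le> (Y * (\<Sum>h\<in>monics N. norm (I h)))\<^sup>2" by (rule power_mono) simp
  also have "\<dots> = Y\<^sup>2 * (\<Sum>h\<in>monics N. norm (I h))\<^sup>2" by (simp add: power_mult_distrib)
  also have "\<dots> \<le> Y\<^sup>2 * ((\<Sum>h\<in>monics N. (norm (I h))\<^sup>2) * real (card (monics N :: 'a poly set)))"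
    by (intro mult_left_mono sum_squared_le_sum_of_squares) auto
  finally have S2: "(norm S)\<^sup>2 \<le> Y\<^sup>2 * (q ^ N * (\<Sum>h\<in>monics N. (norm (I h))\<^sup>2))"
    by (simp add: card_monics q_def mult.commute)
  have "complex_of_real (\<Sum>h\<in>monics N. (norm (I h))\<^sup>2)
      = (\<Sum>h\<in>monics N. \<Sum>g\<in>monics k. \<Sum>g'\<in>monics k. x g * cnj (x g') * (F g h * cnj (F g' h)))"
    unfolding of_real_sum complex_norm_square I_def cnj_sum sum_product
    by (simp add: ac_simps)
  also have "\<dots> = (\<Sum>g\<in>monics k. \<Sum>g'\<in>monics k. \<Sum>h\<in>monics N. x g * cnj (x g') * (F g h * cnj (F g' h)))"
    by (subst sum.swap, rule sum.cong[OF refl], rule sum.swap)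
  also have "\<dots> = (\<Sum>g\<in>monics k. \<Sum>g'\<in>monics k. x g * cnj (x g') * T g g')"
    by (simp add: T_def F_def add_char_simps(5)[OF \<psi>] sum_distrib_left)
  finally have "norm (complex_of_real (\<Sum>h\<in>monics N. (norm (I h))\<^sup>2))
      = norm (\<Sum>g\<in>monics k. \<Sum>g'\<in>monics k. x g * cnj (x g') * T g g')" by simp
  also have "\<dots> \<le> (\<Sum>g\<in>monics k. \<Sum>g'\<in>monics k. norm (x g * cnj (x g') * T g g'))"
    by (intro order_trans[OF norm_sum] sum_mono order_refl)
  also have "\<dots> \<le> (\<Sum>g\<in>monics k. \<Sum>g'\<in>monics k. X\<^sup>2 * norm (T g g'))"
  proof (intro sum_mono)
    fix g g' :: "'a poly" assume "g \<in> monics k" "g' \<in> monics k"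
    hence "norm (x g) * norm (x g') \<le> X * X" using X X0 by (intro mult_mono) auto
    thus "norm (x g * cnj (x g') * T g g') \<le> X\<^sup>2 * norm (T g g')"
      by (simp add: norm_mult power2_eq_square mult_right_mono)
  qed
  also have "\<dots> = X\<^sup>2 * (\<Sum>(g, g')\<in>monics k \<times> monics k. norm (T g g'))"
    by (simp add: sum_distrib_left sum.cartesian_product case_prod_beta)
  finally have I2: "(\<Sum>h\<in>monics N. (norm (I h))\<^sup>2) \<le> X\<^sup>2 * (\<Sum>(g, g')\<in>monics k \<times> monics k. norm (T g g'))"
    unfolding norm_of_real using abs_ge_self order_trans by blast
  have T2: "(\<Sum>(g, g')\<in>monics k \<times> monics k. norm (T g g'))\<^sup>2
      \<le> q ^ (3 * k + 2 * N + m + 1) * (D * (2 + q * D))"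
  proof -
    have "(\<Sum>(g, g')\<in>monics k \<times> monics k. norm (T g g'))\<^sup>2
       \<le> (\<Sum>(g, g')\<in>monics k \<times> monics k. (norm (T g g'))\<^sup>2) * real (card (monics k \<times> monics k :: ('a poly \<times> 'a poly) set))"
      using sum_squared_le_sum_of_squares[of "\<lambda>(g, g'). norm (T g g')" "monics k \<times> monics k"]
      by (simp add: case_prod_beta)
    also have "(\<Sum>(g, g')\<in>monics k \<times> monics k. (norm (T g g'))\<^sup>2)
        \<le> (\<Sum>(g, g')\<in>monics k \<times> monics k. q ^ N *
            real (card (toep_ker (\<lambda>z. corr_symbol \<alpha> (Suc k) g z - corr_symbol \<alpha> (Suc k) g' z) N)))"
      unfolding T_def by (intro sum_mono) (auto intro: pair_sum_bound[OF \<psi>])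
    also have "\<dots> = q ^ N * (\<Sum>g\<in>monics k. \<Sum>g'\<in>monics k.
            real (card (toep_ker (\<lambda>z. corr_symbol \<alpha> (Suc k) g z - corr_symbol \<alpha> (Suc k) g' z) N)))"
      by (simp add: sum_distrib_left sum.cartesian_product case_prod_beta)
    also have "(\<Sum>g\<in>monics k. \<Sum>g'\<in>monics k.
            real (card (toep_ker (\<lambda>z. corr_symbol \<alpha> (Suc k) g z - corr_symbol \<alpha> (Suc k) g' z) N)))
       \<le> q ^ k * (D * (q ^ (N + m + 1) * (2 + q * D)))"
      by (subst sum.swap) (rule sum_card_toep_ker_corr_le[OF assms(2) D])
    finally have "(\<Sum>(g, g')\<in>monics k \<times> monics k. norm (T g g'))\<^sup>2
       \<le> q ^ N * (q ^ k * (D * (q ^ (N + m + 1) * (2 + q * D)))) * (q ^ k * q ^ k)"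
      using q_pos by (simp add: card_cartesian_product card_monics mult_right_mono mult_left_mono flip: q_def)
    also have "\<dots> = q ^ (3 * k + 2 * N + m + 1) * (D * (2 + q * D))"
    proof -
      have "3 * k + 2 * N + m + 1 = N + (k + ((N + m + 1) + (k + k)))" by simp
      thus ?thesis by (simp only: power_add ac_simps)
    qed
    finally show ?thesis .
  qed
  have "(norm S) ^ 4 = ((norm S)\<^sup>2)\<^sup>2" by simp
  also have "\<dots> \<le> (Y\<^sup>2 * (q ^ N * (X\<^sup>2 * (\<Sum>(g, g')\<in>monics k \<times> monics k. norm (T g g')))))\<^sup>2"
  proof (rule power_mono)
    have "Y\<^sup>2 * (q ^ N * (\<Sum>h\<in>monics N. (norm (I h))\<^sup>2))
        \<le> Y\<^sup>2 * (q ^ N * (X\<^sup>2 * (\<Sum>(g, g')\<in>monics k \<times> monics k. norm (T g g'))))"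
      using I2 q_pos by (intro mult_left_mono) auto
    thus "(norm S)\<^sup>2 \<le> Y\<^sup>2 * (q ^ N * (X\<^sup>2 * (\<Sum>(g, g')\<in>monics k \<times> monics k. norm (T g g'))))"
      using S2 by linarith
  qed simp
  also have "\<dots> = (X * Y) ^ 4 * (q ^ (2 * N) * (\<Sum>(g, g')\<in>monics k \<times> monics k. norm (T g g'))\<^sup>2)"
  proof -
    have "(b\<^sup>2 * (Q * (a\<^sup>2 * s)))\<^sup>2 = (a * b) ^ 4 * (Q\<^sup>2 * s\<^sup>2)" for a b Q s :: real
      by (simp add: power_mult_distrib eval_nat_numeral)
    thus ?thesis by (simp add: power_mult[symmetric] mult.commute[of 2])
  qed
  also have "\<dots> \<le> (X * Y) ^ 4 * (q ^ (2 * N) * (q ^ (3 * k + 2 * N + m + 1) * (D * (2 + q * D))))"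
    using T2 q_pos X0 Y0 by (intro mult_left_mono) auto
  also have "\<dots> = (X * Y) ^ 4 * (q ^ (3 * k + 4 * N + m + 1) * (D * (2 + q * D)))"
  proof -
    have "3 * k + 4 * N + m + 1 = 2 * N + (3 * k + 2 * N + m + 1)" by simp
    thus ?thesis by (simp only: power_add ac_simps)
  qed
  finally show ?thesis unfolding S_def F_def .
qed

end

subsection \<open>Estimating the sum over irreducible polynomials\<close>

text \<open>Turns a bound with loss \<delta> and a constant depending on \<delta>, for every
  \<delta> > 0, into a single \<open>o(n)\<close> in the exponent. The parameter \<open>x\<close>
  carries the uniformity.\<close>

lemma exists_vanishing_exponent:
  fixes e :: "nat \<Rightarrow> 'b \<Rightarrow> real" and Q \<theta> :: real
  assumes Q: "Q > 1"
    and bound: "\<And>\<delta>. \<delta> > 0 \<Longrightarrow> \<exists>C. \<forall>n\<ge>1. \<forall>x. e n x \<le> C * Q powr ((\<theta> + \<delta>) * real n)"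
  shows "\<exists>\<epsilon> N. \<epsilon> \<longlonglongrightarrow> 0 \<and> (\<forall>n\<ge>N. \<forall>x. e n x \<le> Q powr (\<theta> * real n + \<epsilon> n * real n))"
proof -
  define A where "A n = {\<delta>. \<delta> > 0 \<and> (\<forall>x. e n x \<le> Q powr ((\<theta> + \<delta>) * real n))}" for n
  have evA: "\<exists>N. \<forall>n\<ge>N. \<delta> \<in> A n" if "\<delta> > 0" for \<delta>
  proof -
    \<comment> \<open>One half of \<delta> is spent on absorbing the constant \<open>C\<close> for
      large \<open>n\<close>.\<close>
    from that have half: "\<delta> / 2 > 0" by simp
    from bound[OF half] obtain C where C: "\<And>n x. n \<ge> 1 \<Longrightarrow> e n x \<le> C * Q powr ((\<theta> + \<delta> / 2) * real n)"
      by blast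
    have "Q powr (\<delta> / 2) > 1" using Q half by simp
    then obtain M where M: "C < (Q powr (\<delta> / 2)) ^ M" using real_arch_pow by blast
    have "\<delta> \<in> A n" if n: "n \<ge> max M 1" for n
    proof -
      have "(Q powr (\<delta> / 2)) ^ M \<le> (Q powr (\<delta> / 2)) ^ n"
        using n \<open>Q powr (\<delta> / 2) > 1\<close> by (intro power_increasing) auto
      also have "\<dots> = Q powr (\<delta> / 2 * real n)"
        unfolding powr_powr[symmetric] using Q by (intro powr_realpow[symmetric]) auto
      finally have CQ: "C \<le> Q powr (\<delta> / 2 * real n)" using M by linarith
      have "e n x \<le> Q powr ((\<theta> + \<delta>) * real n)" for x
      proof -
        have "e n x \<le> C * Q powr ((\<theta> + \<delta> / 2) * real n)" using C n by simp
        also have "\<dots> \<le> Q powr (\<delta> / 2 * real n) * Q powr ((\<theta> + \<delta> / 2) * real n)"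
          by (intro mult_right_mono CQ) auto
        also have "\<dots> = Q powr ((\<theta> + \<delta>) * real n)"
          by (simp add: algebra_simps flip: powr_add)
        finally show ?thesis .
      qed
      thus ?thesis using \<open>\<delta> > 0\<close> by (simp add: A_def)
    qed
    thus ?thesis by blast
  qed
  \<comment> \<open>The infimum of the admissible exponents need not be attained; the added term,
    which tends to 0, leaves room for an admissible \<delta> below
    \<open>\<epsilon> n\<close>.\<close>
  define \<epsilon> where "\<epsilon> n = Inf (A n) + 1 / (real n + 1)" for n
  have bdd: "bdd_below (A n)" for n by (rule bdd_belowI[of _ 0]) (simp add: A_def)
  have "\<epsilon> \<longlonglongrightarrow> 0"
  proof (rule LIMSEQ_I)
    fix r :: real assume r: "r > 0"
    hence "r / 2 > 0" by simp
    from evA[OF this] obtain N where N: "\<And>n. n \<ge> N \<Longrightarrow> r / 2 \<in> A n" by blast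
    obtain M :: nat where M: "2 / r < real M" using reals_Archimedean2 by blast
    have "norm (\<epsilon> n - 0) < r" if n: "n \<ge> max N M" for n
    proof -
      have in_A: "r / 2 \<in> A n" using N n by simp
      have "Inf (A n) \<le> r / 2" by (rule cInf_lower[OF in_A bdd])
      moreover have "Inf (A n) \<ge> 0"
        by (rule cInf_greatest) (use in_A in blast, simp add: A_def)
      moreover have "1 / (real n + 1) < r / 2"
      proof -
        have "2 / r < real n + 1" using M n by simp
        thus ?thesis using r by (simp add: field_simps)
      qed
      moreover have "1 / (real n + 1) > 0" by simp
      ultimately show ?thesis by (simp add: \<epsilon>_def)
    qed
    thus "\<exists>no. \<forall>n\<ge>no. norm (\<epsilon> n - 0) < r" by blast
  qed
  moreover obtain N where N: "\<And>n. n \<ge> N \<Longrightarrow> 1 \<in> A n" using evA[of 1] by auto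
  have "e n x \<le> Q powr (\<theta> * real n + \<epsilon> n * real n)" if nN: "n \<ge> N" for n x
  proof -
    have "Inf (A n) < \<epsilon> n" by (simp add: \<epsilon>_def)
    then obtain \<delta> where \<delta>: "\<delta> \<in> A n" "\<delta> < \<epsilon> n"
      using cInf_lessD[of "A n" "\<epsilon> n"] N[OF nN] by blast
    have "e n x \<le> Q powr ((\<theta> + \<delta>) * real n)" using \<delta> by (simp add: A_def)
    also have "\<dots> \<le> Q powr ((\<theta> + \<epsilon> n) * real n)"
      using \<delta> Q by (intro powr_mono mult_right_mono) auto
    finally show ?thesis by (simp add: algebra_simps)
  qed
  ultimately show ?thesis by blast
qed

lemma power_card_le_powr:
  fixes Q :: real
  assumes "Q > 1" "real k \<le> x"
  shows "Q ^ k \<le> Q powr x"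
proof -
  have "Q ^ k = Q powr real k" using assms by (simp add: powr_realpow)
  thus ?thesis using assms by (simp add: powr_mono)
qed

section \<open>Assembling the Type I and Type II estimates\<close>

context quadratic_form begin

lemma q_gt_1: "q > 1"
proof -
  have "card {0, 1 :: 'a} \<le> card (UNIV :: 'a set)" by (rule card_mono) auto
  thus ?thesis by (simp add: q_def)
qed

lemma type_I_norm:
  assumes \<psi>: "nontrivial_add_char \<psi>" and g: "g \<in> monics i" and "i \<le> n"
  shows "norm (\<Sum>h\<in>monics (n - i). \<psi> (QA m c n a (g * h))) \<le> q powr ((real n + real m) / 2)"
proof (rule power2_le_imp_le)
  have "(norm (\<Sum>h\<in>monics (n - i). \<psi> (QA m c n a (g * h))))\<^sup>2 \<le> q ^ (n - i + (m + i))"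
    using type_I_bound[OF \<psi> g, of "n - i" a] assms(3) by simp
  also have "\<dots> = (q powr ((real n + real m) / 2))\<^sup>2"
  proof -
    have "n - i + (m + i) = n + m" using assms(3) by simp
    hence "q ^ (n - i + (m + i)) = q powr real (n + m)" using powr_realpow[OF q_pos, of "n + m"] by simp
    also have "real (n + m) = (real n + real m) / 2 + (real n + real m) / 2" by simp
    finally show ?thesis by (simp only: powr_add power2_eq_square)
  qed
  finally show "(norm (\<Sum>h\<in>monics (n - i). \<psi> (QA m c n a (g * h))))\<^sup>2 \<le> (q powr ((real n + real m) / 2))\<^sup>2" .
qed simp

lemma real_card_monics: "real (card (monics i :: 'a poly set)) = q ^ i"
  by (simp add: card_monics q_def)

text \<open>One factor \<open>real n + 1\<close> bounds the weight \<open>n - i\<close>, the other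
  the number of degrees \<open>i\<close>.\<close>

lemma type_I_first:
  assumes \<psi>: "nontrivial_add_char \<psi>" and "u \<le> n"
  shows "norm (\<Sum>i\<le>u. of_nat (n - i) * (\<Sum>d\<in>monics i. of_real (poly_moebius d) *
           (\<Sum>h\<in>monics (n - i). \<psi> (QA m c n a (d * h)))))
    \<le> (real n + 1) ^ 2 * (q ^ u * q powr ((real n + real m) / 2))"
proof -
  let ?Z = "q powr ((real n + real m) / 2)"
  have "norm (of_nat (n - i) * (\<Sum>d\<in>monics i. of_real (poly_moebius d) *
           (\<Sum>h\<in>monics (n - i). \<psi> (QA m c n a (d * h))))) \<le> (real n + 1) * (q ^ u * ?Z)" if "i \<in> {..u}" for i
  proof -
    have i: "i \<le> u" "i \<le> n" using that assms by auto
    have "norm (\<Sum>d\<in>monics i. of_real (poly_moebius d) * (\<Sum>h\<in>monics (n - i). \<psi> (QA m c n a (d * h))))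
        \<le> (\<Sum>d\<in>(monics i :: 'a poly set). ?Z)"
    proof (rule sum_norm_le)
      fix d :: "'a poly" assume d: "d \<in> monics i"
      show "norm (of_real (poly_moebius d) * (\<Sum>h\<in>monics (n - i). \<psi> (QA m c n a (d * h)))) \<le> ?Z"
        using mult_mono[OF abs_poly_moebius_le[of d] type_I_norm[OF \<psi> d i(2), of a]] by (simp add: norm_mult)
    qed
    also have "\<dots> = q ^ i * ?Z" by (simp add: real_card_monics)
    also have "\<dots> \<le> q ^ u * ?Z" using i q_gt_1 by (intro mult_right_mono power_increasing) auto
    finally show ?thesis
      unfolding norm_mult[of "of_nat _"] norm_of_nat using i by (intro mult_mono) auto
  qed
  hence "norm (\<Sum>i\<le>u. of_nat (n - i) * (\<Sum>d\<in>monics i. of_real (poly_moebius d) *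
           (\<Sum>h\<in>monics (n - i). \<psi> (QA m c n a (d * h))))) \<le> (\<Sum>i\<le>u. (real n + 1) * (q ^ u * ?Z))"
    by (rule sum_norm_le)
  also have "\<dots> = real (u + 1) * ((real n + 1) * (q ^ u * ?Z))" by simp
  also have "\<dots> \<le> (real n + 1) * ((real n + 1) * (q ^ u * ?Z))"
    using assms q_gt_1 by (intro mult_right_mono) auto
  finally show ?thesis by (simp add: power2_eq_square ac_simps)
qed

text \<open>The outer variable is the monic product \<open>b * d\<close>, so the two cut-offs add
  up. The cube comes from the ranges of \<open>i\<close> and \<open>j\<close> and from the von
  Mangoldt weight.\<close>

lemma type_I_second:
  assumes \<psi>: "nontrivial_add_char \<psi>" and "u + v \<le> n"
  shows "norm (\<Sum>j\<le>v. \<Sum>i\<le>u. \<Sum>b\<in>monics j. \<Sum>d\<in>monics i. of_real (mangoldt b * poly_moebius d) *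
           (\<Sum>h\<in>monics (n - (j + i)). \<psi> (QA m c n a (b * d * h))))
    \<le> (real n + 1) ^ 3 * (q ^ (u + v) * q powr ((real n + real m) / 2))"
proof -
  let ?Z = "q powr ((real n + real m) / 2)"
  have "norm (\<Sum>b\<in>monics j. \<Sum>d\<in>monics i. of_real (mangoldt b * poly_moebius d) *
           (\<Sum>h\<in>monics (n - (j + i)). \<psi> (QA m c n a (b * d * h)))) \<le> (real n + 1) * (q ^ (u + v) * ?Z)"
    if ij: "i \<le> u" "j \<le> v" for i j
  proof -
    have "norm (\<Sum>b\<in>monics j. \<Sum>d\<in>monics i. of_real (mangoldt b * poly_moebius d) *
           (\<Sum>h\<in>monics (n - (j + i)). \<psi> (QA m c n a (b * d * h))))
        \<le> (\<Sum>b\<in>(monics j :: 'a poly set). \<Sum>d\<in>(monics i :: 'a poly set). (real n + 1) * ?Z)"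
    proof (intro sum_norm_le)
      fix b d :: "'a poly" assume bd: "b \<in> monics j" "d \<in> monics i"
      have "mangoldt b \<le> real (degree b)" using bd(1) by (intro mangoldt_le_degree) (auto simp: monics_def)
      also have "degree b = j" using bd(1) by (simp add: monics_def)
      finally have "mangoldt b \<le> real n" using ij assms(2) by simp
      hence "\<bar>mangoldt b * poly_moebius d\<bar> \<le> (real n + 1) * 1"
        unfolding abs_mult using abs_poly_moebius_le[of d] mangoldt_nonneg[of b] by (intro mult_mono) auto
      moreover have "norm (\<Sum>h\<in>monics (n - (j + i)). \<psi> (QA m c n a (b * d * h))) \<le> ?Z"
        using ij assms(2) by (intro type_I_norm[OF \<psi> monics_mult[OF bd]]) simp
      ultimately show "norm (of_real (mangoldt b * poly_moebius d) *
           (\<Sum>h\<in>monics (n - (j + i)). \<psi> (QA m c n a (b * d * h)))) \<le> (real n + 1) * ?Z"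
        unfolding norm_mult[of "of_real _"] norm_of_real by (intro mult_mono) auto
    qed
    also have "\<dots> = (real n + 1) * (q ^ (i + j) * ?Z)" by (simp add: real_card_monics power_add)
    also have "\<dots> \<le> (real n + 1) * (q ^ (u + v) * ?Z)"
      using ij q_gt_1 by (intro mult_left_mono mult_right_mono power_increasing) auto
    finally show ?thesis .
  qed
  hence "norm (\<Sum>j\<le>v. \<Sum>i\<le>u. \<Sum>b\<in>monics j. \<Sum>d\<in>monics i. of_real (mangoldt b * poly_moebius d) *
           (\<Sum>h\<in>monics (n - (j + i)). \<psi> (QA m c n a (b * d * h))))
      \<le> (\<Sum>j\<le>v. \<Sum>i\<le>u. (real n + 1) * (q ^ (u + v) * ?Z))"
    by (intro sum_norm_le) auto
  also have "\<dots> = real (v + 1) * real (u + 1) * ((real n + 1) * (q ^ (u + v) * ?Z))" by simp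
  also have "\<dots> \<le> (real n + 1) * (real n + 1) * ((real n + 1) * (q ^ (u + v) * ?Z))"
    using assms(2) q_gt_1 by (intro mult_right_mono mult_mono) auto
  finally show ?thesis by (simp add: power3_eq_cube ac_simps)
qed

text \<open>With \<open>n = k + N\<close> the exponent \<open>3 * k + 4 * N\<close> is
  \<open>4 * n - k\<close>, at most \<open>4 * (19 / 20) * n\<close> since
  \<open>k \<ge> n / 5\<close>.\<close>

lemma type_II_norm:
  fixes D X Y :: real and x y :: "'a poly \<Rightarrow> complex"
  assumes \<psi>: "nontrivial_add_char \<psi>" and kN: "k \<le> N" "real (k + N) / 5 \<le> real k"
    and D: "\<And>x :: 'a poly. x \<noteq> 0 \<Longrightarrow> degree x \<le> 2 * N \<Longrightarrow> real (card (mdivs x)) \<le> D" and "D \<ge> 1"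
    and X: "\<And>g. g \<in> monics k \<Longrightarrow> norm (x g) \<le> X"
    and Y: "\<And>h. h \<in> monics N \<Longrightarrow> norm (y h) \<le> Y" and XY: "X \<ge> 0" "Y \<ge> 0"
  shows "norm (\<Sum>g\<in>monics k. \<Sum>h\<in>monics N. x g * y h * \<psi> (QA m c (k + N) a (g * h)))
       \<le> 3 * (X * Y) * D * q ^ (m + 2) * q powr (19 / 20 * real (k + N))"
\<comment> \<open>The rule compares powers with exponent \<open>Suc n\<close>, so this takes fourth
  roots.\<close>
proof (rule power_le_imp_le_base[where n = 3])
  define Z where "Z = q powr (19 / 20 * real (k + N))"
  let ?S = "norm (\<Sum>g\<in>monics k. \<Sum>h\<in>monics N. x g * y h * \<psi> (QA m c (k + N) a (g * h)))"
  have "?S ^ 4 \<le> (X * Y) ^ 4 * (q ^ (3 * k + 4 * N + m + 1) * (D * (2 + q * D)))"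
    using kN by (intro type_II_bound[OF \<psi> _ D X Y]) auto
  also have "\<dots> = (X * Y) ^ 4 * (q ^ (3 * k + 4 * N) * (q ^ (m + 1) * (D * (2 + q * D))))"
    by (simp add: power_add)
  also have "\<dots> \<le> (X * Y) ^ 4 * (Z ^ 4 * (q ^ (m + 1) * (D * (3 * q * D))))"
  proof (intro mult_left_mono mult_mono)
    have "Z ^ 4 = q powr (real 4 * (19 / 20 * real (k + N)))"
      unfolding Z_def using powr_power[of q "19 / 20 * real (k + N)" 4] q_pos by simp
    moreover have "real (3 * k + 4 * N) \<le> real 4 * (19 / 20 * real (k + N))" using kN(2) by simp
    ultimately show "q ^ (3 * k + 4 * N) \<le> Z ^ 4" by (simp only: power_card_le_powr[OF q_gt_1])
    have "1 \<le> q * D" using mult_mono[of 1 q 1 D] q_gt_1 \<open>D \<ge> 1\<close> by simp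
    thus "2 + q * D \<le> 3 * q * D" by linarith
  qed (use q_gt_1 \<open>D \<ge> 1\<close> XY in auto)
  also have "\<dots> = (X * Y * Z) ^ 4 * (3 * q ^ (m + 2) * D ^ 2)"
    by (simp add: power_mult_distrib power_add power2_eq_square)
  \<comment> \<open>A deliberately lossy step: the added factors are at least 1, and the right side
    becomes an exact fourth power.\<close>
  also have "\<dots> \<le> (X * Y * Z) ^ 4 * (3 * q ^ (m + 2) * D) ^ 4"
  proof (rule mult_left_mono)
    have "(3 * q ^ (m + 2) * D) ^ 1 * D \<le> (3 * q ^ (m + 2) * D) ^ 1 * (3 * q ^ (m + 2) * D)"
      using q_gt_1 \<open>D \<ge> 1\<close> one_le_power[of q "m + 2"] by (intro mult_left_mono) auto
    also have "\<dots> = (3 * q ^ (m + 2) * D) ^ 2" by (simp add: power2_eq_square)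
    also have "\<dots> \<le> (3 * q ^ (m + 2) * D) ^ 4"
    proof (rule power_increasing)
      have "1 * 1 \<le> q ^ (m + 2) * D" using q_gt_1 \<open>D \<ge> 1\<close> one_le_power[of q "m + 2"] by (intro mult_mono) auto
      thus "1 \<le> 3 * q ^ (m + 2) * D" by simp
    qed simp
    finally show "3 * q ^ (m + 2) * D ^ 2 \<le> (3 * q ^ (m + 2) * D) ^ 4" by (simp add: power2_eq_square)
  qed simp
  also have "\<dots> = (3 * (X * Y) * D * q ^ (m + 2) * Z) ^ 4" by (simp add: power_mult_distrib)
  finally show "?S ^ Suc 3 \<le> (3 * (X * Y) * D * q ^ (m + 2) * q powr (19 / 20 * real (k + N))) ^ Suc 3"
    by (simp add: Z_def eval_nat_numeral)
  show "0 \<le> 3 * (X * Y) * D * q ^ (m + 2) * q powr (19 / 20 * real (k + N))"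
    using XY \<open>D \<ge> 1\<close> q_pos by (intro mult_nonneg_nonneg) auto
qed

lemma mangoldt_sum_bound:
  fixes D :: real
  assumes \<psi>: "nontrivial_add_char \<psi>" and n: "n \<ge> 1"
    and D: "\<And>x :: 'a poly. x \<noteq> 0 \<Longrightarrow> degree x \<le> 2 * n \<Longrightarrow> real (card (mdivs x)) \<le> D" and "D \<ge> 1"
  shows "norm (\<Sum>f\<in>monics n. of_real (mangoldt f) * \<psi> (QA m c n a f))
       \<le> 5 * (real n + 1) ^ 3 * D ^ 2 * q ^ (m + 2) * q powr (19 / 20 * real n)"
proof -
  define u where "u = n div 5"
  define Z where "Z = q powr (19 / 20 * real n)"
  define W where "W = (real n + 1) ^ 3 * D ^ 2 * q ^ (m + 2) * Z"
  have u5: "real u \<le> real n / 5" "real n / 5 < real (u + 1)"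
  proof -
    have "5 * u \<le> n" "n < 5 * (u + 1)" by (auto simp: u_def)
    hence "real (5 * u) \<le> real n" "real n < real (5 * (u + 1))" by (simp_all only: of_nat_le_iff of_nat_less_iff)
    thus "real u \<le> real n / 5" "real n / 5 < real (u + 1)" by simp_all
  qed
  have D2: "1 \<le> D ^ 2" using \<open>D \<ge> 1\<close> by simp
  \<comment> \<open>The exponents \<open>2 * n / 5\<close> and \<open>n / 2\<close> add up to
    \<open>9 * n / 10\<close>, below \<open>19 * n / 20\<close>; the dependence on \<open>m\<close>
    goes into \<open>q ^ (m + 2)\<close>.\<close>
  have type_I_size: "q ^ t * q powr ((real n + real m) / 2) \<le> q ^ (m + 2) * Z" if "t \<le> u + u" for t
  proof -
    have "q ^ t * q powr ((real n + real m) / 2) \<le> q powr (2 / 5 * real n) * q powr ((real n + real m) / 2)"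
      using that u5(1) by (intro mult_right_mono power_card_le_powr q_gt_1) auto
    also have "\<dots> = q powr (2 / 5 * real n + (real n + real m) / 2)" by (simp add: powr_add)
    also have "\<dots> \<le> q powr (real (m + 2) + 19 / 20 * real n)"
      using q_gt_1 by (intro powr_mono) (auto simp: field_simps)
    also have "\<dots> = q ^ (m + 2) * Z" using q_gt_1 unfolding Z_def powr_add by (subst powr_realpow) auto
    finally show ?thesis .
  qed
  have n1: "1 \<le> real n + 1" by simp
  have W_ge: "(real n + 1) ^ r * (q ^ (m + 2) * Z) \<le> W" if "r \<le> 3" for r
  proof -
    have "(real n + 1) ^ r * 1 \<le> (real n + 1) ^ 3 * D ^ 2"
      using that D2 by (intro mult_mono power_increasing) auto
    hence "(real n + 1) ^ r * (q ^ (m + 2) * Z) \<le> (real n + 1) ^ 3 * D ^ 2 * (q ^ (m + 2) * Z)"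
      using q_gt_1 by (intro mult_right_mono) (auto simp: Z_def)
    thus ?thesis by (simp add: W_def ac_simps)
  qed
  define F where "F f = \<psi> (QA m c n a f)" for f
  have T1: "norm (\<Sum>i\<le>u. of_nat (n - i) * (\<Sum>d\<in>monics i. of_real (poly_moebius d) * (\<Sum>h\<in>monics (n - i). F (d * h)))) \<le> W"
  proof -
    have "u \<le> n" by (simp add: u_def)
    note type_I_first[OF \<psi> this, of a]
    also have "(real n + 1) ^ 2 * (q ^ u * q powr ((real n + real m) / 2)) \<le> (real n + 1) ^ 2 * (q ^ (m + 2) * Z)"
      by (intro mult_left_mono type_I_size) auto
    also have "\<dots> \<le> W" by (rule W_ge) simp
    finally show ?thesis unfolding F_def .
  qed
  have T2: "norm (\<Sum>j\<le>u. \<Sum>i\<le>u. \<Sum>b\<in>monics j. \<Sum>d\<in>monics i. of_real (mangoldt b * poly_moebius d) * (\<Sum>h\<in>monics (n - (j + i)). F (b * d * h))) \<le> W"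
  proof -
    have "u + u \<le> n" by (simp add: u_def)
    note type_I_second[OF \<psi> this, of a]
    also have "(real n + 1) ^ 3 * (q ^ (u + u) * q powr ((real n + real m) / 2)) \<le> (real n + 1) ^ 3 * (q ^ (m + 2) * Z)"
      by (intro mult_left_mono type_I_size) auto
    also have "\<dots> \<le> W" by (rule W_ge) simp
    finally show ?thesis unfolding F_def .
  qed
  have T3: "norm (\<Sum>j\<in>{u<..<n - u}. \<Sum>b\<in>monics j. \<Sum>h\<in>monics (n - j). of_real (mangoldt b) * of_real (trunc_moebius_sum u h) * F (b * h)) \<le> 3 * W"
  proof -
    have "norm (\<Sum>b\<in>monics j. \<Sum>h\<in>monics (n - j). of_real (mangoldt b) * of_real (trunc_moebius_sum u h) * F (b * h))
        \<le> 3 * (real n * D) * D * q ^ (m + 2) * Z" if j: "j \<in> {u<..<n - u}" for j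
    proof -
      have jn: "1 \<le> j" "1 \<le> n - j" "j \<le> n" using j by auto
      \<comment> \<open>Both degrees exceed the cut-off, so they are at least
        \<open>u + 1 > n / 5\<close>; rounding down in \<open>u\<close> is harmless because the
        range of \<open>j\<close> is open at both ends.\<close>
      have big: "real n / 5 \<le> real j" "real n / 5 \<le> real (n - j)"
      proof -
        have "u + 1 \<le> j" "u + 1 \<le> n - j" using j by auto
        hence "real (u + 1) \<le> real j" "real (u + 1) \<le> real (n - j)" by (simp_all only: of_nat_le_iff)
        thus "real n / 5 \<le> real j" "real n / 5 \<le> real (n - j)" using u5(2) by linarith+
      qed
      have lam: "norm (complex_of_real (mangoldt b)) \<le> real n" if "b \<in> monics j" for b :: "'a poly"
      proof -
        have "mangoldt b \<le> real (degree b)" using that by (intro mangoldt_le_degree) (auto simp: monics_def)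
        thus ?thesis using that jn mangoldt_nonneg[of b] by (auto simp: monics_def)
      qed
      have tm: "norm (complex_of_real (trunc_moebius_sum u h)) \<le> D" if "h \<in> monics (n - j)" for h :: "'a poly"
      proof -
        have "real (card (mdivs h)) \<le> D"
          using that monics_nonzero[OF that] by (intro D) (auto simp: monics_def)
        thus ?thesis using abs_trunc_moebius_sum_le[of u h] by simp
      qed
      have nD: "real n \<ge> 0" "D \<ge> 0" using \<open>D \<ge> 1\<close> by simp_all
      show ?thesis
      \<comment> \<open>The Type II estimate needs the factor of smaller degree as \<open>g\<close>;
        otherwise the two factors, with their coefficients, change places.\<close>
      proof (cases "j \<le> n - j")
        case True
        have "norm (\<Sum>b\<in>monics j. \<Sum>h\<in>monics (n - j). of_real (mangoldt b) * of_real (trunc_moebius_sum u h) * \<psi> (QA m c (j + (n - j)) a (b * h)))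
            \<le> 3 * (real n * D) * D * q ^ (m + 2) * q powr (19 / 20 * real (j + (n - j)))"
          by (rule type_II_norm[OF \<psi> True _ D \<open>D \<ge> 1\<close> lam tm nD]) (use big jn in auto)
        thus ?thesis using jn by (simp add: F_def Z_def)
      next
        case False
        hence le: "n - j \<le> j" by simp
        have "norm (\<Sum>h\<in>monics (n - j). \<Sum>b\<in>monics j. of_real (trunc_moebius_sum u h) * of_real (mangoldt b) * \<psi> (QA m c (n - j + j) a (h * b)))
            \<le> 3 * (D * real n) * D * q ^ (m + 2) * q powr (19 / 20 * real (n - j + j))"
          by (rule type_II_norm[OF \<psi> le _ D \<open>D \<ge> 1\<close> tm lam nD(2,1)]) (use big jn in auto)
        moreover have "(\<Sum>b\<in>monics j. \<Sum>h\<in>monics (n - j). of_real (mangoldt b) * of_real (trunc_moebius_sum u h) * F (b * h))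
            = (\<Sum>h\<in>monics (n - j). \<Sum>b\<in>monics j. of_real (trunc_moebius_sum u h) * of_real (mangoldt b) * \<psi> (QA m c (n - j + j) a (h * b)))"
          using jn by (subst sum.swap) (simp add: F_def mult.commute)
        ultimately show ?thesis using jn by (simp add: Z_def mult.commute)
      qed
    qed
    hence "norm (\<Sum>j\<in>{u<..<n - u}. \<Sum>b\<in>monics j. \<Sum>h\<in>monics (n - j). of_real (mangoldt b) * of_real (trunc_moebius_sum u h) * F (b * h))
        \<le> (\<Sum>j\<in>{u<..<n - u}. 3 * (real n * D) * D * q ^ (m + 2) * Z)"
      by (rule sum_norm_le)
    also have "\<dots> = real (card {u<..<n - u}) * (3 * (real n * D) * D * q ^ (m + 2) * Z)" by simp
    also have "\<dots> \<le> (real n + 1) ^ 2 * (3 * (real n * D) * D * q ^ (m + 2) * Z)"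
    proof (rule mult_right_mono)
      have "real (card {u<..<n - u}) \<le> (real n + 1) ^ 1" by simp
      also have "\<dots> \<le> (real n + 1) ^ 2" by (intro power_increasing) auto
      finally show "real (card {u<..<n - u}) \<le> (real n + 1) ^ 2" .
    qed (use \<open>D \<ge> 1\<close> q_gt_1 in \<open>auto simp: Z_def\<close>)
    also have "\<dots> \<le> (real n + 1) ^ 2 * (3 * ((real n + 1) * D) * D * q ^ (m + 2) * Z)"
      using \<open>D \<ge> 1\<close> q_gt_1 by (intro mult_left_mono mult_right_mono) (auto simp: Z_def)
    also have "\<dots> = 3 * W" by (simp add: W_def power2_eq_square power3_eq_cube)
    finally show ?thesis .
  qed
  have "(\<Sum>f\<in>monics n. of_real (mangoldt f) * F f)
    = (\<Sum>i\<le>u. of_nat (n - i) * (\<Sum>d\<in>monics i. of_real (poly_moebius d) * (\<Sum>h\<in>monics (n - i). F (d * h))))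
    - (\<Sum>j\<le>u. \<Sum>i\<le>u. \<Sum>b\<in>monics j. \<Sum>d\<in>monics i. of_real (mangoldt b * poly_moebius d) * (\<Sum>h\<in>monics (n - (j + i)). F (b * d * h)))
    - (\<Sum>j\<in>{u<..<n - u}. \<Sum>b\<in>monics j. \<Sum>h\<in>monics (n - j). of_real (mangoldt b) * of_real (trunc_moebius_sum u h) * F (b * h))"
    (is "_ = ?A - ?B - ?C") using n by (intro vaughan_identity) (auto simp: u_def)
  hence "norm (\<Sum>f\<in>monics n. of_real (mangoldt f) * F f) \<le> norm ?A + norm ?B + norm ?C"
    using norm_triangle_ineq4[of "?A - ?B" ?C] norm_triangle_ineq4[of ?A ?B] by simp
  also have "\<dots> \<le> W + W + 3 * W" by (intro add_mono T1 T2 T3)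
  also have "\<dots> = 5 * W" by simp
  finally show ?thesis by (simp only: W_def F_def Z_def mult.assoc)
qed


section \<open>From von Mangoldt weights to irreducible polynomials and to the count\<close>

lemma monic_irred_subset: "monic_irred n \<subseteq> monics n"
  by (auto simp: monic_irred_def monics_def)

text \<open>A proper power of degree \<open>n\<close> has a base of degree at most
  \<open>n div 2\<close>, and the base determines the exponent as
  \<open>n div degree p\<close>.\<close>

lemma card_prime_powers_le:
  assumes "n \<ge> 1"
  shows "real (card {f \<in> monics n. mangoldt f \<noteq> 0 \<and> \<not> irreducible (f :: 'a poly)}) \<le> (real n + 1) * q powr (real n / 2)"
proof -
  define P where "P = {f \<in> monics n. mangoldt f \<noteq> 0 \<and> \<not> irreducible (f :: 'a poly)}"
  define U where "U = (\<Union>i\<le>n div 2. monics i :: 'a poly set)"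
  have sub: "P \<subseteq> (\<lambda>p. p ^ (n div degree p)) ` U"
  proof
    fix f assume f: "f \<in> P"
    hence "mangoldt f \<noteq> 0" by (simp add: P_def)
    then obtain p j where pj: "monic_prime p" "j \<ge> 1" "f = p ^ j" by (rule mangoldt_nonzero_imp)
    have "j \<noteq> 1" using f pj by (auto simp: P_def)
    hence j2: "j \<ge> 2" using pj by simp
    have "p \<noteq> 0" using pj(1) by auto
    hence "degree f = j * degree p" using pj(3) by (simp add: degree_power_eq)
    hence n: "n = j * degree p" using f by (simp add: P_def monics_def)
    have dp: "degree p > 0" using monic_prime_degree_pos[OF pj(1)] .
    have "2 * degree p \<le> n" using j2 by (simp add: n)
    hence "p \<in> U" using pj(1) by (auto simp: U_def monics_def)
    moreover have "n div degree p = j" using dp by (simp add: n)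
    ultimately show "f \<in> (\<lambda>p. p ^ (n div degree p)) ` U" using pj(3) by (intro image_eqI[of _ _ p]) auto
  qed
  have "card P \<le> card ((\<lambda>p. p ^ (n div degree p)) ` U)" by (intro card_mono sub) (simp add: U_def)
  also have "\<dots> \<le> card U" by (intro card_image_le) (simp add: U_def)
  also have "\<dots> \<le> (\<Sum>i\<le>n div 2. card (monics i :: 'a poly set))" unfolding U_def by (intro card_UN_le) simp
  finally have "real (card P) \<le> real (\<Sum>i\<le>n div 2. card (monics i :: 'a poly set))" by (rule of_nat_mono)
  also have "\<dots> = (\<Sum>i\<le>n div 2. q ^ i)" by (simp add: real_card_monics)
  also have "\<dots> \<le> (\<Sum>i\<le>n div 2. q powr (real n / 2))"
    by (intro sum_mono power_card_le_powr q_gt_1) auto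
  also have "\<dots> = real (n div 2 + 1) * q powr (real n / 2)" by simp
  also have "\<dots> \<le> (real n + 1) * q powr (real n / 2)" by (intro mult_right_mono) auto
  finally show ?thesis unfolding P_def .
qed

text \<open>On irreducibles of degree \<open>n\<close> the von Mangoldt weight is the constant
  \<open>n\<close>, so removing it is a mere division; the proper prime powers contribute only about
  \<open>q powr (n / 2)\<close>.\<close>

lemma prime_sum_bound:
  fixes D :: real
  assumes \<psi>: "nontrivial_add_char \<psi>" and n: "n \<ge> 1"
    and D: "\<And>x :: 'a poly. x \<noteq> 0 \<Longrightarrow> degree x \<le> 2 * n \<Longrightarrow> real (card (mdivs x)) \<le> D" and "D \<ge> 1"
  shows "norm (\<Sum>f\<in>monic_irred n. \<psi> (QA m c n a f))
       \<le> 6 * (real n + 1) ^ 3 * D ^ 2 * q ^ (m + 2) * q powr (19 / 20 * real n)"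
proof -
  define Z where "Z = q powr (19 / 20 * real n)"
  define V where "V = (real n + 1) ^ 3 * (D ^ 2 * (q ^ (m + 2) * Z))"
  define F where "F f = \<psi> (QA m c n a f)" for f
  define R where "R = {f \<in> monics n. mangoldt f \<noteq> 0 \<and> \<not> irreducible (f :: 'a poly)}"
  have fin: "finite R" by (simp add: R_def)
  have "(\<Sum>f\<in>monics n. of_real (mangoldt f) * F f) = (\<Sum>f\<in>monic_irred n \<union> R. of_real (mangoldt f) * F f)"
    by (rule sum.mono_neutral_right[OF finite_monics]) (auto simp: R_def monic_irred_def monics_def)
  also have "\<dots> = (\<Sum>f\<in>monic_irred n. of_real (mangoldt f) * F f) + (\<Sum>f\<in>R. of_real (mangoldt f) * F f)"
    using finite_subset[OF monic_irred_subset finite_monics] fin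
    by (intro sum.union_disjoint) (auto simp: R_def monic_irred_def)
  also have "(\<Sum>f\<in>monic_irred n. of_real (mangoldt f) * F f) = of_nat n * (\<Sum>f\<in>monic_irred n. F f)"
    unfolding sum_distrib_left by (intro sum.cong refl) (auto simp: monic_irred_def mangoldt_prime)
  finally have split: "of_nat n * (\<Sum>f\<in>monic_irred n. F f)
      = (\<Sum>f\<in>monics n. of_real (mangoldt f) * F f) - (\<Sum>f\<in>R. of_real (mangoldt f) * F f)" by simp
  have "norm (\<Sum>f\<in>R. of_real (mangoldt f) * F f) \<le> (\<Sum>f\<in>R. real n + 1)"
  proof (rule sum_norm_le)
    fix f assume "f \<in> R"
    hence f: "lead_coeff f = 1" "degree f = n" by (auto simp: R_def monics_def)
    have "mangoldt f \<le> real n" using mangoldt_le_degree[OF f(1)] f(2) by simp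
    thus "norm (of_real (mangoldt f) * F f) \<le> real n + 1"
      using mangoldt_nonneg[of f] by (simp add: norm_mult F_def add_char_simps(2)[OF \<psi>])
  qed
  also have "\<dots> = real (card R) * (real n + 1)" by simp
  also have "\<dots> \<le> ((real n + 1) * q powr (real n / 2)) * (real n + 1)"
    unfolding R_def by (intro mult_right_mono card_prime_powers_le n) auto
  also have "\<dots> = (real n + 1) ^ 2 * q powr (real n / 2)" by (simp add: power2_eq_square)
  also have "\<dots> \<le> V"
    unfolding V_def
  proof (intro mult_mono)
    show "(real n + 1)\<^sup>2 \<le> (real n + 1) ^ 3" by (intro power_increasing) auto
    have "q powr (real n / 2) \<le> Z" unfolding Z_def using q_gt_1 by (intro powr_mono) auto
    moreover have "1 * (1 * Z) \<le> D ^ 2 * (q ^ (m + 2) * Z)"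
      using \<open>D \<ge> 1\<close> q_gt_1 one_le_power[of q "m + 2"] by (intro mult_mono) (auto simp: Z_def)
    ultimately show "q powr (real n / 2) \<le> D ^ 2 * (q ^ (m + 2) * Z)" by simp
  qed auto
  finally have R_le: "norm (\<Sum>f\<in>R. of_real (mangoldt f) * F f) \<le> V" .
  have "norm (\<Sum>f\<in>monics n. of_real (mangoldt f) * F f) \<le> 5 * (real n + 1) ^ 3 * D ^ 2 * q ^ (m + 2) * Z"
    unfolding F_def Z_def by (rule mangoldt_sum_bound[OF \<psi> n D \<open>D \<ge> 1\<close>])
  hence main: "norm (\<Sum>f\<in>monics n. of_real (mangoldt f) * F f) \<le> 5 * V"
    by (simp only: V_def mult.assoc)
  have "1 * norm (\<Sum>f\<in>monic_irred n. F f) \<le> real n * norm (\<Sum>f\<in>monic_irred n. F f)"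
    using n by (intro mult_right_mono) auto
  also have "\<dots> = norm (of_nat n * (\<Sum>f\<in>monic_irred n. F f))" by (simp only: norm_mult norm_of_nat)
  also have "\<dots> \<le> 5 * V + V"
    unfolding split by (rule order_trans[OF norm_triangle_ineq4 add_mono[OF main R_le]])
  also have "\<dots> = 6 * V" by simp
  finally show ?thesis by (simp only: V_def Z_def F_def mult.assoc mult_1)
qed

text \<open>The zero frequency gives the main term. A nonzero frequency \<alpha> turns \<psi> into
  another nontrivial character, hence \<open>E\<close> must serve all of them; the shift by \<gamma>
  is a factor of modulus one.\<close>

lemma count_via_char:
  fixes \<psi> :: "'a \<Rightarrow> complex"
  assumes \<psi>: "nontrivial_add_char \<psi>"
    and E: "\<And>\<psi> :: 'a \<Rightarrow> complex. nontrivial_add_char \<psi> \<Longrightarrow> norm (\<Sum>f\<in>monic_irred n. \<psi> (QA m c n a f)) \<le> E"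
  shows "\<bar>real (card {f \<in> monic_irred n. QA m c n a f = \<gamma>}) - real (card (monic_irred n :: 'a poly set)) / q\<bar> \<le> E"
proof -
  let ?P = "monic_irred n :: 'a poly set"
  let ?Q = "\<lambda>f. QA m c n a f"
  have fin: "finite ?P" using finite_subset[OF monic_irred_subset finite_monics] .
  let ?N = "real (card {f \<in> ?P. ?Q f = \<gamma>})"
  have E0: "E \<ge> 0" using E[OF \<psi>] norm_ge_zero order_trans by blast
  have "complex_of_real (q * ?N) = (\<Sum>f\<in>?P. if ?Q f - \<gamma> = 0 then of_nat (card (UNIV :: 'a set)) else 0)"
    using fin by (simp add: q_def sum.If_cases Int_def)
  also have "\<dots> = (\<Sum>f\<in>?P. \<Sum>\<alpha>\<in>UNIV. \<psi> (\<alpha> * (?Q f - \<gamma>)))"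
    by (simp only: sum_UNIV_add_char[OF \<psi>])
  also have "\<dots> = (\<Sum>\<alpha>\<in>UNIV. \<Sum>f\<in>?P. \<psi> (\<alpha> * (?Q f - \<gamma>)))" by (rule sum.swap)
  also have "\<dots> = (\<Sum>f\<in>?P. \<psi> (0 * (?Q f - \<gamma>))) + (\<Sum>\<alpha>\<in>UNIV - {0}. \<Sum>f\<in>?P. \<psi> (\<alpha> * (?Q f - \<gamma>)))"
    by (rule sum.remove) auto
  also have "(\<Sum>f\<in>?P. \<psi> (0 * (?Q f - \<gamma>))) = of_nat (card ?P)" by (simp add: add_char_simps[OF \<psi>])
  finally have eq: "complex_of_real (q * ?N - real (card ?P)) = (\<Sum>\<alpha>\<in>UNIV - {0}. \<Sum>f\<in>?P. \<psi> (\<alpha> * (?Q f - \<gamma>)))"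
    by simp
  have "\<bar>q * ?N - real (card ?P)\<bar> = norm (\<Sum>\<alpha>\<in>UNIV - {0}. \<Sum>f\<in>?P. \<psi> (\<alpha> * (?Q f - \<gamma>)))"
    unfolding eq[symmetric] norm_of_real ..
  also have "\<dots> \<le> (\<Sum>\<alpha>\<in>UNIV - {0 :: 'a}. E)"
  proof (rule sum_norm_le)
    fix \<alpha> :: 'a assume \<alpha>: "\<alpha> \<in> UNIV - {0}"
    have "(\<Sum>f\<in>?P. \<psi> (\<alpha> * (?Q f - \<gamma>))) = cnj (\<psi> (\<alpha> * \<gamma>)) * (\<Sum>f\<in>?P. \<psi> (\<alpha> * ?Q f))"
      by (simp add: right_diff_distrib add_char_simps(5)[OF \<psi>] sum_distrib_left mult.commute)
    hence "norm (\<Sum>f\<in>?P. \<psi> (\<alpha> * (?Q f - \<gamma>))) = norm (\<Sum>f\<in>?P. \<psi> (\<alpha> * ?Q f))"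
      by (simp add: norm_mult add_char_simps(2)[OF \<psi>])
    also have "\<dots> \<le> E" using \<alpha> by (intro E[of "\<lambda>x. \<psi> (\<alpha> * x)"] nontrivial_add_char_scale[OF \<psi>]) simp
    finally show "norm (\<Sum>f\<in>?P. \<psi> (\<alpha> * (?Q f - \<gamma>))) \<le> E" .
  qed
  also have "\<dots> = real (card (UNIV - {0 :: 'a})) * E" by simp
  also have "\<dots> \<le> q * E"
    unfolding q_def by (intro mult_right_mono E0 of_nat_mono card_mono) auto
  finally have "\<bar>q * ?N - real (card ?P)\<bar> \<le> q * E" .
  moreover have "\<bar>q * ?N - real (card ?P)\<bar> = q * \<bar>?N - real (card ?P) / q\<bar>"
    using q_pos by (simp add: abs_mult_pos' right_diff_distrib)
  ultimately show ?thesis using q_pos by simp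
qed

lemma count_bound:
  assumes "\<delta> > 0"
  shows "\<exists>C. \<forall>n\<ge>1. \<forall>x :: (nat \<Rightarrow> 'a) \<times> 'a.
     \<bar>real (card {f \<in> monic_irred n. QA m c n (fst x) f = snd x}) - real (card (monic_irred n :: 'a poly set)) / q\<bar>
       \<le> C * q powr ((19 / 20 + \<delta>) * real n)"
proof -
  \<comment> \<open>Seven losses of size \<open>y = q powr (\<eta> * n)\<close> occur: three in
    \<open>(real n + 1) ^ 3\<close> and four in \<open>D ^ 2\<close>, because \<open>D\<close>
    bounds divisor counts up to degree \<open>2 * n\<close> and so contains
    \<open>y ^ 2\<close>.\<close>
  define \<eta> where "\<eta> = \<delta> / 7"
  have \<eta>: "\<eta> > 0" using assms by (simp add: \<eta>_def)
  obtain C0 where C0: "C0 \<ge> 1"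
    "\<And>f::'a poly. f \<noteq> 0 \<Longrightarrow> real (card (mdivs f)) \<le> C0 * q powr (\<eta> * real (degree f))"
    using card_mdivs_bound[OF q_gt_1 \<eta>] by blast
  obtain B where B: "B \<ge> 1" "\<And>n::nat. real n + 1 \<le> B * q powr (\<eta> * real n)"
    using linear_le_powr[OF q_gt_1 \<eta>] by blast
  obtain \<psi> :: "'a \<Rightarrow> complex" where \<psi>: "nontrivial_add_char \<psi>" using exists_nontrivial_add_char by blast
  show ?thesis
  proof (intro exI[of _ "6 * B ^ 3 * C0 ^ 2 * q ^ (m + 2)"] allI impI)
    fix n :: nat and x :: "(nat \<Rightarrow> 'a) \<times> 'a" assume n: "n \<ge> 1"
    define y where "y = q powr (\<eta> * real n)"
    define Z where "Z = q powr (19 / 20 * real n)"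
    have y1: "y \<ge> 1" unfolding y_def using q_gt_1 \<eta> by (intro ge_one_powr_ge_zero) auto
    have y2: "q powr (\<eta> * real (2 * n)) = y ^ 2"
      unfolding y_def power2_eq_square powr_add[symmetric] by (simp add: algebra_simps)
    define D where "D = C0 * y ^ 2"
    have D: "real (card (mdivs f)) \<le> D" if "f \<noteq> 0" "degree f \<le> 2 * n" for f :: "'a poly"
    proof -
      have "real (card (mdivs f)) \<le> C0 * q powr (\<eta> * real (degree f))" by (rule C0(2)[OF that(1)])
      also have "\<dots> \<le> C0 * q powr (\<eta> * real (2 * n))"
        using that(2) C0(1) \<eta> q_gt_1 by (intro mult_left_mono powr_mono) (auto simp del: of_nat_mult)
      finally show ?thesis by (simp only: D_def y2)
    qed
    have "1 * 1 \<le> C0 * y ^ 2" using C0(1) y1 by (intro mult_mono) auto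
    hence D1: "D \<ge> 1" by (simp add: D_def)
    have "\<bar>real (card {f \<in> monic_irred n. QA m c n (fst x) f = snd x}) - real (card (monic_irred n :: 'a poly set)) / q\<bar>
        \<le> 6 * (real n + 1) ^ 3 * D ^ 2 * q ^ (m + 2) * Z"
      unfolding Z_def by (rule count_via_char[OF \<psi>]) (rule prime_sum_bound[OF _ n D D1])
    also have "\<dots> \<le> 6 * (B * y) ^ 3 * D ^ 2 * q ^ (m + 2) * Z"
      using B(2)[of n] q_pos by (intro mult_right_mono mult_left_mono power_mono) (auto simp: y_def Z_def)
    also have "\<dots> = 6 * B ^ 3 * C0 ^ 2 * q ^ (m + 2) * (y ^ 7 * Z)"
      by (simp add: D_def power_mult_distrib eval_nat_numeral)
    also have "y ^ 7 * Z = q powr ((19 / 20 + \<delta>) * real n)"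
    proof -
      have "y ^ 7 = q powr (real 7 * (\<eta> * real n))" unfolding y_def using powr_power[of q "\<eta> * real n" 7] q_pos by simp
      hence "y ^ 7 * Z = q powr (real 7 * (\<eta> * real n) + 19 / 20 * real n)" by (simp only: Z_def powr_add)
      also have "real 7 * (\<eta> * real n) + 19 / 20 * real n = (19 / 20 + \<delta>) * real n"
        by (simp add: \<eta>_def field_simps)
      finally show ?thesis .
    qed
    finally show "\<bar>real (card {f \<in> monic_irred n. QA m c n (fst x) f = snd x}) - real (card (monic_irred n :: 'a poly set)) / q\<bar>
        \<le> 6 * B ^ 3 * C0 ^ 2 * q ^ (m + 2) * q powr ((19 / 20 + \<delta>) * real n)" .
  qed
qed

end

theorem theorem1p1:
  fixes m :: nat and c :: "nat \<Rightarrow> 'a::{finite,field}"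
  assumes "odd (card (UNIV :: 'a set))"
    and "c m \<noteq> 0"
  shows "\<exists>C::real. \<exists>\<epsilon>::nat \<Rightarrow> real. \<exists>N::nat. \<epsilon> \<longlonglongrightarrow> 0 \<and>
    (\<forall>n\<ge>N. \<forall>a::nat \<Rightarrow> 'a. \<forall>\<gamma>::'a.
       \<bar>real (card {f \<in> monic_irred n. QA m c n a f = \<gamma>})
          - real (card (monic_irred n :: 'a poly set)) / real (card (UNIV :: 'a set))\<bar>
       \<le> C * real (card (UNIV :: 'a set)) powr (19 / 20 * real n + \<epsilon> n * real n))"
proof -
  interpret quadratic_form m c "real (card (UNIV :: 'a set))"
    by unfold_locales (use assms in auto)
  \<comment> \<open>The linear form and the target value are packed into one parameter
    \<open>x\<close>, so that a single \<epsilon> serves all of them.\<close>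
  define e where "e n x = \<bar>real (card {f \<in> monic_irred n. QA m c n (fst x) f = snd x})
      - real (card (monic_irred n :: 'a poly set)) / real (card (UNIV :: 'a set))\<bar>" for n x
  have "\<exists>\<epsilon> N. \<epsilon> \<longlonglongrightarrow> 0 \<and> (\<forall>n\<ge>N. \<forall>x. e n x \<le> real (card (UNIV :: 'a set)) powr (19 / 20 * real n + \<epsilon> n * real n))"
    by (rule exists_vanishing_exponent[OF q_gt_1]) (unfold e_def, rule count_bound)
  then obtain \<epsilon> N where \<epsilon>: "\<epsilon> \<longlonglongrightarrow> 0" and
    bound: "\<And>n x. n \<ge> N \<Longrightarrow> e n x \<le> real (card (UNIV :: 'a set)) powr (19 / 20 * real n + \<epsilon> n * real n)"
    by blast
  show ?thesis
  \<comment> \<open>The constant can be 1, as every constant factor has been absorbed into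
    \<epsilon>.\<close>
  proof (rule exI[of _ 1], rule exI[of _ \<epsilon>], rule exI[of _ N], intro conjI allI impI \<epsilon>)
    fix n :: nat and a :: "nat \<Rightarrow> 'a" and \<gamma> :: 'a assume "n \<ge> N"
    from bound[OF this, of "(a, \<gamma>)"]
    show "\<bar>real (card {f \<in> monic_irred n. QA m c n a f = \<gamma>})
          - real (card (monic_irred n :: 'a poly set)) / real (card (UNIV :: 'a set))\<bar>
       \<le> 1 * real (card (UNIV :: 'a set)) powr (19 / 20 * real n + \<epsilon> n * real n)" by (simp add: e_def)
  qed
qed

end
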